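(* Let $B$ be a closed manifold endowed with an almost contact-symplectic structure $(\beta,\eta,\psi)$ such that $\eta$ represents an integral cohomology class, and let $\pi:M\to B$ be the corresponding Boothby--Wang fibration, endowed with its $\mathbb{S}^1$-invariant contact pair structure $(\alpha_1,\alpha_2,\phi)$. Suppose that $\eta$ is invariant under $\psi$, i.e. $\eta(\psi X,\psi Y)=\eta(X,Y)$ for all vector fields $X,Y$ on $B$, and that $\psi$ is decomposable. Then the contact pair structure $(\alpha_1,\alpha_2,\phi)$ on $M$ is normal if and only if the almost contact structure $(\beta,W,\psi)$ on $B$ is normal, where $W$ is the Reeb vector field of $(\beta,\eta)$.
   Context: All objects are smooth. Contact-symplectic pairs. A contact-symplectic pair of type $(h,k)$ on a $(2h+2k+1)$-dimensional manifold $B$ consists of a $1$-form $\beta$ and a closed $2$-form $\eta$ such that $\beta\wedge(d\beta)^h\wedge\eta^k$ is a volume form, $(d\beta)^{h+1}=0$ and $\eta^{k+1}=0$. Its Reeb vector field $W$ is uniquely defined by $\beta(W)=1$, $i_Wd\beta=i_W\eta=0$. Its characteristic foliations are the foliation with tangent distribution $\ker\eta=\{v: i_v\eta=0\}$ and the foliation with tangent distribution $\ker\beta\cap\ker d\beta$. An almost contact-symplectic structure is a triple $(\beta,\eta,\psi)$ with $(\beta,\eta)$ a contact-symplectic pair and $\psi$ an endomorphism of $TB$ with $\psi^2=-\mathrm{Id}+\beta\otimes W$; then $(\beta,W,\psi)$ is an almost contact structure. The endomorphism $\psi$ is decomposable if it preserves the tangent distributions of both characteristic foliations. Almost contact structures.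 An almost contact structure on a manifold $N$ is a triple $(\alpha,Z,\phi)$ of a $1$-form, a vector field and a field of endomorphisms of $TN$ with $\phi^2=-\mathrm{Id}+\alpha\otimes Z$, $\phi(Z)=0$, $\alpha(Z)=1$. It is normal if the almost complex structure on $N\times\mathbb{R}$ given by $X+f\frac{d}{dt}\mapsto \phi X-fZ+\alpha(X)\frac{d}{dt}$ is integrable. Contact pairs. A contact pair of type $(h,k)$ on a $(2h+2k+2)$-dimensional manifold $M$ is a pair $(\alpha_1,\alpha_2)$ of $1$-forms such that $\alpha_1\wedge(d\alpha_1)^h\wedge\alpha_2\wedge(d\alpha_2)^k$ is a volume form, $(d\alpha_1)^{h+1}=0$ and $(d\alpha_2)^{k+1}=0$. Its Reeb vector fields $Z_1,Z_2$ are uniquely determined by $\alpha_i(Z_j)=\delta_{ij}$ and $i_{Z_j}d\alpha_i=0$ for $i,j\in\{1,2\}$. A contact pair structure on $M$ is a triple $(\alpha_1,\alpha_2,\phi)$ where $(\alpha_1,\alpha_2)$ is a contact pair and $\phi$ is a tensor field of type $(1,1)$ with $\phi^2=-\mathrm{Id}+\alpha_1\otimes Z_1+\alpha_2\otimes Z_2$ and $\phi(Z_1)=\phi(Z_2)=0$. To it are associated the almost complex structures $J=\phi-\alpha_2\otimes Z_1+\alpha_1\otimes Z_2$ and $T=\phi+\alpha_2\otimes Z_1-\alpha_1\otimes Z_2$. The contact pair structure is normal if $J$ and $T$ are both integrable (vanishing Nijenhuis tensors). Boothby--Wang fibration. If the closed $2$-form $\eta$ on the closed manifold $B$ represents an integral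 class, the corresponding Boothby--Wang fibration is the principal $\mathbb{S}^1$-bundle $\pi:M\to B$ with Euler class $[\eta]$, endowed with a connection $1$-form $\alpha_1$ with curvature $\eta$, i.e. $d\alpha_1=\pi^*\eta$ (regarded as a real-valued $\mathbb{S}^1$-invariant $1$-form, normalized to equal $1$ on the generator of the circle action, up to the choice of normalization of the period). The $\mathbb{S}^1$-invariant contact pair structure on $M$ is $(\alpha_1,\alpha_2,\phi)$ with $\alpha_2=\pi^*\beta$ and $\phi_pX=(\psi\,\pi_*X)^*_p$ for $X\in T_pM$, where $Y^*_p\in\ker\alpha_1$ denotes the horizontal lift at $p$ of a vector $Y\in T_{\pi(p)}B$. *)

theory Defs
  imports
    "HOL-Analysis.Analysis"
    "HOL-Combinatorics.Permutations"
    "HOL-Homology.Homology"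
    "HOL-Library.Function_Algebras"
begin

section \<open>Functions with values in a real vector space\<close>

instantiation "fun" :: (type, real_vector) real_vector
begin

definition scaleR_fun :: "real \<Rightarrow> ('a \<Rightarrow> 'b) \<Rightarrow> 'a \<Rightarrow> 'b"
  where "scaleR_fun c f = (\<lambda>x. c *\<^sub>R f x)"

instance
  by standard (simp_all add: scaleR_fun_def fun_eq_iff scaleR_add_right scaleR_add_left)

end


section \<open>Smooth manifolds and smooth maps\<close>

primrec Ck_on :: "nat \<Rightarrow> 'a::euclidean_space set \<Rightarrow> ('a \<Rightarrow> 'b::real_normed_vector) \<Rightarrow> bool" where
  "Ck_on 0 S f \<longleftrightarrow> continuous_on S f"
| "Ck_on (Suc n) S f \<longleftrightarrow>
     (\<forall>x\<in>S. f differentiable (at x)) \<and> (\<forall>v. Ck_on n S (\<lambda>x. frechet_derivative f (at x) v))"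

text \<open>Meaningful for open \<open>S\<close> only.\<close>

definition smooth_on :: "'a::euclidean_space set \<Rightarrow> ('a \<Rightarrow> 'b::real_normed_vector) \<Rightarrow> bool"
  where "smooth_on S f \<longleftrightarrow> (\<forall>n. Ck_on n S f)"

text \<open>
  The underlying set of a manifold is a whole type \<open>'m\<close>, and the model space is \<open>'e\<close>, so that the
  dimension is \<open>DIM('e)\<close>. A chart is a pair of a domain and a coordinate map, whose values outside
  the domain are irrelevant.
\<close>

type_synonym ('m, 'e) atlas = "('m set \<times> ('m \<Rightarrow> 'e)) set"

definition smooth_manifold ::
    "('m::{t2_space,second_countable_topology}, 'e::euclidean_space) atlas \<Rightarrow> bool" where
  "smooth_manifold A \<longleftrightarrow>
     (\<Union>(U, \<phi>)\<in>A. U) = UNIV \<and>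
     (\<forall>(U, \<phi>)\<in>A. open U \<and> open (\<phi> ` U) \<and> homeomorphism U (\<phi> ` U) \<phi> (inv_into U \<phi>)) \<and>
     (\<forall>(U, \<phi>)\<in>A. \<forall>(V, \<xi>)\<in>A. smooth_on (\<phi> ` (U \<inter> V)) (\<xi> \<circ> inv_into U \<phi>))"

definition std_atlas :: "('e, 'e::euclidean_space) atlas"
  where "std_atlas = {(UNIV, \<lambda>x. x)}"

definition prod_atlas ::
    "('m, 'e) atlas \<Rightarrow> ('n, 'f) atlas \<Rightarrow> ('m \<times> 'n, 'e \<times> 'f) atlas" where
  "prod_atlas A A' = {(U \<times> V, map_prod \<phi> \<xi>) | U \<phi> V \<xi>. (U, \<phi>) \<in> A \<and> (V, \<xi>) \<in> A'}"

definition smooth_at ::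
    "('m::topological_space, 'e::euclidean_space) atlas \<Rightarrow>
     ('n::topological_space, 'f::euclidean_space) atlas \<Rightarrow> ('m \<Rightarrow> 'n) \<Rightarrow> 'm \<Rightarrow> bool" where
  "smooth_at A A' F p \<longleftrightarrow>
     (\<exists>(U, \<phi>)\<in>A. \<exists>(V, \<xi>)\<in>A'. \<exists>N. open N \<and> p \<in> N \<and> N \<subseteq> U \<and> F ` N \<subseteq> V \<and>
        smooth_on (\<phi> ` N) (\<xi> \<circ> F \<circ> inv_into U \<phi>))"

abbreviation smooth_fun_at ::
    "('m::topological_space, 'e::euclidean_space) atlas \<Rightarrow> ('m \<Rightarrow> real) \<Rightarrow> 'm \<Rightarrow> bool"
  where "smooth_fun_at A f p \<equiv> smooth_at A std_atlas f p"


section \<open>Tangent vectors and vector fields\<close>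

text \<open>
  A tangent vector at \<open>p\<close> is a derivation at \<open>p\<close> of the algebra of functions that are smooth in a
  neighbourhood of \<open>p\<close>; for such a derivation, the value at \<open>f\<close> depends only on the germ of \<open>f\<close>.
  On all other functions it is set to 0, so that equality of tangent vectors is equality in HOL.
\<close>

type_synonym 'm tvec = "('m \<Rightarrow> real) \<Rightarrow> real"
type_synonym 'm vfield = "'m \<Rightarrow> 'm tvec"

definition tangent_space ::
    "('m::topological_space, 'e::euclidean_space) atlas \<Rightarrow> 'm \<Rightarrow> 'm tvec set" where
  "tangent_space A p =
     {v. (\<forall>f. \<not> smooth_fun_at A f p \<longrightarrow> v f = 0) \<and>
         (\<forall>f c. smooth_fun_at A f p \<longrightarrow> v (\<lambda>x. c * f x) = c * v f) \<and>
         (\<forall>f g. smooth_fun_at A f p \<longrightarrow> smooth_fun_at A g p \<longrightarrow>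
            v (\<lambda>x. f x + g x) = v f + v g \<and> v (\<lambda>x. f x * g x) = f p * v g + g p * v f)}"

definition push_forward ::
    "('n::topological_space, 'f::euclidean_space) atlas \<Rightarrow> ('m \<Rightarrow> 'n) \<Rightarrow> 'm \<Rightarrow> 'm tvec \<Rightarrow> 'n tvec"
  where "push_forward A' F p v = (\<lambda>f. if smooth_fun_at A' f (F p) then v (f \<circ> F) else 0)"

definition velocity ::
    "('m::topological_space, 'e::euclidean_space) atlas \<Rightarrow> (real \<Rightarrow> 'm) \<Rightarrow> real \<Rightarrow> 'm tvec"
  where "velocity A \<gamma> t = (\<lambda>f. if smooth_fun_at A f (\<gamma> t) then deriv (f \<circ> \<gamma>) t else 0)"

definition smooth_vfield_on ::
    "('m::topological_space, 'e::euclidean_space) atlas \<Rightarrow> 'm set \<Rightarrow> 'm vfield \<Rightarrow> bool" where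
  "smooth_vfield_on A U X \<longleftrightarrow>
     (\<forall>p\<in>U. X p \<in> tangent_space A p) \<and>
     (\<forall>f. \<forall>p\<in>U. smooth_fun_at A f p \<longrightarrow> smooth_fun_at A (\<lambda>q. X q f) p)"

definition lie_bracket ::
    "('m::topological_space, 'e::euclidean_space) atlas \<Rightarrow> 'm vfield \<Rightarrow> 'm vfield \<Rightarrow> 'm vfield" where
  "lie_bracket A X Y p =
     (\<lambda>f. if smooth_fun_at A f p then X p (\<lambda>q. Y q f) - Y p (\<lambda>q. X q f) else 0)"


section \<open>Fields of endomorphisms and differential forms\<close>

definition endomorphism_field ::
    "('m::topological_space, 'e::euclidean_space) atlas \<Rightarrow> ('m \<Rightarrow> 'm tvec \<Rightarrow> 'm tvec) \<Rightarrow> bool" where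
  "endomorphism_field A J \<longleftrightarrow>
     (\<forall>p. \<forall>v\<in>tangent_space A p. J p v \<in> tangent_space A p) \<and>
     (\<forall>p. \<forall>v\<in>tangent_space A p. \<forall>w\<in>tangent_space A p. \<forall>c.
        J p (v + w) = J p v + J p w \<and> J p (c *\<^sub>R v) = c *\<^sub>R J p v) \<and>
     (\<forall>U X. open U \<longrightarrow> smooth_vfield_on A U X \<longrightarrow> smooth_vfield_on A U (\<lambda>p. J p (X p)))"

text \<open>
  A \<open>k\<close>-form assigns to a point \<open>p\<close> a function of lists of tangent vectors; only its values on
  lists of \<open>k\<close> tangent vectors at \<open>p\<close> are relevant.
\<close>

type_synonym 'm dform = "'m \<Rightarrow> 'm tvec list \<Rightarrow> real"

definition tangent_lists ::
    "('m::topological_space, 'e::euclidean_space) atlas \<Rightarrow> nat \<Rightarrow> 'm \<Rightarrow> 'm tvec list set"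
  where "tangent_lists A k p = {vs. length vs = k \<and> set vs \<subseteq> tangent_space A p}"

definition differential_form ::
    "('m::topological_space, 'e::euclidean_space) atlas \<Rightarrow> nat \<Rightarrow> 'm dform \<Rightarrow> bool" where
  "differential_form A k \<omega> \<longleftrightarrow>
     (\<forall>p. \<forall>vs\<in>tangent_lists A k p.
        (\<forall>i<k. \<forall>v\<in>tangent_space A p. \<forall>w\<in>tangent_space A p. \<forall>c.
           \<omega> p (vs[i := v + w]) = \<omega> p (vs[i := v]) + \<omega> p (vs[i := w]) \<and>
           \<omega> p (vs[i := c *\<^sub>R v]) = c * \<omega> p (vs[i := v])) \<and>
        (\<forall>j<k. \<forall>i<j. vs ! i = vs ! j \<longrightarrow> \<omega> p vs = 0)) \<and>
     (\<forall>U Xs. open U \<longrightarrow> length Xs = k \<longrightarrow> (\<forall>X\<in>set Xs. smooth_vfield_on A U X) \<longrightarrow>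
        (\<forall>p\<in>U. smooth_fun_at A (\<lambda>q. \<omega> q (map (\<lambda>X. X q) Xs)) p))"

definition pullback ::
    "('n::topological_space, 'f::euclidean_space) atlas \<Rightarrow> ('m \<Rightarrow> 'n) \<Rightarrow> 'n dform \<Rightarrow> 'm dform"
  where "pullback A' F \<omega> p vs = \<omega> (F p) (map (push_forward A' F p) vs)"

text \<open>\<open>wedge p q\<close> is the exterior product of a \<open>p\<close>-form and a \<open>q\<close>-form.\<close>

definition wedge :: "nat \<Rightarrow> nat \<Rightarrow> 'm dform \<Rightarrow> 'm dform \<Rightarrow> 'm dform" where
  "wedge p q \<omega> \<tau> x vs =
     (\<Sum>\<sigma> | \<sigma> permutes {..<p + q}.
        of_int (sign \<sigma>) * \<omega> x (map (\<lambda>i. vs ! \<sigma> i) [0..<p]) * \<tau> x (map (\<lambda>i. vs ! \<sigma> i) [p..<p + q]))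
     / (fact p * fact q)"

primrec wedge_power :: "'m dform \<Rightarrow> nat \<Rightarrow> 'm dform" \<comment> \<open>powers of a 2-form\<close> where
  "wedge_power \<omega> 0 = (\<lambda>p vs. 1)"
| "wedge_power \<omega> (Suc n) = wedge 2 (2 * n) \<omega> (wedge_power \<omega> n)"

definition delete_at :: "nat \<Rightarrow> 'a list \<Rightarrow> 'a list"
  where "delete_at i xs = take i xs @ drop (Suc i) xs"

text \<open>
  The invariant formula for the exterior derivative of a \<open>k\<close>-form, without a factor \<open>1/(k+1)\<close>:
  \<open>d\<alpha>(X,Y) = X(\<alpha>(Y)) - Y(\<alpha>(X)) - \<alpha>([X,Y])\<close> for a 1-form.
\<close>

definition cartan_formula ::
    "('m::topological_space, 'e::euclidean_space) atlas \<Rightarrow> nat \<Rightarrow> 'm dform \<Rightarrow> 'm vfield list \<Rightarrow> 'm \<Rightarrow> real"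
  where
  "cartan_formula A k \<omega> Xs p =
     (\<Sum>i\<le>k. (- 1) ^ i * (Xs ! i) p (\<lambda>q. \<omega> q (map (\<lambda>X. X q) (delete_at i Xs)))) +
     (\<Sum>j\<le>k. \<Sum>i<j. (- 1) ^ (i + j) *
        \<omega> p (lie_bracket A (Xs ! i) (Xs ! j) p # map (\<lambda>X. X p) (delete_at i (delete_at j Xs))))"

text \<open>
  The value of the invariant formula at \<open>p\<close> depends only on the values at \<open>p\<close> of the vector fields.
\<close>

definition ext_deriv ::
    "('m::topological_space, 'e::euclidean_space) atlas \<Rightarrow> nat \<Rightarrow> 'm dform \<Rightarrow> 'm dform" where
  "ext_deriv A k \<omega> p vs =
     (THE c. \<forall>U Xs. open U \<longrightarrow> p \<in> U \<longrightarrow> (\<forall>X\<in>set Xs. smooth_vfield_on A U X) \<longrightarrow>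
        map (\<lambda>X. X p) Xs = vs \<longrightarrow> cartan_formula A k \<omega> Xs p = c)"

definition vanishing_form ::
    "('m::topological_space, 'e::euclidean_space) atlas \<Rightarrow> nat \<Rightarrow> 'm dform \<Rightarrow> bool"
  where "vanishing_form A k \<omega> \<longleftrightarrow> (\<forall>p. \<forall>vs\<in>tangent_lists A k p. \<omega> p vs = 0)"

definition closed_form ::
    "('m::topological_space, 'e::euclidean_space) atlas \<Rightarrow> nat \<Rightarrow> 'm dform \<Rightarrow> bool"
  where "closed_form A k \<omega> \<longleftrightarrow> vanishing_form A (Suc k) (ext_deriv A k \<omega>)"

definition volume_form ::
    "('m::topological_space, 'e::euclidean_space) atlas \<Rightarrow> 'm dform \<Rightarrow> bool"
  where "volume_form A \<omega> \<longleftrightarrow> (\<forall>p. \<exists>vs\<in>tangent_lists A DIM('e) p. \<omega> p vs \<noteq> 0)"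


section \<open>Integrability of almost complex structures\<close>

definition nijenhuis ::
    "('m::topological_space, 'e::euclidean_space) atlas \<Rightarrow> ('m \<Rightarrow> 'm tvec \<Rightarrow> 'm tvec) \<Rightarrow>
     'm vfield \<Rightarrow> 'm vfield \<Rightarrow> 'm vfield" where
  "nijenhuis A J X Y p =
     lie_bracket A (\<lambda>q. J q (X q)) (\<lambda>q. J q (Y q)) p
     - J p (lie_bracket A (\<lambda>q. J q (X q)) Y p)
     - J p (lie_bracket A X (\<lambda>q. J q (Y q)) p)
     + J p (J p (lie_bracket A X Y p))"

definition integrable_acs ::
    "('m::topological_space, 'e::euclidean_space) atlas \<Rightarrow> ('m \<Rightarrow> 'm tvec \<Rightarrow> 'm tvec) \<Rightarrow> bool" where
  "integrable_acs A J \<longleftrightarrow>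
     (\<forall>U X Y. open U \<longrightarrow> smooth_vfield_on A U X \<longrightarrow> smooth_vfield_on A U Y \<longrightarrow>
        (\<forall>p\<in>U. nijenhuis A J X Y p = 0))"


section \<open>Almost contact structures\<close>

definition almost_contact_structure ::
    "('m::topological_space, 'e::euclidean_space) atlas \<Rightarrow> 'm dform \<Rightarrow> 'm vfield \<Rightarrow>
     ('m \<Rightarrow> 'm tvec \<Rightarrow> 'm tvec) \<Rightarrow> bool" where
  "almost_contact_structure A \<alpha> Z \<phi> \<longleftrightarrow>
     differential_form A 1 \<alpha> \<and> smooth_vfield_on A UNIV Z \<and> endomorphism_field A \<phi> \<and>
     (\<forall>p. \<forall>v\<in>tangent_space A p. \<phi> p (\<phi> p v) = - v + \<alpha> p [v] *\<^sub>R Z p) \<and>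
     (\<forall>p. \<phi> p (Z p) = 0 \<and> \<alpha> p [Z p] = 1)"

text \<open>
  A tangent vector \<open>w\<close> at \<open>(b, t)\<close> of the product with the real line is written as \<open>X + f d/dt\<close>,
  where \<open>X\<close> is its projection to the first factor and \<open>f = dt(w) = w(snd)\<close>.
\<close>

definition cone_acs ::
    "('m::topological_space, 'e::euclidean_space) atlas \<Rightarrow> 'm dform \<Rightarrow> 'm vfield \<Rightarrow>
     ('m \<Rightarrow> 'm tvec \<Rightarrow> 'm tvec) \<Rightarrow>
     'm \<times> real \<Rightarrow> ('m \<times> real) tvec \<Rightarrow> ('m \<times> real) tvec" where
  "cone_acs A \<alpha> Z \<phi> = (\<lambda>(b, t) w.
     let AR = prod_atlas A (std_atlas :: (real, real) atlas);
         X = push_forward A fst (b, t) w;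
         f = w snd
     in push_forward AR (\<lambda>b'. (b', t)) b (\<phi> b X - f *\<^sub>R Z b)
        + \<alpha> b [X] *\<^sub>R velocity AR (\<lambda>s. (b, s)) t)"

definition normal_almost_contact_structure ::
    "('m::topological_space, 'e::euclidean_space) atlas \<Rightarrow> 'm dform \<Rightarrow> 'm vfield \<Rightarrow>
     ('m \<Rightarrow> 'm tvec \<Rightarrow> 'm tvec) \<Rightarrow> bool" where
  "normal_almost_contact_structure A \<alpha> Z \<phi> \<longleftrightarrow>
     almost_contact_structure A \<alpha> Z \<phi> \<and>
     integrable_acs (prod_atlas A (std_atlas :: (real, real) atlas)) (cone_acs A \<alpha> Z \<phi>)"


section \<open>Contact-symplectic pairs\<close>

definition contact_symplectic_pair ::
    "('m::topological_space, 'e::euclidean_space) atlas \<Rightarrow> nat \<Rightarrow> nat \<Rightarrow> 'm dform \<Rightarrow> 'm dform \<Rightarrow> bool"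
  where
  "contact_symplectic_pair A h k \<beta> \<eta> \<longleftrightarrow>
     DIM('e) = 2 * h + 2 * k + 1 \<and>
     differential_form A 1 \<beta> \<and> differential_form A 2 \<eta> \<and> closed_form A 2 \<eta> \<and>
     volume_form A (wedge 1 (2 * h + 2 * k) \<beta>
       (wedge (2 * h) (2 * k) (wedge_power (ext_deriv A 1 \<beta>) h) (wedge_power \<eta> k))) \<and>
     vanishing_form A (2 * (h + 1)) (wedge_power (ext_deriv A 1 \<beta>) (h + 1)) \<and>
     vanishing_form A (2 * (k + 1)) (wedge_power \<eta> (k + 1))"

definition cs_reeb_field ::
    "('m::topological_space, 'e::euclidean_space) atlas \<Rightarrow> 'm dform \<Rightarrow> 'm dform \<Rightarrow> 'm vfield \<Rightarrow> bool"
  where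
  "cs_reeb_field A \<beta> \<eta> W \<longleftrightarrow>
     smooth_vfield_on A UNIV W \<and>
     (\<forall>p. \<beta> p [W p] = 1) \<and>
     (\<forall>p. \<forall>v\<in>tangent_space A p. ext_deriv A 1 \<beta> p [W p, v] = 0 \<and> \<eta> p [W p, v] = 0)"

text \<open>The Reeb field \<open>W\<close> is determined by \<open>\<beta>\<close> and \<open>\<eta>\<close>; it is an argument only to give it a name.\<close>

definition almost_contact_symplectic_structure ::
    "('m::topological_space, 'e::euclidean_space) atlas \<Rightarrow> nat \<Rightarrow> nat \<Rightarrow> 'm dform \<Rightarrow> 'm dform \<Rightarrow>
     'm vfield \<Rightarrow> ('m \<Rightarrow> 'm tvec \<Rightarrow> 'm tvec) \<Rightarrow> bool" where
  "almost_contact_symplectic_structure A h k \<beta> \<eta> W \<psi> \<longleftrightarrow>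
     contact_symplectic_pair A h k \<beta> \<eta> \<and> cs_reeb_field A \<beta> \<eta> W \<and> endomorphism_field A \<psi> \<and>
     (\<forall>p. \<forall>v\<in>tangent_space A p. \<psi> p (\<psi> p v) = - v + \<beta> p [v] *\<^sub>R W p)"

definition ker_form ::
    "('m::topological_space, 'e::euclidean_space) atlas \<Rightarrow> nat \<Rightarrow> 'm dform \<Rightarrow> 'm \<Rightarrow> 'm tvec set" where
  "ker_form A k \<omega> p =
     {v \<in> tangent_space A p. \<forall>vs\<in>tangent_lists A (k - 1) p. \<omega> p (v # vs) = 0}"

definition decomposable ::
    "('m::topological_space, 'e::euclidean_space) atlas \<Rightarrow> 'm dform \<Rightarrow> 'm dform \<Rightarrow>
     ('m \<Rightarrow> 'm tvec \<Rightarrow> 'm tvec) \<Rightarrow> bool" where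
  "decomposable A \<beta> \<eta> \<psi> \<longleftrightarrow>
     (\<forall>p. \<psi> p ` ker_form A 2 \<eta> p \<subseteq> ker_form A 2 \<eta> p \<and>
          \<psi> p ` (ker_form A 1 \<beta> p \<inter> ker_form A 2 (ext_deriv A 1 \<beta>) p)
            \<subseteq> ker_form A 1 \<beta> p \<inter> ker_form A 2 (ext_deriv A 1 \<beta>) p)"


section \<open>Contact pair structures\<close>

definition contact_pair ::
    "('m::topological_space, 'e::euclidean_space) atlas \<Rightarrow> nat \<Rightarrow> nat \<Rightarrow> 'm dform \<Rightarrow> 'm dform \<Rightarrow> bool"
  where
  "contact_pair A h k \<alpha>1 \<alpha>2 \<longleftrightarrow>
     DIM('e) = 2 * h + 2 * k + 2 \<and>
     differential_form A 1 \<alpha>1 \<and> differential_form A 1 \<alpha>2 \<and>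
     volume_form A
       (wedge 1 (2 * h + (1 + 2 * k)) \<alpha>1
         (wedge (2 * h) (1 + 2 * k) (wedge_power (ext_deriv A 1 \<alpha>1) h)
           (wedge 1 (2 * k) \<alpha>2 (wedge_power (ext_deriv A 1 \<alpha>2) k)))) \<and>
     vanishing_form A (2 * (h + 1)) (wedge_power (ext_deriv A 1 \<alpha>1) (h + 1)) \<and>
     vanishing_form A (2 * (k + 1)) (wedge_power (ext_deriv A 1 \<alpha>2) (k + 1))"

definition cp_reeb_fields ::
    "('m::topological_space, 'e::euclidean_space) atlas \<Rightarrow> 'm dform \<Rightarrow> 'm dform \<Rightarrow>
     'm vfield \<Rightarrow> 'm vfield \<Rightarrow> bool" where
  "cp_reeb_fields A \<alpha>1 \<alpha>2 Z1 Z2 \<longleftrightarrow>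
     smooth_vfield_on A UNIV Z1 \<and> smooth_vfield_on A UNIV Z2 \<and>
     (\<forall>p. \<alpha>1 p [Z1 p] = 1 \<and> \<alpha>1 p [Z2 p] = 0 \<and> \<alpha>2 p [Z1 p] = 0 \<and> \<alpha>2 p [Z2 p] = 1) \<and>
     (\<forall>p. \<forall>v\<in>tangent_space A p. \<forall>\<alpha>\<in>{\<alpha>1, \<alpha>2}. \<forall>Z\<in>{Z1, Z2}. ext_deriv A 1 \<alpha> p [Z p, v] = 0)"

definition contact_pair_structure ::
    "('m::topological_space, 'e::euclidean_space) atlas \<Rightarrow> nat \<Rightarrow> nat \<Rightarrow> 'm dform \<Rightarrow> 'm dform \<Rightarrow>
     'm vfield \<Rightarrow> 'm vfield \<Rightarrow> ('m \<Rightarrow> 'm tvec \<Rightarrow> 'm tvec) \<Rightarrow> bool" where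
  "contact_pair_structure A h k \<alpha>1 \<alpha>2 Z1 Z2 \<phi> \<longleftrightarrow>
     contact_pair A h k \<alpha>1 \<alpha>2 \<and> cp_reeb_fields A \<alpha>1 \<alpha>2 Z1 Z2 \<and> endomorphism_field A \<phi> \<and>
     (\<forall>p. \<forall>v\<in>tangent_space A p.
        \<phi> p (\<phi> p v) = - v + \<alpha>1 p [v] *\<^sub>R Z1 p + \<alpha>2 p [v] *\<^sub>R Z2 p) \<and>
     (\<forall>p. \<phi> p (Z1 p) = 0 \<and> \<phi> p (Z2 p) = 0)"

definition acs_J ::
    "'m dform \<Rightarrow> 'm dform \<Rightarrow> 'm vfield \<Rightarrow> 'm vfield \<Rightarrow> ('m \<Rightarrow> 'm tvec \<Rightarrow> 'm tvec) \<Rightarrow>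
     'm \<Rightarrow> 'm tvec \<Rightarrow> 'm tvec"
  where "acs_J \<alpha>1 \<alpha>2 Z1 Z2 \<phi> p v = \<phi> p v - \<alpha>2 p [v] *\<^sub>R Z1 p + \<alpha>1 p [v] *\<^sub>R Z2 p"

definition acs_T ::
    "'m dform \<Rightarrow> 'm dform \<Rightarrow> 'm vfield \<Rightarrow> 'm vfield \<Rightarrow> ('m \<Rightarrow> 'm tvec \<Rightarrow> 'm tvec) \<Rightarrow>
     'm \<Rightarrow> 'm tvec \<Rightarrow> 'm tvec"
  where "acs_T \<alpha>1 \<alpha>2 Z1 Z2 \<phi> p v = \<phi> p v + \<alpha>2 p [v] *\<^sub>R Z1 p - \<alpha>1 p [v] *\<^sub>R Z2 p"

text \<open>The existential quantifier only names the Reeb fields, which are determined by the pair.\<close>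

definition normal_contact_pair_structure ::
    "('m::topological_space, 'e::euclidean_space) atlas \<Rightarrow> nat \<Rightarrow> nat \<Rightarrow> 'm dform \<Rightarrow> 'm dform \<Rightarrow>
     ('m \<Rightarrow> 'm tvec \<Rightarrow> 'm tvec) \<Rightarrow> bool" where
  "normal_contact_pair_structure A h k \<alpha>1 \<alpha>2 \<phi> \<longleftrightarrow>
     (\<exists>Z1 Z2. contact_pair_structure A h k \<alpha>1 \<alpha>2 Z1 Z2 \<phi> \<and>
        integrable_acs A (acs_J \<alpha>1 \<alpha>2 Z1 Z2 \<phi>) \<and> integrable_acs A (acs_T \<alpha>1 \<alpha>2 Z1 Z2 \<phi>))"


section \<open>Integral classes\<close>

text \<open>
  \<open>x 1\<close>, \<open>x 2\<close>, \<open>x 3\<close> are affine coordinates on the standard \<open>p\<close>-simplex when \<open>p \<le> 3\<close>. A singular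
  simplex is smooth if it extends smoothly to a neighbourhood in these coordinates.
\<close>

definition smooth_singular_simplex ::
    "('m::topological_space, 'e::euclidean_space) atlas \<Rightarrow> nat \<Rightarrow> ((nat \<Rightarrow> real) \<Rightarrow> 'm) \<Rightarrow> bool" where
  "smooth_singular_simplex A p \<sigma> \<longleftrightarrow>
     p \<le> 3 \<and> singular_simplex p euclidean \<sigma> \<and>
     (\<exists>V (g :: real \<times> real \<times> real \<Rightarrow> 'm). open V \<and> (\<forall>x\<in>V. smooth_at std_atlas A g x) \<and>
        (\<forall>x\<in>standard_simplex p. (x 1, x 2, x 3) \<in> V \<and> \<sigma> x = g (x 1, x 2, x 3)))"

definition simplex_point2 :: "real \<Rightarrow> real \<Rightarrow> nat \<Rightarrow> real"
  where "simplex_point2 s t = (\<lambda>i. if i = 0 then 1 - s - t else if i = 1 then s else if i = 2 then t else 0)"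

definition simplex_integral2 ::
    "('m::topological_space, 'e::euclidean_space) atlas \<Rightarrow> 'm dform \<Rightarrow> ((nat \<Rightarrow> real) \<Rightarrow> 'm) \<Rightarrow> real" where
  "simplex_integral2 A \<eta> \<sigma> =
     integral {(s, t). 0 < s \<and> 0 < t \<and> s + t < 1}
       (\<lambda>(s, t). \<eta> (\<sigma> (simplex_point2 s t))
          [velocity A (\<lambda>s'. \<sigma> (simplex_point2 s' t)) s, velocity A (\<lambda>t'. \<sigma> (simplex_point2 s t')) t])"

text \<open>
  The de Rham class of the closed 2-form \<open>\<eta>\<close> is the class of the smooth singular cochain
  \<open>\<sigma> \<mapsto> \<integral>\<^sub>\<sigma> \<eta>\<close>. It is integral if this cochain differs from an integer-valued cocycle \<open>c\<close> by the
  coboundary of a real 1-cochain \<open>b\<close>.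
\<close>

definition represents_integral_class ::
    "('m::topological_space, 'e::euclidean_space) atlas \<Rightarrow> 'm dform \<Rightarrow> bool" where
  "represents_integral_class A \<eta> \<longleftrightarrow>
     (\<exists>(c :: ((nat \<Rightarrow> real) \<Rightarrow> 'm) \<Rightarrow> int) (b :: ((nat \<Rightarrow> real) \<Rightarrow> 'm) \<Rightarrow> real).
        (\<forall>\<tau>. smooth_singular_simplex A 3 \<tau> \<longrightarrow> (\<Sum>i\<le>3. (- 1) ^ i * c (singular_face 3 i \<tau>)) = 0) \<and>
        (\<forall>\<sigma>. smooth_singular_simplex A 2 \<sigma> \<longrightarrow>
           simplex_integral2 A \<eta> \<sigma> = of_int (c \<sigma>) + (\<Sum>i\<le>2. (- 1) ^ i * b (singular_face 2 i \<sigma>))))"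


section \<open>Boothby--Wang fibrations\<close>

text \<open>
  The circle is \<open>\<real>/\<int>\<close>: an action of it is a 1-periodic action \<open>\<theta>\<close> of \<open>\<real>\<close>. In a local trivialization
  over \<open>U\<close>, the equivariant diffeomorphism from the preimage of \<open>U\<close> to the product of \<open>U\<close> with the unit
  circle is \<open>p \<mapsto> (\<pi> p, \<xi> p)\<close>, and \<open>\<Psi> (u, t)\<close> is the image under the inverse diffeomorphism
  of the pair of \<open>u\<close> and \<open>cis (2\<pi>t)\<close>.
\<close>

definition principal_circle_bundle ::
    "('b::topological_space, 'e::euclidean_space) atlas \<Rightarrow>
     ('m::topological_space, 'f::euclidean_space) atlas \<Rightarrow> (real \<Rightarrow> 'm \<Rightarrow> 'm) \<Rightarrow> ('m \<Rightarrow> 'b) \<Rightarrow> bool" where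
  "principal_circle_bundle AB AM \<theta> \<pi> \<longleftrightarrow>
     (\<forall>p. smooth_at AM AB \<pi> p) \<and>
     (\<forall>x. smooth_at (prod_atlas (std_atlas :: (real, real) atlas) AM) AM (\<lambda>(t, p). \<theta> t p) x) \<and>
     (\<forall>p s t. \<theta> 0 p = p \<and> \<theta> 1 p = p \<and> \<theta> (s + t) p = \<theta> s (\<theta> t p)) \<and>
     (\<forall>b. \<exists>U \<Psi> (\<xi> :: 'm \<Rightarrow> complex). open U \<and> b \<in> U \<and>
        (\<forall>x\<in>U \<times> UNIV. smooth_at (prod_atlas AB (std_atlas :: (real, real) atlas)) AM \<Psi> x) \<and>
        (\<forall>p\<in>\<pi> -` U. smooth_at AM std_atlas \<xi> p) \<and>
        (\<forall>u\<in>U. \<forall>s t. \<pi> (\<Psi> (u, t)) = u \<and> \<xi> (\<Psi> (u, t)) = cis (2 * pi * t) \<and>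
           \<theta> s (\<Psi> (u, t)) = \<Psi> (u, s + t)) \<and>
        (\<forall>p\<in>\<pi> -` U. \<exists>t. p = \<Psi> (\<pi> p, t)))"

definition circle_generator ::
    "('m::topological_space, 'f::euclidean_space) atlas \<Rightarrow> (real \<Rightarrow> 'm \<Rightarrow> 'm) \<Rightarrow> 'm vfield"
  where "circle_generator AM \<theta> p = velocity AM (\<lambda>t. \<theta> t p) 0"

definition connection_form ::
    "('m::topological_space, 'f::euclidean_space) atlas \<Rightarrow> (real \<Rightarrow> 'm \<Rightarrow> 'm) \<Rightarrow> 'm dform \<Rightarrow> bool" where
  "connection_form AM \<theta> \<alpha> \<longleftrightarrow>
     differential_form AM 1 \<alpha> \<and>
     (\<forall>p. \<alpha> p [circle_generator AM \<theta> p] = 1) \<and>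
     (\<forall>t p. \<forall>v\<in>tangent_space AM p. pullback AM (\<theta> t) \<alpha> p [v] = \<alpha> p [v])"

text \<open>
  As the circle has period 1, the real Euler class of the bundle is, in Chern--Weil theory, the
  class of the curvature of any connection form, so the condition on \<open>d\<alpha>\<close> says both that the
  Euler class is the class of \<open>\<eta>\<close> and that the curvature of \<open>\<alpha>\<close> is \<open>\<eta>\<close>.
\<close>

definition boothby_wang_fibration ::
    "('b::topological_space, 'e::euclidean_space) atlas \<Rightarrow>
     ('m::topological_space, 'f::euclidean_space) atlas \<Rightarrow> 'b dform \<Rightarrow>
     (real \<Rightarrow> 'm \<Rightarrow> 'm) \<Rightarrow> ('m \<Rightarrow> 'b) \<Rightarrow> 'm dform \<Rightarrow> bool" where
  "boothby_wang_fibration AB AM \<eta> \<theta> \<pi> \<alpha> \<longleftrightarrow>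
     principal_circle_bundle AB AM \<theta> \<pi> \<and> connection_form AM \<theta> \<alpha> \<and>
     (\<forall>p. \<forall>vs\<in>tangent_lists AM 2 p. ext_deriv AM 1 \<alpha> p vs = pullback AB \<pi> \<eta> p vs)"

definition horizontal_lift ::
    "('b::topological_space, 'e::euclidean_space) atlas \<Rightarrow>
     ('m::topological_space, 'f::euclidean_space) atlas \<Rightarrow> ('m \<Rightarrow> 'b) \<Rightarrow> 'm dform \<Rightarrow>
     'm \<Rightarrow> 'b tvec \<Rightarrow> 'm tvec" where
  "horizontal_lift AB AM \<pi> \<alpha> p y =
     (THE w. w \<in> tangent_space AM p \<and> \<alpha> p [w] = 0 \<and> push_forward AB \<pi> p w = y)"

definition lifted_endomorphism ::
    "('b::topological_space, 'e::euclidean_space) atlas \<Rightarrow>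
     ('m::topological_space, 'f::euclidean_space) atlas \<Rightarrow> ('m \<Rightarrow> 'b) \<Rightarrow> 'm dform \<Rightarrow>
     ('b \<Rightarrow> 'b tvec \<Rightarrow> 'b tvec) \<Rightarrow> 'm \<Rightarrow> 'm tvec \<Rightarrow> 'm tvec" where
  "lifted_endomorphism AB AM \<pi> \<alpha> \<psi> p v =
     horizontal_lift AB AM \<pi> \<alpha> p (\<psi> (\<pi> p) (push_forward AB \<pi> p v))"

end

theory Submission
  imports Defs
begin

text \<open>
  Let \<open>\<xi>\<close> be the generator of the circle action and \<open>X\<^sup>*\<close> the horizontal lift of \<open>X\<close>. Both \<open>J\<close> and \<open>T\<close> have
  the form \<open>E X\<^sup>* = (\<psi> X)\<^sup>* + s \<beta>(X) \<xi>\<close>, \<open>E \<xi> = - s W\<^sup>*\<close> with \<open>s = -1\<close> and \<open>s = 1\<close>, and so has the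
  almost complex structure on \<open>B \<times> \<real>\<close>, with \<open>s = 1\<close>, \<open>\<xi> = d/dt\<close> and the flat connection \<open>dt\<close>. For a connection
  with curvature \<open>\<eta>\<close>, the horizontal and vertical parts of the Nijenhuis tensor of \<open>E\<close> on \<open>(X\<^sup>*, Y\<^sup>*)\<close> and
  \<open>(\<xi>, X\<^sup>*)\<close> are, up to sign, the classical tensors \<open>[\<psi>, \<psi>](X, Y) + d\<beta>(X, Y) W\<close>,
  \<open>(L\<^bsub>\<psi>X\<^esub> \<beta>)(Y) - (L\<^bsub>\<psi>Y\<^esub> \<beta>)(X)\<close> and \<open>(L\<^bsub>W\<^esub> \<psi>)(X)\<close> of \<open>(\<beta>, W, \<psi>)\<close>: the curvature only enters through
  \<open>\<eta>(\<psi> X, Y) + \<eta>(X, \<psi> Y)\<close> and \<open>\<eta>(X, Y) - \<eta>(\<psi> X, \<psi> Y)\<close>, which vanish. So the integrability of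
  each of the three structures is equivalent to the vanishing of the same tensors on \<open>B\<close>.
\<close>

section \<open>Calculus of smooth functions\<close>

text \<open>Normality on \<open>M\<close> and normality on \<open>B\<close> are not compared
  directly. One equivalence, for a fibration with one-dimensional fibres, a connection and a sign
  \<open>s\<close> with \<open>s * s = 1\<close>, is instantiated for the circle bundle and for the
  product with the line. Changing \<open>s\<close> only flips the signs of the vertical part on two
  lifts and of the horizontal part on the generator and a lift; this is why \<open>J\<close> and
  \<open>T\<close> impose the same conditions. The first curvature combination vanishes by applying
  invariance to \<psi> X and Y, since \<psi>^2 is - Id up to a multiple of W, which \<eta>
  annihilates. The obstacle is the passage from points to fields: horizontal lifts are chosen point
  by point, so their smoothness has to come from local trivialisations, and only tensoriality allows
  arbitrary fields to be replaced by lifts and multiples of the generator. Normality on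
  \<open>M\<close> also includes being a contact pair: the dimension of \<open>M\<close> comes from
  invariance of dimension, the volume form from the generator and a lifted frame. As d\<alpha>1 is
  the pullback of \<eta>, a pair of type (h, k) on \<open>B\<close> lifts to one of type (k,
  h).\<close>

lemma Ck_on_subset: "Ck_on n S f \<Longrightarrow> T \<subseteq> S \<Longrightarrow> Ck_on n T f"
proof (induction n arbitrary: f)
  case 0
  then show ?case by (auto intro: continuous_on_subset)
next
  case (Suc n)
  then show ?case unfolding Ck_on.simps by blast
qed

lemma differentiable_transform_open:
  assumes "open S" "x \<in> S" "\<And>x. x \<in> S \<Longrightarrow> f x = g x" "f differentiable (at x)"
  shows "g differentiable (at x)"
  using assms has_derivative_transform_within_open[of f _ x UNIV S g]
  unfolding differentiable_def by blast

text \<open>Openness is essential: the Frechet derivative at a point of \<open>S\<close> sees a full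
  neighbourhood, and \<open>f\<close> and \<open>g\<close> have to agree there.\<close>

lemma Ck_on_cong:
  assumes "open S" "\<And>x. x \<in> S \<Longrightarrow> f x = g x" "Ck_on n S f"
  shows "Ck_on n S g"
  using assms(2,3)
proof (induction n arbitrary: f g)
  case 0
  from continuous_on_eq[of S f g, OF _ 0(1)] 0(2) show ?case unfolding Ck_on.simps by blast
next
  case (Suc n)
  have d: "f differentiable (at x)" if "x \<in> S" for x
    using Suc.prems(2) that unfolding Ck_on.simps by blast
  have eq: "frechet_derivative f (at x) v = frechet_derivative g (at x) v" if "x \<in> S" for x v
    using frechet_derivative_transform_within_open[OF d[OF that] assms(1) that Suc.prems(1)] by (rule fun_cong)
  have "Ck_on n S (\<lambda>x. frechet_derivative f (at x) v)" for v
    using Suc.prems(2) unfolding Ck_on.simps by blast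
  from Suc.IH[OF eq this] have "Ck_on n S (\<lambda>x. frechet_derivative g (at x) v)" for v .
  moreover have "g differentiable (at x)" if "x \<in> S" for x
    by (rule differentiable_transform_open[OF assms(1) that Suc.prems(1) d[OF that]])
  ultimately show ?case unfolding Ck_on.simps by blast
qed

text \<open>The recursive clause does not repeat the lower class, so the inclusion is itself an
  induction; its base case is that differentiable functions are continuous.\<close>

lemma Ck_on_Suc_imp: "Ck_on (Suc n) S f \<Longrightarrow> Ck_on n S f"
proof (induction n arbitrary: f)
  case 0
  then show ?case
    by (simp add: differentiable_imp_continuous_on differentiable_at_imp_differentiable_on)
next
  case (Suc n)
  from Suc.prems have *: "Ck_on (Suc n) S (\<lambda>x. frechet_derivative f (at x) v)" for v
    by (subst (asm) Ck_on.simps) blast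
  from Suc.prems have "\<forall>x\<in>S. f differentiable (at x)" by simp
  with Suc.IH[OF *] show ?case by (simp only: Ck_on.simps) blast
qed

lemma Ck_on_const: "Ck_on n S (\<lambda>x. c)"
  by (induction n arbitrary: c) (auto simp: frechet_derivative_const)

lemma Ck_on_bounded_linear: "bounded_linear f \<Longrightarrow> Ck_on n S f"
proof (induction n)
  case 0
  then show ?case by (simp add: linear_continuous_on)
next
  case (Suc n)
  have "frechet_derivative f (at x) = f" for x
    using Suc.prems by (metis bounded_linear_imp_has_derivative frechet_derivative_at)
  then show ?case
    using Suc.prems by (auto intro: Ck_on_const bounded_linear_imp_differentiable)
qed

lemma Ck_on_add:
  assumes "open S"
  shows "Ck_on n S f \<Longrightarrow> Ck_on n S g \<Longrightarrow> Ck_on n S (\<lambda>x. f x + g x)"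
proof (induction n arbitrary: f g)
  case 0
  then show ?case by (auto intro: continuous_on_add)
next
  case (Suc n)
  have D: "((\<lambda>x. f x + g x) has_derivative
      (\<lambda>v. frechet_derivative f (at x) v + frechet_derivative g (at x) v)) (at x)" if "x \<in> S" for x
    using Suc.prems that by (intro has_derivative_add) (auto simp: frechet_derivative_works)
  have "Ck_on n S (\<lambda>x. frechet_derivative (\<lambda>x. f x + g x) (at x) v)" for v
  proof (rule Ck_on_cong[OF assms])
    show "frechet_derivative f (at x) v + frechet_derivative g (at x) v =
      frechet_derivative (\<lambda>x. f x + g x) (at x) v" if "x \<in> S" for x
      using frechet_derivative_at[OF D[OF that]] by metis
    show "Ck_on n S (\<lambda>x. frechet_derivative f (at x) v + frechet_derivative g (at x) v)"
      using Suc by auto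
  qed
  with D show ?case by (auto simp: differentiable_def)
qed

lemma Ck_on_sum:
  assumes "open S" "finite I" "\<And>i. i \<in> I \<Longrightarrow> Ck_on n S (f i)"
  shows "Ck_on n S (\<lambda>x. \<Sum>i\<in>I. f i x)"
  using assms(2,3)
  by (induction I rule: finite_induct) (auto intro: Ck_on_add Ck_on_const assms(1))

text \<open>Each summand of the product rule pairs a derivative with an undifferentiated factor,
  which is lowered to class \<open>n\<close> first. The bilinear form covers products, scalar
  multiples and inner products at once.\<close>

lemma (in bounded_bilinear) Ck_on:
  assumes "open S"
  shows "Ck_on n S f \<Longrightarrow> Ck_on n S g \<Longrightarrow> Ck_on n S (\<lambda>x. prod (f x) (g x))"
proof (induction n arbitrary: f g)
  case 0
  then show ?case by (auto intro: continuous_on)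
next
  case (Suc n)
  have D: "((\<lambda>x. prod (f x) (g x)) has_derivative
      (\<lambda>v. prod (f x) (frechet_derivative g (at x) v) + prod (frechet_derivative f (at x) v) (g x))) (at x)"
    if "x \<in> S" for x
    using Suc.prems that by (intro FDERIV) (auto simp: frechet_derivative_works)
  have "Ck_on n S (\<lambda>x. frechet_derivative (\<lambda>x. prod (f x) (g x)) (at x) v)" for v
  proof (rule Ck_on_cong[OF assms])
    show "prod (f x) (frechet_derivative g (at x) v) + prod (frechet_derivative f (at x) v) (g x) =
      frechet_derivative (\<lambda>x. prod (f x) (g x)) (at x) v" if "x \<in> S" for x
      using frechet_derivative_at[OF D[OF that]] by metis
    have "Ck_on n S f" "Ck_on n S g"
      using Suc.prems Ck_on_Suc_imp by blast+
    with Suc show "Ck_on n S (\<lambda>x. prod (f x) (frechet_derivative g (at x) v) + prod (frechet_derivative f (at x) v) (g x))"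
      by (intro Ck_on_add assms) auto
  qed
  with D show ?case by (auto simp: differentiable_def)
qed

lemma Ck_on_inner_left:
  assumes "Ck_on n S f" "open S"
  shows "Ck_on n S (\<lambda>x. f x \<bullet> c)"
  using bounded_bilinear.Ck_on[OF bounded_bilinear_inner assms(2,1) Ck_on_const] .

lemma Ck_on_componentwise:
  fixes f :: "'a::euclidean_space \<Rightarrow> 'b::euclidean_space"
  assumes "open S" "\<And>b. b \<in> Basis \<Longrightarrow> Ck_on n S (\<lambda>x. f x \<bullet> b)"
  shows "Ck_on n S f"
proof -
  have "Ck_on n S (\<lambda>x. (f x \<bullet> b) *\<^sub>R b)" if "b \<in> Basis" for b
    using assms that by (intro bounded_bilinear.Ck_on[OF bounded_bilinear_scaleR] Ck_on_const) auto
  then have "Ck_on n S (\<lambda>x. \<Sum>b\<in>Basis. (f x \<bullet> b) *\<^sub>R b)"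
    using assms by (intro Ck_on_sum) auto
  then show ?thesis by (simp add: euclidean_representation)
qed

lemma linear_frechet_derivative_at:
  "f differentiable (at x) \<Longrightarrow> linear (frechet_derivative f (at x))"
  using frechet_derivative_works has_derivative_linear by blast

text \<open>The chain rule differentiates \<open>g\<close> in a direction that varies with
  \<open>x\<close>, whereas \<open>Ck_on\<close> only controls fixed directions. Hence the direction
  is expanded in the standard basis, with coefficients that are derivatives of
  \<open>f\<close>.\<close>

lemma Ck_on_compose:
  fixes f :: "'a::euclidean_space \<Rightarrow> 'b::euclidean_space" and g :: "'b \<Rightarrow> 'c::real_normed_vector"
  assumes "open S" "open T" "f ` S \<subseteq> T"
  shows "Ck_on n S f \<Longrightarrow> Ck_on n T g \<Longrightarrow> Ck_on n S (\<lambda>x. g (f x))"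
proof (induction n arbitrary: g)
  case 0
  then show ?case using assms by (auto intro: continuous_on_compose2)
next
  case (Suc n)
  have df: "f differentiable (at x)" and dg: "g differentiable (at (f x))" if "x \<in> S" for x
    using Suc.prems that assms(3) by auto
  have D: "((\<lambda>x. g (f x)) has_derivative (\<lambda>v. frechet_derivative g (at (f x)) (frechet_derivative f (at x) v))) (at x)"
    if "x \<in> S" for x
    using has_derivative_compose[of f _ x UNIV g] df[OF that] dg[OF that]
    unfolding frechet_derivative_works by blast
  have "Ck_on n S (\<lambda>x. frechet_derivative (\<lambda>x. g (f x)) (at x) v)" for v
  proof (rule Ck_on_cong[OF assms(1)])
    show "(\<Sum>b\<in>Basis. (frechet_derivative f (at x) v \<bullet> b) *\<^sub>R frechet_derivative g (at (f x)) b)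
        = frechet_derivative (\<lambda>x. g (f x)) (at x) v" if "x \<in> S" for x
    proof -
      interpret linear "frechet_derivative g (at (f x))"
        by (rule linear_frechet_derivative_at) (rule dg[OF that])
      have "frechet_derivative (\<lambda>x. g (f x)) (at x) v
          = frechet_derivative g (at (f x)) (\<Sum>b\<in>Basis. (frechet_derivative f (at x) v \<bullet> b) *\<^sub>R b)"
        using frechet_derivative_at[OF D[OF that]] by (simp add: euclidean_representation fun_eq_iff)
      then show ?thesis by (simp add: sum scale)
    qed
    have "Ck_on n S f" using Suc.prems Ck_on_Suc_imp by blast
    then show "Ck_on n S (\<lambda>x. \<Sum>b\<in>Basis. (frechet_derivative f (at x) v \<bullet> b) *\<^sub>R frechet_derivative g (at (f x)) b)"
      using Suc.prems assms(1)
      by (intro Ck_on_sum bounded_bilinear.Ck_on[OF bounded_bilinear_scaleR] Ck_on_inner_left Suc.IH) simp_all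
  qed
  with D show ?case by (auto simp: differentiable_def)
qed

section \<open>Smooth functions on open sets\<close>

lemma smooth_on_subset: "smooth_on S f \<Longrightarrow> T \<subseteq> S \<Longrightarrow> smooth_on T f"
  unfolding smooth_on_def using Ck_on_subset by blast

lemma smooth_on_const: "smooth_on S (\<lambda>x. c)"
  unfolding smooth_on_def using Ck_on_const by blast

lemma smooth_on_bounded_linear: "bounded_linear h \<Longrightarrow> smooth_on S h"
  unfolding smooth_on_def using Ck_on_bounded_linear by blast

lemma smooth_on_cong:
  assumes "smooth_on S f" "open S" "\<And>x. x \<in> S \<Longrightarrow> f x = g x"
  shows "smooth_on S g"
  using Ck_on_cong[of S f g] assms unfolding smooth_on_def by blast

lemma smooth_on_add: "smooth_on S f \<Longrightarrow> smooth_on S g \<Longrightarrow> open S \<Longrightarrow> smooth_on S (\<lambda>x. f x + g x)"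
  unfolding smooth_on_def using Ck_on_add[of S _ f g] by blast

lemma (in bounded_bilinear) smooth_on:
  "smooth_on S f \<Longrightarrow> smooth_on S g \<Longrightarrow> open S \<Longrightarrow> smooth_on S (\<lambda>x. prod (f x) (g x))"
  unfolding smooth_on_def using Ck_on[of S _ f g] by blast

lemmas smooth_on_mult = bounded_bilinear.smooth_on[OF bounded_bilinear_mult]

lemma smooth_on_inner_left: "smooth_on S f \<Longrightarrow> open S \<Longrightarrow> smooth_on S (\<lambda>x. f x \<bullet> c)"
  unfolding smooth_on_def using Ck_on_inner_left by blast

lemma smooth_on_componentwise:
  fixes f :: "'a::euclidean_space \<Rightarrow> 'b::euclidean_space"
  assumes "open S" "\<And>b. b \<in> Basis \<Longrightarrow> smooth_on S (\<lambda>x. f x \<bullet> b)"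
  shows "smooth_on S f"
  using Ck_on_componentwise[of S _ f] assms unfolding smooth_on_def by blast

lemma smooth_on_compose:
  fixes f :: "'a::euclidean_space \<Rightarrow> 'b::euclidean_space" and g :: "'b \<Rightarrow> 'c::real_normed_vector"
  assumes "smooth_on S f" "smooth_on T g" "open S" "open T" "f ` S \<subseteq> T"
  shows "smooth_on S (\<lambda>x. g (f x))"
  using Ck_on_compose[of S T f _ g] assms unfolding smooth_on_def by blast

lemma smooth_on_Pair:
  fixes f :: "'a::euclidean_space \<Rightarrow> 'b::euclidean_space" and g :: "'a \<Rightarrow> 'c::euclidean_space"
  assumes "smooth_on S f" "smooth_on S g" "open S"
  shows "smooth_on S (\<lambda>x. (f x, g x))"
proof (rule smooth_on_componentwise[OF assms(3)])
  fix b :: "'b \<times> 'c" assume "b \<in> Basis"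
  then show "smooth_on S (\<lambda>x. (f x, g x) \<bullet> b)"
    using assms by (auto simp: Basis_prod_def inner_Pair intro: smooth_on_inner_left)
qed

lemma smooth_on_iff_derivative:
  "smooth_on S f \<longleftrightarrow>
    (\<forall>x\<in>S. f differentiable (at x)) \<and> (\<forall>v. smooth_on S (\<lambda>x. frechet_derivative f (at x) v))"
proof
  assume f: "smooth_on S f"
  then have "Ck_on (Suc n) S f" for n unfolding smooth_on_def by blast
  then show "(\<forall>x\<in>S. f differentiable (at x)) \<and> (\<forall>v. smooth_on S (\<lambda>x. frechet_derivative f (at x) v))"
    unfolding Ck_on.simps smooth_on_def by blast
next
  assume "(\<forall>x\<in>S. f differentiable (at x)) \<and> (\<forall>v. smooth_on S (\<lambda>x. frechet_derivative f (at x) v))"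
  then have "Ck_on (Suc n) S f" for n unfolding smooth_on_def Ck_on.simps by blast
  then show "smooth_on S f" unfolding smooth_on_def using Ck_on_Suc_imp by blast
qed

lemma smooth_on_frechet_derivative:
  "smooth_on S f \<Longrightarrow> smooth_on S (\<lambda>x. frechet_derivative f (at x) v)"
  using smooth_on_iff_derivative by blast

lemma smooth_on_imp_differentiable: "smooth_on S f \<Longrightarrow> x \<in> S \<Longrightarrow> f differentiable (at x)"
  using smooth_on_iff_derivative by blast

lemma smooth_on_imp_continuous_on: "smooth_on S f \<Longrightarrow> continuous_on S f"
  unfolding smooth_on_def using Ck_on.simps(1) by blast

text \<open>Bootstrapping: the derivative is a product of the function with itself and a constant,
  so class \<open>n\<close> yields class \<open>n + 1\<close>.\<close>

lemma smooth_on_inverse: "smooth_on (- {0}) (inverse :: complex \<Rightarrow> complex)"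
  unfolding smooth_on_def
proof
  fix n show "Ck_on n (- {0}) (inverse :: complex \<Rightarrow> complex)"
  proof (induction n)
    case 0
    show ?case by (auto intro!: continuous_intros)
  next
    case (Suc n)
    have D: "(inverse has_derivative (\<lambda>h. - (inverse x * h * inverse x))) (at x)" if "x \<noteq> 0" for x :: complex
      using has_derivative_inverse'[OF that] by simp
    have eq: "frechet_derivative inverse (at x) v = inverse x * (- v * inverse x)" if "x \<noteq> 0" for x v :: complex
      using frechet_derivative_at[OF D[OF that]] by (metis mult.assoc mult_minus_left mult_minus_right)
    have "Ck_on n (- {0}) (\<lambda>x. frechet_derivative inverse (at x) v)" for v :: complex
    proof (rule Ck_on_cong)
      show "Ck_on n (- {0}) (\<lambda>x. inverse x * (- v * inverse x))"
        by (intro bounded_bilinear.Ck_on[OF bounded_bilinear_mult] Suc Ck_on_const) auto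
      show "inverse x * (- v * inverse x) = frechet_derivative inverse (at x) v" if "x \<in> - {0}" for x
        using eq[of x v] that by (metis ComplD singletonI)
    qed auto
    with D show ?case by (auto simp: differentiable_def)
  qed
qed

text \<open>The derivative is the inverse, whose smoothness is known. The logarithm later supplies a
  smooth angle on the circle fibres.\<close>

lemma smooth_on_Ln: "smooth_on (- \<real>\<^sub>\<le>\<^sub>0) Ln"
  unfolding smooth_on_def
proof
  fix n
  have D: "(Ln has_derivative (\<lambda>h. inverse x * h)) (at x)" if "x \<notin> \<real>\<^sub>\<le>\<^sub>0" for x :: complex
    using has_field_derivative_Ln[OF that] by (simp add: has_field_derivative_def)
  have eq: "frechet_derivative Ln (at x) v = inverse x * v" if "x \<notin> \<real>\<^sub>\<le>\<^sub>0" for x v :: complex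
    using frechet_derivative_at[OF D[OF that]] by metis
  have op: "open (- \<real>\<^sub>\<le>\<^sub>0 :: complex set)" by (simp add: open_Compl)
  have "Ck_on n (- {0}) (inverse :: complex \<Rightarrow> complex)" for n
    using smooth_on_inverse by (simp add: smooth_on_def)
  then have inv: "Ck_on n (- \<real>\<^sub>\<le>\<^sub>0) (inverse :: complex \<Rightarrow> complex)" for n
    by (rule Ck_on_subset) auto
  have "Ck_on n (- \<real>\<^sub>\<le>\<^sub>0) (\<lambda>x. frechet_derivative Ln (at x) v)" for v n
    by (rule Ck_on_cong[OF op, of "\<lambda>x. inverse x * v"])
       (auto simp: eq intro!: bounded_bilinear.Ck_on[OF bounded_bilinear_mult] op inv Ck_on_const)
  with D have "Ck_on (Suc n) (- \<real>\<^sub>\<le>\<^sub>0) Ln" by (auto simp: differentiable_def)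
  then show "Ck_on n (- \<real>\<^sub>\<le>\<^sub>0) Ln" by (rule Ck_on_Suc_imp)
qed

section \<open>Parameter integrals and Hadamard's lemma\<close>

text \<open>Differentiation under the integral sign turns \<open>h\<close> into a directional
  derivative and contributes a factor \<open>t\<close>. With the weight \<open>t ^ k\<close> the
  family of such integrals is closed under differentiation, and the induction on the class goes
  through.\<close>

lemma smooth_on_integral_segment:
  fixes h :: "'a::euclidean_space \<Rightarrow> real"
  assumes "smooth_on S h" "open S" "convex S" "a \<in> S"
  shows "smooth_on S (\<lambda>x. integral {0..1} (\<lambda>t. t ^ k * h (a + t *\<^sub>R (x - a))))"
  unfolding smooth_on_def
proof
  have seg: "a + t *\<^sub>R (x - a) \<in> S" if "x \<in> S" "t \<in> {0..1}" for x and t :: real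
  proof -
    have "a + t *\<^sub>R (x - a) = (1 - t) *\<^sub>R a + t *\<^sub>R x" by (simp add: algebra_simps)
    then show ?thesis using assms(3,4) that by (auto intro!: convexD)
  qed
  have cont: "continuous_on (S \<times> {0..1}) (\<lambda>(x, t). t ^ k * h (a + t *\<^sub>R (x - a)))"
    if "continuous_on S h" for h :: "'a \<Rightarrow> real" and k
    unfolding case_prod_unfold
    by (intro continuous_intros continuous_on_compose2[OF that]) (use seg in auto)
  have hd: "((\<lambda>x. integral {0..1} (\<lambda>t. t ^ k * h (a + t *\<^sub>R (x - a)))) has_derivative
      (\<lambda>v. integral {0..1} (\<lambda>t. t ^ Suc k * frechet_derivative h (at (a + t *\<^sub>R (x - a))) v))) (at x)"
    if h: "smooth_on S h" and x: "x \<in> S" for h :: "'a \<Rightarrow> real" and k x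
  proof -
    \<comment> \<open>The derivative of the integrand as a bounded linear map, as the Leibniz rule
      requires; the left factor is the identity of the reals.\<close>
    define D where "D = (\<lambda>x t. blinfun_scaleR_left (1::real) o\<^sub>L
      Blinfun (\<lambda>v. t ^ Suc k * frechet_derivative h (at (a + t *\<^sub>R (x - a))) v))"
    have lin: "bounded_linear (\<lambda>v. t ^ Suc k * frechet_derivative h (at (a + t *\<^sub>R (x - a))) v)"
      if "x \<in> S" "t \<in> {0..1}" for x t
      by (intro bounded_linear_intros)
         (use smooth_on_imp_differentiable[OF h seg[OF that]] in
           \<open>simp add: linear_conv_bounded_linear[symmetric] linear_frechet_derivative_at\<close>)
    have D: "blinfun_apply (D x t) v = t ^ Suc k * frechet_derivative h (at (a + t *\<^sub>R (x - a))) v"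
      if "x \<in> S" "t \<in> {0..1}" for x t v
      using lin[OF that] by (simp add: D_def bounded_linear_Blinfun_apply)
    have cD: "continuous_on (S \<times> cbox 0 1) (\<lambda>(x, t). D x t)"
    \<comment> \<open>In finite dimension, continuity of an operator-valued map can be tested on
      each basis vector.\<close>
    proof (rule continuous_on_blinfun_componentwise)
      fix i :: 'a
      have "continuous_on S (\<lambda>y. frechet_derivative h (at y) i)"
        using smooth_on_frechet_derivative[OF h] by (rule smooth_on_imp_continuous_on)
      note cont[OF this, of "Suc k"]
      moreover have "blinfun_apply (case z of (x, t) \<Rightarrow> D x t) i =
          (\<lambda>(x, t). t ^ Suc k * frechet_derivative h (at (a + t *\<^sub>R (x - a))) i) z"
        if "z \<in> S \<times> {0..1}" for z
        using that D by (cases z) (simp del: power_Suc)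
      ultimately show "continuous_on (S \<times> cbox 0 1) (\<lambda>x. blinfun_apply (case x of (x, t) \<Rightarrow> D x t) i)"
        by (simp cong: continuous_on_cong add: cbox_interval)
    qed
    have "((\<lambda>x. integral (cbox 0 1) (\<lambda>t. t ^ k * h (a + t *\<^sub>R (x - a)))) has_derivative
        blinfun_apply (integral (cbox 0 1) (D x))) (at x within S)"
    proof (rule leibniz_rule[where U = S and fx = D])
      fix x and t :: real assume x: "x \<in> S" and t: "t \<in> cbox 0 1"
      have t': "t \<in> {0..1}" using t by simp
      have "(h has_derivative frechet_derivative h (at (a + t *\<^sub>R (x - a)))) (at (a + t *\<^sub>R (x - a)))"
        using smooth_on_imp_differentiable[OF h seg[OF x t']] frechet_derivative_works by blast
      moreover have "((\<lambda>x. a + t *\<^sub>R (x - a)) has_derivative (\<lambda>v. t *\<^sub>R v)) (at x)"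
        by (auto intro!: derivative_eq_intros)
      ultimately have "((\<lambda>x. h (a + t *\<^sub>R (x - a))) has_derivative
          (\<lambda>v. frechet_derivative h (at (a + t *\<^sub>R (x - a))) (t *\<^sub>R v))) (at x)"
        using has_derivative_compose by blast
      then have "((\<lambda>x. t ^ k * h (a + t *\<^sub>R (x - a))) has_derivative
          (\<lambda>v. t ^ k * frechet_derivative h (at (a + t *\<^sub>R (x - a))) (t *\<^sub>R v))) (at x)"
        by (rule has_derivative_mult_right)
      moreover have "(\<lambda>v. t ^ k * frechet_derivative h (at (a + t *\<^sub>R (x - a))) (t *\<^sub>R v)) = blinfun_apply (D x t)"
        using linear_frechet_derivative_at[OF smooth_on_imp_differentiable[OF h seg[OF x t']]]
        by (auto simp: D[OF x t'] linear_cmul)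
      ultimately show "((\<lambda>x. t ^ k * h (a + t *\<^sub>R (x - a))) has_derivative blinfun_apply (D x t)) (at x within S)"
        by (metis has_derivative_at_withinI)
    next
      fix x assume x: "x \<in> S"
      have "continuous_on {0..1} (\<lambda>t. (\<lambda>(x, t). t ^ k * h (a + t *\<^sub>R (x - a))) (x, t))"
        by (rule continuous_on_compose2[OF cont[OF smooth_on_imp_continuous_on[OF h], of k]])
           (use x in \<open>auto intro!: continuous_intros\<close>)
      then show "(\<lambda>t. t ^ k * h (a + t *\<^sub>R (x - a))) integrable_on cbox 0 1"
        by (intro integrable_continuous) simp
    qed (use cD x assms(3) in auto)
    moreover have "blinfun_apply (integral (cbox 0 1) (D x)) v =
      integral {0..1} (\<lambda>t. t ^ Suc k * frechet_derivative h (at (a + t *\<^sub>R (x - a))) v)" for v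
    proof -
      have "continuous_on (cbox 0 1) (\<lambda>t. (\<lambda>(x, t). D x t) (x, t))"
        by (rule continuous_on_compose2[OF cD]) (use x in \<open>auto intro!: continuous_intros\<close>)
      then have "D x integrable_on cbox 0 1" by (intro integrable_continuous) simp
      then have "integral (cbox 0 1) (\<lambda>t. blinfun_apply (D x t) v) = blinfun_apply (integral (cbox 0 1) (D x)) v"
        by (intro integral_linear[of _ _ "\<lambda>l. blinfun_apply l v", unfolded o_def] bounded_linear_intros)
      moreover have "integral (cbox 0 1) (\<lambda>t. blinfun_apply (D x t) v) =
          integral {0..1} (\<lambda>t. t ^ Suc k * frechet_derivative h (at (a + t *\<^sub>R (x - a))) v)"
        unfolding cbox_interval using x by (intro integral_cong) (simp add: D)
      ultimately show ?thesis by simp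
    qed
    ultimately show ?thesis
      unfolding at_within_open[OF x assms(2)] cbox_interval by (metis (no_types, lifting) ext)
  qed
  show "Ck_on n S (\<lambda>x. integral {0..1} (\<lambda>t. t ^ k * h (a + t *\<^sub>R (x - a))))" for n
    using assms(1)
  proof (induction n arbitrary: h k)
    case 0
    then show ?case using hd
      by (auto intro!: continuous_at_imp_continuous_on dest!: has_derivative_continuous)
  next
    case (Suc n h k)
    have "Ck_on n S (\<lambda>x. frechet_derivative (\<lambda>x. integral {0..1} (\<lambda>t. t ^ k * h (a + t *\<^sub>R (x - a)))) (at x) v)" for v
    proof (rule Ck_on_cong[OF assms(2)])
      show "Ck_on n S (\<lambda>x. integral {0..1} (\<lambda>t. t ^ Suc k * frechet_derivative h (at (a + t *\<^sub>R (x - a))) v))"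
        by (rule Suc.IH[of "\<lambda>y. frechet_derivative h (at y) v"]) (rule smooth_on_frechet_derivative[OF Suc.prems])
      show "integral {0..1} (\<lambda>t. t ^ Suc k * frechet_derivative h (at (a + t *\<^sub>R (x - a))) v) =
        frechet_derivative (\<lambda>x. integral {0..1} (\<lambda>t. t ^ k * h (a + t *\<^sub>R (x - a)))) (at x) v" if "x \<in> S" for x
        using frechet_derivative_at[OF hd[OF Suc.prems that, of k]] by metis
    qed
    moreover have "(\<lambda>x. integral {0..1} (\<lambda>t. t ^ k * h (a + t *\<^sub>R (x - a)))) differentiable (at x)" if "x \<in> S" for x
      using hd[OF Suc.prems that] unfolding differentiable_def by blast
    ultimately show ?case by simp
  qed
qed

text \<open>The coefficients are averages of the partial derivatives of \<open>f\<close> over the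
  segment from \<open>a\<close> to \<open>x\<close>. Their smoothness is the point: it allows a
  derivation at \<open>a\<close> to be applied to the products.\<close>

lemma hadamard:
  fixes f :: "'a::euclidean_space \<Rightarrow> real"
  assumes "smooth_on S f" "open S" "convex S" "a \<in> S"
  obtains g where "\<And>e. smooth_on S (g e)"
    "\<And>e. g e a = frechet_derivative f (at a) e"
    "\<And>x. x \<in> S \<Longrightarrow> f x = f a + (\<Sum>e\<in>Basis. ((x - a) \<bullet> e) * g e x)"
proof
  define g where "g e x = integral {0..1} (\<lambda>t. t ^ 0 * frechet_derivative f (at (a + t *\<^sub>R (x - a))) e)" for e x
  show "smooth_on S (g e)" for e
    unfolding g_def by (intro smooth_on_integral_segment smooth_on_frechet_derivative assms)
  show "g e a = frechet_derivative f (at a) e" for e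
    by (simp add: g_def)
  fix x assume x: "x \<in> S"
  have seg: "a + t *\<^sub>R (x - a) \<in> S" if "t \<in> {0..1}" for t :: real
  proof -
    have "a + t *\<^sub>R (x - a) = (1 - t) *\<^sub>R a + t *\<^sub>R x" by (simp add: algebra_simps)
    then show ?thesis using assms(3,4) x that by (auto intro!: convexD)
  qed
  define D where "D t = frechet_derivative f (at (a + t *\<^sub>R (x - a)))" for t
  have Df: "(f has_derivative D t) (at (a + t *\<^sub>R (x - a)))" if "t \<in> {0..1}" for t
    using smooth_on_imp_differentiable[OF assms(1) seg[OF that]] frechet_derivative_works
    unfolding D_def by blast
  have "((\<lambda>t. f (a + t *\<^sub>R (x - a))) has_vector_derivative D t (x - a)) (at t within {0..1})"
    if "t \<in> {0..1}" for t
  proof -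
    have "((\<lambda>t. a + t *\<^sub>R (x - a)) has_derivative (\<lambda>s. s *\<^sub>R (x - a))) (at t)"
      by (auto intro!: derivative_eq_intros)
    from has_derivative_compose[OF this Df[OF that]]
    have "((\<lambda>t. f (a + t *\<^sub>R (x - a))) has_derivative (\<lambda>s. D t (s *\<^sub>R (x - a)))) (at t)" .
    then show ?thesis
      using has_derivative_linear[OF Df[OF that]]
      by (simp add: has_vector_derivative_def linear_cmul has_derivative_at_withinI)
  qed
  then have "((\<lambda>t. D t (x - a)) has_integral f (a + 1 *\<^sub>R (x - a)) - f (a + 0 *\<^sub>R (x - a))) {0..1}"
    by (intro fundamental_theorem_of_calculus) auto
  then have "f x - f a = integral {0..1} (\<lambda>t. D t (x - a))"
    by (simp add: integral_unique)
  also have "\<dots> = integral {0..1} (\<lambda>t. \<Sum>e\<in>Basis. ((x - a) \<bullet> e) * D t e)"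
  proof (rule integral_cong)
    fix t :: real assume "t \<in> {0..1}"
    then interpret linear "D t" using Df has_derivative_linear by blast
    have "D t (x - a) = D t (\<Sum>e\<in>Basis. ((x - a) \<bullet> e) *\<^sub>R e)" by (simp add: euclidean_representation)
    then show "D t (x - a) = (\<Sum>e\<in>Basis. ((x - a) \<bullet> e) * D t e)" by (simp add: sum scale)
  qed
  also have "\<dots> = (\<Sum>e\<in>Basis. integral {0..1} (\<lambda>t. ((x - a) \<bullet> e) * D t e))"
  proof (rule integral_sum)
    fix e :: 'a
    have "continuous_on S (\<lambda>y. frechet_derivative f (at y) e)"
      by (intro smooth_on_imp_continuous_on smooth_on_frechet_derivative assms)
    then have "continuous_on {0..1} (\<lambda>t. D t e)"
      unfolding D_def by (rule continuous_on_compose2) (use seg in \<open>auto intro!: continuous_intros\<close>)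
    then show "(\<lambda>t. ((x - a) \<bullet> e) * D t e) integrable_on {0..1}"
      by (intro integrable_continuous_real continuous_intros)
  qed auto
  also have "\<dots> = (\<Sum>e\<in>Basis. ((x - a) \<bullet> e) * g e x)" by (simp add: g_def D_def)
  finally show "f x = f a + (\<Sum>e\<in>Basis. ((x - a) \<bullet> e) * g e x)" by simp
qed

section \<open>Smooth maps between manifolds\<close>

lemma
  assumes "smooth_manifold A" "(U, \<phi>) \<in> A"
  shows chart_open: "open U" and chart_image_open: "open (\<phi> ` U)"
    and chart_homeomorphism: "homeomorphism U (\<phi> ` U) \<phi> (inv_into U \<phi>)"
  using assms unfolding smooth_manifold_def by blast+

lemma chart_transition:
  assumes "smooth_manifold A" "(U, \<phi>) \<in> A" "(V, \<xi>) \<in> A"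
  shows "smooth_on (\<phi> ` (U \<inter> V)) (\<xi> \<circ> inv_into U \<phi>)"
  using assms unfolding smooth_manifold_def by blast

lemma chart_exists:
  assumes "smooth_manifold A"
  obtains U \<phi> where "(U, \<phi>) \<in> A" "p \<in> U"
proof -
  have "(\<Union>(U, \<phi>)\<in>A. U) = UNIV" using assms unfolding smooth_manifold_def by (rule conjunct1)
  then have "p \<in> (\<Union>(U, \<phi>)\<in>A. U)" by simp
  then show thesis using that by (elim UN_E) (simp split: prod.splits)
qed

lemma chart_inv:
  assumes "smooth_manifold A" "(U, \<phi>) \<in> A" "p \<in> U"
  shows "inv_into U \<phi> (\<phi> p) = p"
  using homeomorphism_apply1[OF chart_homeomorphism[OF assms(1,2)] assms(3)] .

lemma chart_image_open_subset:
  assumes "smooth_manifold A" "(U, \<phi>) \<in> A" "open N" "N \<subseteq> U"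
  shows "open (\<phi> ` N)"
proof -
  have "openin (top_of_set U) N" using assms chart_open open_openin_trans openin_open_eq by blast
  then have "openin (top_of_set (\<phi> ` U)) (\<phi> ` N)"
    using homeomorphism_imp_open_map[OF chart_homeomorphism[OF assms(1,2)]] by blast
  then show ?thesis using chart_image_open[OF assms(1,2)] openin_open_trans by blast
qed

lemma chart_preimage_open:
  assumes "smooth_manifold A" "(U, \<phi>) \<in> A" "open S"
  shows "open {p \<in> U. \<phi> p \<in> S}"
proof -
  have "continuous_on U \<phi>" using chart_homeomorphism[OF assms(1,2)] by (simp add: homeomorphism_def)
  then show ?thesis
    using continuous_open_preimage[of U \<phi> S] chart_open[OF assms(1,2)] assms(3)
    by (simp add: vimage_def Int_def)
qed

section \<open>Smoothness of maps at a point and its independence of charts\<close>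

lemma smooth_atI:
  assumes "(U, \<phi>) \<in> A" "(V, \<xi>) \<in> A'" "open N" "p \<in> N" "N \<subseteq> U" "F ` N \<subseteq> V"
    "smooth_on (\<phi> ` N) (\<xi> \<circ> F \<circ> inv_into U \<phi>)"
  shows "smooth_at A A' F p"
  using assms unfolding smooth_at_def by blast

lemma smooth_atE:
  assumes "smooth_at A A' F p"
  obtains U \<phi> V \<xi> N where "(U, \<phi>) \<in> A" "(V, \<xi>) \<in> A'" "open N" "p \<in> N" "N \<subseteq> U" "F ` N \<subseteq> V"
    "smooth_on (\<phi> ` N) (\<xi> \<circ> F \<circ> inv_into U \<phi>)"
  using assms unfolding smooth_at_def by blast

lemma smooth_at_nbhd:
  assumes "smooth_at A A' F p"
  obtains N where "open N" "p \<in> N" "\<And>q. q \<in> N \<Longrightarrow> smooth_at A A' F q"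
  using assms by (elim smooth_atE) (meson smooth_atI that)

text \<open>\<open>smooth_at\<close> does not postulate continuity. It follows from smoothness of
  the coordinate expression, conjugated by the chart homeomorphisms.\<close>

lemma smooth_at_continuous_nbhd:
  assumes A: "smooth_manifold A" and A': "smooth_manifold A'"
    and c: "(U, \<phi>) \<in> A" "(V, \<xi>) \<in> A'" "open N" "N \<subseteq> U" "F ` N \<subseteq> V"
    and s: "smooth_on (\<phi> ` N) (\<xi> \<circ> F \<circ> inv_into U \<phi>)"
  shows "continuous_on N F"
proof -
  have 1: "continuous_on N \<phi>"
    using chart_homeomorphism[OF A c(1)] c(4) continuous_on_subset by (auto simp: homeomorphism_def)
  have 2: "continuous_on N (\<lambda>q. (\<xi> \<circ> F \<circ> inv_into U \<phi>) (\<phi> q))"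
    by (rule continuous_on_compose2[OF smooth_on_imp_continuous_on[OF s] 1]) simp
  have eq: "(\<xi> \<circ> F \<circ> inv_into U \<phi>) (\<phi> q) = \<xi> (F q)" if "q \<in> N" for q
    using chart_inv[OF A c(1)] that c(4) by auto
  have 3: "continuous_on (\<xi> ` V) (inv_into V \<xi>)"
    using chart_homeomorphism[OF A' c(2)] by (simp add: homeomorphism_def)
  have "continuous_on N (\<lambda>q. inv_into V \<xi> ((\<xi> \<circ> F \<circ> inv_into U \<phi>) (\<phi> q)))"
    by (rule continuous_on_compose2[OF 3 2]) (use eq c(5) in auto)
  then show ?thesis
    by (rule continuous_on_eq) (use eq chart_inv[OF A' c(2)] c(5) in auto)
qed

lemma smooth_at_imp_isCont:
  assumes A: "smooth_manifold A" and A': "smooth_manifold A'" and "smooth_at A A' F p"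
  shows "isCont F p"
  using assms(3) smooth_at_continuous_nbhd[OF A A'] continuous_on_eq_continuous_at
  by (elim smooth_atE) blast

lemma smooth_at_cong:
  assumes "smooth_at A A' F p" "smooth_manifold A" "open M" "p \<in> M" "\<And>q. q \<in> M \<Longrightarrow> F q = G q"
  shows "smooth_at A A' G p"
proof -
  obtain U \<phi> V \<xi> N where c: "(U, \<phi>) \<in> A" "(V, \<xi>) \<in> A'" "open N" "p \<in> N" "N \<subseteq> U" "F ` N \<subseteq> V"
    and s: "smooth_on (\<phi> ` N) (\<xi> \<circ> F \<circ> inv_into U \<phi>)"
    using smooth_atE[OF assms(1)] by metis
  have op: "open (\<phi> ` (N \<inter> M))"
    using chart_image_open_subset[OF assms(2) c(1)] c(3,5) assms(3) by (meson le_infI1 open_Int)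
  have "smooth_on (\<phi> ` (N \<inter> M)) (\<xi> \<circ> G \<circ> inv_into U \<phi>)"
  proof (rule smooth_on_cong[OF smooth_on_subset[OF s] op])
    show "(\<xi> \<circ> F \<circ> inv_into U \<phi>) x = (\<xi> \<circ> G \<circ> inv_into U \<phi>) x" if "x \<in> \<phi> ` (N \<inter> M)" for x
      using that c(5) assms(5) chart_inv[OF assms(2) c(1)] by auto
  qed auto
  then show ?thesis
    by (rule smooth_atI[OF c(1,2), rotated -1]) (use c assms in auto)
qed

text \<open>The charts in \<open>smooth_at\<close> are existentially quantified; transition maps on
  both sides move the coordinate expression to prescribed charts. Continuity of \<open>F\<close>
  provides a neighbourhood that \<open>F\<close> maps into the prescribed target chart.\<close>

lemma smooth_at_chart:
  assumes A: "smooth_manifold A" and A': "smooth_manifold A'" and F: "smooth_at A A' F p"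
    and c: "(U, \<phi>) \<in> A" "p \<in> U" "(V, \<xi>) \<in> A'" "F p \<in> V"
  obtains N where "open N" "p \<in> N" "N \<subseteq> U" "F ` N \<subseteq> V"
    "smooth_on (\<phi> ` N) (\<xi> \<circ> F \<circ> inv_into U \<phi>)"
proof -
  obtain U' \<phi>' V' \<xi>' N' where d: "(U', \<phi>') \<in> A" "(V', \<xi>') \<in> A'" "open N'" "p \<in> N'" "N' \<subseteq> U'" "F ` N' \<subseteq> V'"
    and s: "smooth_on (\<phi>' ` N') (\<xi>' \<circ> F \<circ> inv_into U' \<phi>')"
    using smooth_atE[OF F] by metis
  define N where "N = {q \<in> N'. F q \<in> V} \<inter> U"
  have "continuous_on N' F" by (rule smooth_at_continuous_nbhd[OF A A' d(1,2,3,5,6) s])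
  then have "open {q \<in> N'. F q \<in> V}"
    using continuous_open_preimage[of N' F V] d(3) chart_open[OF A' c(3)] by (simp add: vimage_def Int_def)
  then have N: "open N" "p \<in> N" "N \<subseteq> U" "N \<subseteq> N'" "F ` N \<subseteq> V"
    using chart_open[OF A c(1)] c d(4) by (auto simp: N_def)
  have o1: "open (\<phi> ` N)" and o2: "open (\<phi>' ` N)"
    using chart_image_open_subset[OF A] N c(1) d(1,5) by blast+
  have t1: "smooth_on (\<phi> ` N) (\<phi>' \<circ> inv_into U \<phi>)"
    by (rule smooth_on_subset[OF chart_transition[OF A c(1) d(1)]]) (use N d(5) in blast)
  have o3: "open (\<xi>' ` (V' \<inter> V))"
    using chart_image_open_subset[OF A' d(2)] chart_open[OF A'] c(3) d(2) by (meson inf_le1 open_Int)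
  have t2: "smooth_on (\<xi>' ` (V' \<inter> V)) (\<xi> \<circ> inv_into V' \<xi>')"
    by (rule chart_transition[OF A' d(2) c(3)])
  have i1: "inv_into U \<phi> (\<phi> q) = q" "inv_into U' \<phi>' (\<phi>' q) = q" if "q \<in> N" for q
    using that N d(5) chart_inv[OF A c(1)] chart_inv[OF A d(1)] by blast+
  have i2: "inv_into V' \<xi>' (\<xi>' (F q)) = F q" if "q \<in> N" for q
    using that N d(6) chart_inv[OF A' d(2)] by blast
  have im1: "(\<phi>' \<circ> inv_into U \<phi>) ` (\<phi> ` N) \<subseteq> \<phi>' ` N" using i1 by auto
  have "smooth_on (\<phi> ` N) (\<lambda>x. (\<xi>' \<circ> F \<circ> inv_into U' \<phi>') ((\<phi>' \<circ> inv_into U \<phi>) x))"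
    by (rule smooth_on_compose[OF t1 smooth_on_subset[OF s] o1 o2 im1]) (use N in blast)
  from smooth_on_compose[OF this t2 o1 o3]
  have "smooth_on (\<phi> ` N) (\<lambda>x. (\<xi> \<circ> inv_into V' \<xi>') ((\<xi>' \<circ> F \<circ> inv_into U' \<phi>') ((\<phi>' \<circ> inv_into U \<phi>) x)))"
    using i1 N d(6) by fastforce
  then have "smooth_on (\<phi> ` N) (\<xi> \<circ> F \<circ> inv_into U \<phi>)"
    by (rule smooth_on_cong[OF _ o1]) (use i1 i2 in auto)
  with N that show thesis by blast
qed

lemma smooth_at_compose:
  assumes A: "smooth_manifold A" and A': "smooth_manifold A'" and A'': "smooth_manifold A''"
    and F: "smooth_at A A' F p" and G: "smooth_at A' A'' G (F p)"
  shows "smooth_at A A'' (\<lambda>q. G (F q)) p"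
proof -
  obtain V \<xi> W \<zeta> M where d: "(V, \<xi>) \<in> A'" "(W, \<zeta>) \<in> A''" "open M" "F p \<in> M" "M \<subseteq> V" "G ` M \<subseteq> W"
    and s: "smooth_on (\<xi> ` M) (\<zeta> \<circ> G \<circ> inv_into V \<xi>)"
    using smooth_atE[OF G] by metis
  obtain U \<phi> where c: "(U, \<phi>) \<in> A" "p \<in> U" using chart_exists[OF A] .
  obtain N where N: "open N" "p \<in> N" "N \<subseteq> U" "F ` N \<subseteq> V"
    and t: "smooth_on (\<phi> ` N) (\<xi> \<circ> F \<circ> inv_into U \<phi>)"
    using smooth_at_chart[OF A A' F c d(1)] d(4,5) by blast
  have "continuous_on N F" by (rule smooth_at_continuous_nbhd[OF A A' c(1) d(1) N(1,3,4) t])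
  then have "open {q \<in> N. F q \<in> M}"
    using continuous_open_preimage[of N F M] N(1) d(3) by (simp add: vimage_def Int_def)
  moreover define L where "L = {q \<in> N. F q \<in> M}"
  ultimately have L: "open L" "p \<in> L" "L \<subseteq> U" "L \<subseteq> N" "F ` L \<subseteq> M" using N d(4) by auto
  have i1: "inv_into U \<phi> (\<phi> q) = q" "inv_into V \<xi> (\<xi> (F q)) = F q" if "q \<in> L" for q
    using that L N chart_inv[OF A c(1)] chart_inv[OF A' d(1)] by blast+
  have o1: "open (\<phi> ` L)" using chart_image_open_subset[OF A c(1)] L by blast
  have o2: "open (\<xi> ` M)" using chart_image_open_subset[OF A' d(1)] d by blast
  have im: "(\<xi> \<circ> F \<circ> inv_into U \<phi>) ` (\<phi> ` L) \<subseteq> \<xi> ` M" using i1 L by auto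
  have "smooth_on (\<phi> ` L) (\<lambda>x. (\<zeta> \<circ> G \<circ> inv_into V \<xi>) ((\<xi> \<circ> F \<circ> inv_into U \<phi>) x))"
    by (rule smooth_on_compose[OF smooth_on_subset[OF t] s o1 o2 im]) (use L in blast)
  then have "smooth_on (\<phi> ` L) (\<zeta> \<circ> (\<lambda>q. G (F q)) \<circ> inv_into U \<phi>)"
    by (rule smooth_on_cong[OF _ o1]) (use i1 in auto)
  then show ?thesis
    by (rule smooth_atI[OF c(1) d(2), rotated -1]) (use L d(6) in blast)+
qed

section \<open>Model spaces and product manifolds\<close>

lemma inv_into_UNIV_ident: "inv_into UNIV (\<lambda>x. x) = (\<lambda>x. x)"
  by (auto simp: fun_eq_iff inv_into_def)

lemma smooth_manifold_std: "smooth_manifold std_atlas"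
  unfolding smooth_manifold_def std_atlas_def
  by (auto simp: inv_into_UNIV_ident homeomorphism_def o_def intro: smooth_on_bounded_linear[OF bounded_linear_ident])

lemma std_chart: "(UNIV, \<lambda>x. x) \<in> std_atlas"
  by (simp add: std_atlas_def)

lemma smooth_at_std_chart:
  assumes "smooth_manifold A" "smooth_at A std_atlas f p" "(U, \<phi>) \<in> A" "p \<in> U"
  obtains N where "open N" "p \<in> N" "N \<subseteq> U" "smooth_on (\<phi> ` N) (f \<circ> inv_into U \<phi>)"
proof (rule smooth_at_chart[OF assms(1) smooth_manifold_std assms(2-4) std_chart])
  fix N assume "open N" "p \<in> N" "N \<subseteq> U" "smooth_on (\<phi> ` N) ((\<lambda>x. x) \<circ> f \<circ> inv_into U \<phi>)"
  then show thesis by (intro that) (simp_all add: o_def)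
qed simp

lemma smooth_at_stdI:
  assumes "(U, \<phi>) \<in> A" "open N" "p \<in> N" "N \<subseteq> U" "smooth_on (\<phi> ` N) (f \<circ> inv_into U \<phi>)"
  shows "smooth_at A std_atlas f p"
  by (rule smooth_atI[OF assms(1) std_chart assms(2-4)]) (use assms(5) in \<open>auto simp: o_def\<close>)

lemma smooth_at_std_std:
  assumes "open N" "x \<in> N" "smooth_on N f"
  shows "smooth_at std_atlas std_atlas f x"
  by (rule smooth_at_stdI[OF std_chart assms(1,2)]) (use assms(3) in \<open>auto simp: inv_into_UNIV_ident o_def\<close>)

lemma smooth_at_const:
  assumes "smooth_manifold A" "smooth_manifold A'"
  shows "smooth_at A A' (\<lambda>_. c) p"
proof -
  obtain U \<phi> V \<xi> where "(U, \<phi>) \<in> A" "p \<in> U" "(V, \<xi>) \<in> A'" "c \<in> V"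
    using chart_exists[OF assms(1)] chart_exists[OF assms(2)] by metis
  then show ?thesis
    by (intro smooth_atI[of U \<phi> A V \<xi> A' U]) (auto simp: o_def chart_open[OF assms(1)] smooth_on_const)
qed

lemma smooth_at_ident:
  assumes "smooth_manifold A"
  shows "smooth_at A A (\<lambda>q. q) p"
proof -
  obtain U \<phi> where c: "(U, \<phi>) \<in> A" "p \<in> U" using chart_exists[OF assms] .
  have "smooth_on (\<phi> ` U) (\<phi> \<circ> (\<lambda>q. q) \<circ> inv_into U \<phi>)"
    using chart_transition[OF assms c(1) c(1)] by (simp add: o_def)
  with c show ?thesis by (intro smooth_atI[of U \<phi> A U \<phi> A U]) (auto simp: chart_open[OF assms])
qed

lemma smooth_at_chart_map:
  assumes "smooth_manifold A" "(U, \<phi>) \<in> A" "p \<in> U"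
  shows "smooth_at A std_atlas \<phi> p"
proof (rule smooth_at_stdI[OF assms(2) chart_open[OF assms(1,2)] assms(3)])
  show "smooth_on (\<phi> ` U) (\<phi> \<circ> inv_into U \<phi>)"
    using chart_transition[OF assms(1,2,2)] by simp
qed auto

lemma prod_chart:
  assumes "(U, \<phi>) \<in> A" "(V, \<xi>) \<in> A'"
  shows "(U \<times> V, map_prod \<phi> \<xi>) \<in> prod_atlas A A'"
  using assms unfolding prod_atlas_def by blast

text \<open>The choice made by \<open>inv_into\<close> is controlled only on the image of a chart,
  hence the restrictions on \<open>x\<close> and \<open>y\<close>.\<close>

lemma prod_chart_inv:
  assumes "smooth_manifold A" "smooth_manifold A'" "(U, \<phi>) \<in> A" "(V, \<xi>) \<in> A'" "x \<in> \<phi> ` U" "y \<in> \<xi> ` V"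
  shows "inv_into (U \<times> V) (map_prod \<phi> \<xi>) (x, y) = (inv_into U \<phi> x, inv_into V \<xi> y)"
proof (rule inv_into_f_eq)
  have "inj_on \<phi> U" "inj_on \<xi> V"
    using chart_inv[OF assms(1,3)] chart_inv[OF assms(2,4)] by (metis inj_on_inverseI)+
  then show "inj_on (map_prod \<phi> \<xi>) (U \<times> V)" by (rule map_prod_inj_on)
qed (use assms(5,6) in \<open>auto simp: inv_into_into f_inv_into_f\<close>)

lemma smooth_manifold_prod:
  fixes A :: "('m::{t2_space,second_countable_topology}, 'e::euclidean_space) atlas"
    and A' :: "('n::{t2_space,second_countable_topology}, 'f::euclidean_space) atlas"
  assumes A: "smooth_manifold A" and A': "smooth_manifold A'"
  shows "smooth_manifold (prod_atlas A A')"
  unfolding smooth_manifold_def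
proof (intro conjI)
  show "(\<Union>(U, \<phi>)\<in>prod_atlas A A'. U) = UNIV"
  proof (rule equalityI[OF subset_UNIV], rule subsetI)
    fix p :: "'m \<times> 'n"
    obtain U \<phi> V \<xi> where "(U, \<phi>) \<in> A" "fst p \<in> U" "(V, \<xi>) \<in> A'" "snd p \<in> V"
      using chart_exists[OF A] chart_exists[OF A'] by metis
    then have "(U \<times> V, map_prod \<phi> \<xi>) \<in> prod_atlas A A'" "p \<in> U \<times> V"
      using prod_chart by (auto simp: mem_Times_iff)
    then show "p \<in> (\<Union>(U, \<phi>)\<in>prod_atlas A A'. U)" by blast
  qed
  show "\<forall>(W, \<kappa>)\<in>prod_atlas A A'. open W \<and> open (\<kappa> ` W) \<and> homeomorphism W (\<kappa> ` W) \<kappa> (inv_into W \<kappa>)"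
  proof safe
    fix W \<kappa> assume "(W, \<kappa>) \<in> prod_atlas A A'"
    then obtain U \<phi> V \<xi> where W: "W = U \<times> V" "\<kappa> = map_prod \<phi> \<xi>" and c: "(U, \<phi>) \<in> A" "(V, \<xi>) \<in> A'"
      unfolding prod_atlas_def by blast
    note h1 = chart_homeomorphism[OF A c(1)] and h2 = chart_homeomorphism[OF A' c(2)]
    show "open W" unfolding W(1) by (rule open_Times[OF chart_open[OF A c(1)] chart_open[OF A' c(2)]])
    have im: "\<kappa> ` W = \<phi> ` U \<times> \<xi> ` V" using W by (simp add: map_prod_surj_on)
    show "open (\<kappa> ` W)" unfolding im by (rule open_Times[OF chart_image_open[OF A c(1)] chart_image_open[OF A' c(2)]])
    have inv: "inv_into W \<kappa> z = map_prod (inv_into U \<phi>) (inv_into V \<xi>) z" if "z \<in> \<kappa> ` W" for z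
      using prod_chart_inv[OF A A' c] that im W by (cases z) auto
    show "homeomorphism W (\<kappa> ` W) \<kappa> (inv_into W \<kappa>)"
    proof (rule homeomorphismI)
      have c1: "continuous_on U \<phi>" "continuous_on (\<phi> ` U) (inv_into U \<phi>)"
        and c2: "continuous_on V \<xi>" "continuous_on (\<xi> ` V) (inv_into V \<xi>)"
        using h1 h2 by (simp_all add: homeomorphism_def)
      have "continuous_on (U \<times> V) (\<lambda>z. (\<phi> (fst z), \<xi> (snd z)))"
        by (intro continuous_on_Pair continuous_on_compose2[OF c1(1) continuous_on_fst[OF continuous_on_id]]
            continuous_on_compose2[OF c2(1) continuous_on_snd[OF continuous_on_id]]) (simp_all add: image_subset_iff)
      then show "continuous_on W \<kappa>" by (simp add: W map_prod_def case_prod_beta')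
      have "continuous_on (\<phi> ` U \<times> \<xi> ` V) (\<lambda>z. (inv_into U \<phi> (fst z), inv_into V \<xi> (snd z)))"
        by (intro continuous_on_Pair continuous_on_compose2[OF c1(2) continuous_on_fst[OF continuous_on_id]]
            continuous_on_compose2[OF c2(2) continuous_on_snd[OF continuous_on_id]]) (simp_all add: image_subset_iff mem_Times_iff)
      then show "continuous_on (\<kappa> ` W) (inv_into W \<kappa>)"
        unfolding im by (rule continuous_on_eq) (simp add: inv im map_prod_def case_prod_beta')
      show "inv_into W \<kappa> ` (\<kappa> ` W) \<subseteq> W" by (rule image_subsetI) (rule inv_into_into)
      show "inv_into W \<kappa> (\<kappa> x) = x" if "x \<in> W" for x
        using that inv[OF imageI[OF that]] chart_inv[OF A c(1)] chart_inv[OF A' c(2)] by (cases x) (simp add: W)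
      show "\<kappa> (inv_into W \<kappa> y) = y" if "y \<in> \<kappa> ` W" for y using that by (rule f_inv_into_f)
    qed auto
  qed
  show "\<forall>(W, \<kappa>)\<in>prod_atlas A A'. \<forall>(W', \<kappa>')\<in>prod_atlas A A'. smooth_on (\<kappa> ` (W \<inter> W')) (\<kappa>' \<circ> inv_into W \<kappa>)"
  proof safe
    fix W \<kappa> W' \<kappa>' assume "(W, \<kappa>) \<in> prod_atlas A A'" "(W', \<kappa>') \<in> prod_atlas A A'"
    then obtain U \<phi> V \<xi> U' \<phi>' V' \<xi>' where W: "W = U \<times> V" "\<kappa> = map_prod \<phi> \<xi>" "W' = U' \<times> V'" "\<kappa>' = map_prod \<phi>' \<xi>'"
      and c: "(U, \<phi>) \<in> A" "(V, \<xi>) \<in> A'" "(U', \<phi>') \<in> A" "(V', \<xi>') \<in> A'"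
      unfolding prod_atlas_def by blast
    have eq: "\<kappa> ` (W \<inter> W') = \<phi> ` (U \<inter> U') \<times> \<xi> ` (V \<inter> V')"
      using W by (simp add: Times_Int_Times map_prod_surj_on)
    have o1: "open (\<phi> ` (U \<inter> U'))" and o2: "open (\<xi> ` (V \<inter> V'))"
      using chart_image_open_subset[OF A c(1) open_Int[OF chart_open[OF A c(1)] chart_open[OF A c(3)]]]
        chart_image_open_subset[OF A' c(2) open_Int[OF chart_open[OF A' c(2)] chart_open[OF A' c(4)]]]
      by simp_all
    then have o: "open (\<phi> ` (U \<inter> U') \<times> \<xi> ` (V \<inter> V'))" by (rule open_Times)
    have "smooth_on (\<phi> ` (U \<inter> U') \<times> \<xi> ` (V \<inter> V')) (\<lambda>z. (\<phi>' \<circ> inv_into U \<phi>) (fst z))"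
      by (rule smooth_on_compose[OF smooth_on_bounded_linear[OF bounded_linear_fst] chart_transition[OF A c(1,3)] o o1]) auto
    moreover have "smooth_on (\<phi> ` (U \<inter> U') \<times> \<xi> ` (V \<inter> V')) (\<lambda>z. (\<xi>' \<circ> inv_into V \<xi>) (snd z))"
      by (rule smooth_on_compose[OF smooth_on_bounded_linear[OF bounded_linear_snd] chart_transition[OF A' c(2,4)] o o2]) auto
    ultimately have "smooth_on (\<phi> ` (U \<inter> U') \<times> \<xi> ` (V \<inter> V'))
        (\<lambda>z. ((\<phi>' \<circ> inv_into U \<phi>) (fst z), (\<xi>' \<circ> inv_into V \<xi>) (snd z)))"
      by (rule smooth_on_Pair[OF _ _ o])
    then show "smooth_on (\<kappa> ` (W \<inter> W')) (\<kappa>' \<circ> inv_into W \<kappa>)"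
      unfolding eq by (rule smooth_on_cong[OF _ o]) (use W prod_chart_inv[OF A A' c(1,2)] in auto)
  qed
qed

lemma smooth_at_Pair:
  assumes A: "smooth_manifold A" and B: "smooth_manifold B" and C: "smooth_manifold C"
    and F: "smooth_at A B F p" and G: "smooth_at A C G p"
  shows "smooth_at A (prod_atlas B C) (\<lambda>q. (F q, G q)) p"
proof -
  obtain U \<phi> V \<xi> V' \<xi>' where c: "(U, \<phi>) \<in> A" "p \<in> U" "(V, \<xi>) \<in> B" "F p \<in> V" "(V', \<xi>') \<in> C" "G p \<in> V'"
    using chart_exists[OF A] chart_exists[OF B] chart_exists[OF C] by metis
  obtain N where N: "open N" "p \<in> N" "N \<subseteq> U" "F ` N \<subseteq> V" "smooth_on (\<phi> ` N) (\<xi> \<circ> F \<circ> inv_into U \<phi>)"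
    using smooth_at_chart[OF A B F c(1-4)] by blast
  obtain N' where N': "open N'" "p \<in> N'" "N' \<subseteq> U" "G ` N' \<subseteq> V'" "smooth_on (\<phi> ` N') (\<xi>' \<circ> G \<circ> inv_into U \<phi>)"
    using smooth_at_chart[OF A C G c(1,2,5,6)] by blast
  have o: "open (\<phi> ` (N \<inter> N'))"
    using chart_image_open_subset[OF A c(1)] N N' by (meson le_infI1 open_Int)
  have "smooth_on (\<phi> ` (N \<inter> N')) (\<lambda>x. ((\<xi> \<circ> F \<circ> inv_into U \<phi>) x, (\<xi>' \<circ> G \<circ> inv_into U \<phi>) x))"
    by (rule smooth_on_Pair[OF smooth_on_subset[OF N(5)] smooth_on_subset[OF N'(5)] o]) auto
  then have "smooth_on (\<phi> ` (N \<inter> N')) (map_prod \<xi> \<xi>' \<circ> (\<lambda>q. (F q, G q)) \<circ> inv_into U \<phi>)"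
    by (simp add: o_def)
  then show ?thesis
    by (rule smooth_atI[OF c(1) prod_chart[OF c(3,5)], rotated -1]) (use N N' in auto)
qed

lemma smooth_at_fst:
  assumes A: "smooth_manifold A" and B: "smooth_manifold B"
  shows "smooth_at (prod_atlas A B) A fst p"
proof -
  obtain U \<phi> V \<xi> where c: "(U, \<phi>) \<in> A" "fst p \<in> U" "(V, \<xi>) \<in> B" "snd p \<in> V"
    using chart_exists[OF A] chart_exists[OF B] by metis
  have o: "open (\<phi> ` U \<times> \<xi> ` V)" by (rule open_Times[OF chart_image_open[OF A c(1)] chart_image_open[OF B c(3)]])
  have "smooth_on (\<phi> ` U \<times> \<xi> ` V) (\<phi> \<circ> fst \<circ> inv_into (U \<times> V) (map_prod \<phi> \<xi>))"
    by (rule smooth_on_cong[OF smooth_on_bounded_linear[OF bounded_linear_fst] o])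
       (use prod_chart_inv[OF A B c(1,3)] in \<open>auto simp: f_inv_into_f\<close>)
  then have "smooth_on (map_prod \<phi> \<xi> ` (U \<times> V)) (\<phi> \<circ> fst \<circ> inv_into (U \<times> V) (map_prod \<phi> \<xi>))"
    by (simp add: map_prod_surj_on)
  then show ?thesis
    by (rule smooth_atI[OF prod_chart[OF c(1,3)] c(1), rotated -1])
       (use c chart_open[OF A c(1)] chart_open[OF B c(3)] in \<open>auto simp: mem_Times_iff intro!: open_Times\<close>)
qed

lemma smooth_at_snd:
  assumes A: "smooth_manifold A" and B: "smooth_manifold B"
  shows "smooth_at (prod_atlas A B) B snd p"
proof -
  obtain U \<phi> V \<xi> where c: "(U, \<phi>) \<in> A" "fst p \<in> U" "(V, \<xi>) \<in> B" "snd p \<in> V"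
    using chart_exists[OF A] chart_exists[OF B] by metis
  have o: "open (\<phi> ` U \<times> \<xi> ` V)" by (rule open_Times[OF chart_image_open[OF A c(1)] chart_image_open[OF B c(3)]])
  have "smooth_on (\<phi> ` U \<times> \<xi> ` V) (\<xi> \<circ> snd \<circ> inv_into (U \<times> V) (map_prod \<phi> \<xi>))"
    by (rule smooth_on_cong[OF smooth_on_bounded_linear[OF bounded_linear_snd] o])
       (use prod_chart_inv[OF A B c(1,3)] in \<open>auto simp: f_inv_into_f\<close>)
  then have "smooth_on (map_prod \<phi> \<xi> ` (U \<times> V)) (\<xi> \<circ> snd \<circ> inv_into (U \<times> V) (map_prod \<phi> \<xi>))"
    by (simp add: map_prod_surj_on)
  then show ?thesis
    by (rule smooth_atI[OF prod_chart[OF c(1,3)] c(3), rotated -1])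
       (use c chart_open[OF A c(1)] chart_open[OF B c(3)] in \<open>auto simp: mem_Times_iff intro!: open_Times\<close>)
qed

text \<open>A common chart and a common neighbourhood reduce every pointwise operation to one on
  open sets of the model space; sums, products and inner products are the instances.\<close>

lemma smooth_fun_at_binop:
  fixes A :: "('m::{t2_space,second_countable_topology}, 'e::euclidean_space) atlas"
  assumes A: "smooth_manifold A" and f: "smooth_at A std_atlas f p" and g: "smooth_at A std_atlas g p"
    and h: "\<And>(S :: 'e set) u v. open S \<Longrightarrow> smooth_on S u \<Longrightarrow> smooth_on S v \<Longrightarrow> smooth_on S (\<lambda>x. h (u x) (v x))"
  shows "smooth_at A std_atlas (\<lambda>q. h (f q) (g q)) p"
proof -
  obtain U \<phi> where c: "(U, \<phi>) \<in> A" "p \<in> U" using chart_exists[OF A] .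
  obtain N where N: "open N" "p \<in> N" "N \<subseteq> U" "smooth_on (\<phi> ` N) (f \<circ> inv_into U \<phi>)"
    using smooth_at_std_chart[OF A f c] .
  obtain N' where N': "open N'" "p \<in> N'" "N' \<subseteq> U" "smooth_on (\<phi> ` N') (g \<circ> inv_into U \<phi>)"
    using smooth_at_std_chart[OF A g c] .
  have o: "open (\<phi> ` (N \<inter> N'))"
    using chart_image_open_subset[OF A c(1)] N N' by (meson le_infI1 open_Int)
  have "smooth_on (\<phi> ` (N \<inter> N')) (\<lambda>x. h ((f \<circ> inv_into U \<phi>) x) ((g \<circ> inv_into U \<phi>) x))"
    using smooth_on_subset[OF N(4)] smooth_on_subset[OF N'(4)] by (intro h[OF o]) (simp_all add: image_mono o_def)
  then show ?thesis
    by (intro smooth_at_stdI[OF c(1), of "N \<inter> N'"]) (use N N' in \<open>auto simp: o_def\<close>)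
qed

lemma smooth_fun_at_add:
  "smooth_manifold A \<Longrightarrow> smooth_at A std_atlas f p \<Longrightarrow> smooth_at A std_atlas g p \<Longrightarrow>
    smooth_at A std_atlas (\<lambda>q. f q + g q) p"
  by (rule smooth_fun_at_binop) (auto intro: smooth_on_add)

lemma smooth_fun_at_mult:
  "smooth_manifold A \<Longrightarrow> smooth_fun_at A f p \<Longrightarrow> smooth_fun_at A g p \<Longrightarrow>
    smooth_fun_at A (\<lambda>q. f q * g q) p"
  by (rule smooth_fun_at_binop) (auto intro: smooth_on_mult)

lemma smooth_fun_at_const: "smooth_manifold A \<Longrightarrow> smooth_at A std_atlas (\<lambda>_. c) p"
  by (rule smooth_at_const[OF _ smooth_manifold_std])

lemma smooth_fun_at_sum:
  assumes "smooth_manifold A" "finite I" "\<And>i. i \<in> I \<Longrightarrow> smooth_fun_at A (f i) p"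
  shows "smooth_fun_at A (\<lambda>q. \<Sum>i\<in>I. f i q) p"
  using assms(2,3)
  by (induction I rule: finite_induct) (simp_all add: smooth_fun_at_const smooth_fun_at_add assms(1))

lemma smooth_fun_at_coordinate:
  assumes "smooth_manifold A" "(U, \<phi>) \<in> A" "p \<in> U"
  shows "smooth_fun_at A (\<lambda>q. \<phi> q \<bullet> e) p"
  by (rule smooth_fun_at_binop[OF assms(1) smooth_at_chart_map[OF assms] smooth_fun_at_const[OF assms(1)]])
     (rule bounded_bilinear.smooth_on[OF bounded_bilinear_inner])

section \<open>Tangent vectors and vector fields\<close>

lemma tangent_spaceI:
  assumes "\<And>f. \<not> smooth_fun_at A f p \<Longrightarrow> v f = 0"
    "\<And>f c. smooth_fun_at A f p \<Longrightarrow> v (\<lambda>x. c * f x) = c * v f"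
    "\<And>f g. smooth_fun_at A f p \<Longrightarrow> smooth_fun_at A g p \<Longrightarrow> v (\<lambda>x. f x + g x) = v f + v g"
    "\<And>f g. smooth_fun_at A f p \<Longrightarrow> smooth_fun_at A g p \<Longrightarrow> v (\<lambda>x. f x * g x) = f p * v g + g p * v f"
  shows "v \<in> tangent_space A p"
  using assms unfolding tangent_space_def by simp

lemma
  assumes "v \<in> tangent_space A p"
  shows tangent_not_smooth: "\<not> smooth_fun_at A f p \<Longrightarrow> v f = 0"
    and tangent_cmult: "smooth_fun_at A f p \<Longrightarrow> v (\<lambda>x. c * f x) = c * v f"
    and tangent_add: "smooth_fun_at A f p \<Longrightarrow> smooth_fun_at A g p \<Longrightarrow> v (\<lambda>x. f x + g x) = v f + v g"
    and tangent_mult: "smooth_fun_at A f p \<Longrightarrow> smooth_fun_at A g p \<Longrightarrow>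
      v (\<lambda>x. f x * g x) = f p * v g + g p * v f"
  using assms unfolding tangent_space_def by simp_all

lemma tangent_eqI:
  assumes "v \<in> tangent_space A p" "w \<in> tangent_space A p" "\<And>f. smooth_fun_at A f p \<Longrightarrow> v f = w f"
  shows "v = w"
proof
  fix f show "v f = w f"
    using assms by (cases "smooth_fun_at A f p") (simp_all add: tangent_not_smooth)
qed

lemma tangent_const:
  assumes "smooth_manifold A" "v \<in> tangent_space A p"
  shows "v (\<lambda>_. c) = 0"
proof -
  have "v (\<lambda>_. 1 * 1) = 0"
    using tangent_mult[OF assms(2) smooth_fun_at_const[OF assms(1), of 1] smooth_fun_at_const[OF assms(1), of 1]]
    by simp
  then show ?thesis
    using tangent_cmult[OF assms(2) smooth_fun_at_const[OF assms(1), of 1], of c] by simp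
qed

text \<open>
  The function \<open>f - g\<close> vanishes near \<open>p\<close>, hence equals its product with the indicator function of the
  complement of a neighbourhood of \<open>p\<close>; both factors are smooth at \<open>p\<close> and vanish there.
\<close>

lemma tangent_germ:
  assumes A: "smooth_manifold A" and v: "v \<in> tangent_space A p"
    and N: "open N" "p \<in> N" "\<And>q. q \<in> N \<Longrightarrow> f q = g q"
  shows "v f = v g"
proof (cases "smooth_fun_at A g p")
  case True
  define b where "b q = (if q \<in> N then 0 else 1 :: real)" for q
  define d where "d q = f q + - 1 * g q" for q
  have f: "smooth_fun_at A f p" using smooth_at_cong[OF True A N(1,2)] N(3) by simp
  have mg: "smooth_fun_at A (\<lambda>q. - 1 * g q) p"
    by (rule smooth_fun_at_mult[OF A smooth_fun_at_const[OF A] True])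
  have d: "smooth_fun_at A d p" unfolding d_def by (rule smooth_fun_at_add[OF A f mg])
  have b: "smooth_fun_at A b p"
    by (rule smooth_at_cong[OF smooth_fun_at_const[OF A, of 0] A N(1,2)]) (simp add: b_def)
  have "d = (\<lambda>q. d q * b q)" using N(3) by (simp add: b_def d_def fun_eq_iff)
  moreover have "v (\<lambda>q. d q * b q) = 0"
    using tangent_mult[OF v d b] N by (simp add: b_def d_def)
  ultimately have "v d = 0" by simp
  then show ?thesis
    using tangent_add[OF v f mg] tangent_cmult[OF v True, of "- 1"] unfolding d_def by simp
next
  case False
  then have "\<not> smooth_fun_at A f p" using smooth_at_cong[OF _ A N(1,2)] N(3) by blast
  then show ?thesis using False tangent_not_smooth[OF v] by simp
qed

lemma tangent_space_zero: "0 \<in> tangent_space A p"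
  by (rule tangent_spaceI) simp_all

lemma tangent_space_plus:
  assumes "v \<in> tangent_space A p" "w \<in> tangent_space A p"
  shows "v + w \<in> tangent_space A p"
  by (rule tangent_spaceI)
     (simp_all add: tangent_not_smooth[OF assms(1)] tangent_not_smooth[OF assms(2)]
       tangent_cmult[OF assms(1)] tangent_cmult[OF assms(2)] tangent_add[OF assms(1)] tangent_add[OF assms(2)]
       tangent_mult[OF assms(1)] tangent_mult[OF assms(2)] algebra_simps)

lemma tangent_space_scaleR:
  assumes "v \<in> tangent_space A p"
  shows "c *\<^sub>R v \<in> tangent_space A p"
  by (rule tangent_spaceI)
     (simp_all add: scaleR_fun_def tangent_not_smooth[OF assms] tangent_cmult[OF assms] tangent_add[OF assms]
       tangent_mult[OF assms] algebra_simps)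

lemma tangent_space_uminus: "v \<in> tangent_space A p \<Longrightarrow> - v \<in> tangent_space A p"
  using tangent_space_scaleR[of v A p "- 1"] by simp

lemma tangent_space_diff:
  "v \<in> tangent_space A p \<Longrightarrow> w \<in> tangent_space A p \<Longrightarrow> v - w \<in> tangent_space A p"
  using tangent_space_plus[of v A p "- w"] tangent_space_uminus by fastforce

lemma sum_fun_apply: "(\<Sum>i\<in>I. f i) x = (\<Sum>i\<in>I. f i x)"
  by (induction I rule: infinite_finite_induct) simp_all

lemma tangent_space_sum:
  "(\<And>i. i \<in> I \<Longrightarrow> v i \<in> tangent_space A p) \<Longrightarrow> (\<Sum>i\<in>I. v i) \<in> tangent_space A p"
  by (induction I rule: infinite_finite_induct) (simp_all add: tangent_space_zero tangent_space_plus)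

lemma tangent_sum:
  assumes "smooth_manifold A" "v \<in> tangent_space A p" "finite I" "\<And>i. i \<in> I \<Longrightarrow> smooth_fun_at A (f i) p"
  shows "v (\<lambda>q. \<Sum>i\<in>I. f i q) = (\<Sum>i\<in>I. v (f i))"
  using assms(3,4)
  by (induction I rule: finite_induct)
     (simp_all add: tangent_const[OF assms(1,2)] tangent_add[OF assms(2)] smooth_fun_at_sum[OF assms(1)])

section \<open>Coordinate vectors and the dimension of tangent spaces\<close>

text \<open>The partial derivative in direction \<open>e\<close>, with the value 0 that
  \<open>tangent_space\<close> prescribes on functions not smooth at \<open>p\<close>.\<close>

definition chart_vector ::
    "('m::topological_space, 'e::euclidean_space) atlas \<Rightarrow> 'm set \<Rightarrow> ('m \<Rightarrow> 'e) \<Rightarrow> 'e \<Rightarrow> 'm vfield" where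
  "chart_vector A U \<phi> e p =
     (\<lambda>f. if smooth_fun_at A f p then frechet_derivative (f \<circ> inv_into U \<phi>) (at (\<phi> p)) e else 0)"

lemma smooth_fun_at_differentiable:
  assumes A: "smooth_manifold A" and c: "(U, \<phi>) \<in> A" "p \<in> U" and f: "smooth_fun_at A f p"
  shows "(f \<circ> inv_into U \<phi>) differentiable (at (\<phi> p))"
proof -
  obtain N where "open N" "p \<in> N" "N \<subseteq> U" "smooth_on (\<phi> ` N) (f \<circ> inv_into U \<phi>)"
    using smooth_at_std_chart[OF A f c] .
  then show ?thesis by (intro smooth_on_imp_differentiable[of "\<phi> ` N"]) simp_all
qed

lemma chart_vector_apply:
  assumes "smooth_manifold A" "(U, \<phi>) \<in> A" "p \<in> U" "smooth_fun_at A f p"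
    "(f \<circ> inv_into U \<phi> has_derivative D) (at (\<phi> p))"
  shows "chart_vector A U \<phi> e p f = D e"
  using assms(4) frechet_derivative_at[OF assms(5)] by (simp add: chart_vector_def)

lemma chart_vector_in_tangent_space:
  assumes A: "smooth_manifold A" and c: "(U, \<phi>) \<in> A" "p \<in> U"
  shows "chart_vector A U \<phi> e p \<in> tangent_space A p"
proof (rule tangent_spaceI)
  note app = chart_vector_apply[OF A c]
  define D where "D f = frechet_derivative (f \<circ> inv_into U \<phi>) (at (\<phi> p))" for f :: "'a \<Rightarrow> real"
  have D: "(f \<circ> inv_into U \<phi> has_derivative D f) (at (\<phi> p))" if "smooth_fun_at A f p" for f
    using smooth_fun_at_differentiable[OF A c that] unfolding D_def frechet_derivative_works .
  have Df: "chart_vector A U \<phi> e p f = D f e" if "smooth_fun_at A f p" for f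
    by (rule app[OF that D[OF that]])
  show "chart_vector A U \<phi> e p f = 0" if "\<not> smooth_fun_at A f p" for f
    using that by (simp add: chart_vector_def)
  show "chart_vector A U \<phi> e p (\<lambda>x. k * f x) = k * chart_vector A U \<phi> e p f" if f: "smooth_fun_at A f p" for f k
  proof -
    have "(\<lambda>x. k * f x) \<circ> inv_into U \<phi> = (\<lambda>y. k * (f \<circ> inv_into U \<phi>) y)" by (simp add: o_def)
    then show ?thesis
      using app[OF smooth_fun_at_mult[OF A smooth_fun_at_const[OF A] f], of k "\<lambda>v. k * D f v" e]
        has_derivative_mult_right[OF D[OF f], of k] Df[OF f] by simp
  qed
  show "chart_vector A U \<phi> e p (\<lambda>x. f x + g x) = chart_vector A U \<phi> e p f + chart_vector A U \<phi> e p g"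
    if f: "smooth_fun_at A f p" and g: "smooth_fun_at A g p" for f g
  proof -
    have "(\<lambda>x. f x + g x) \<circ> inv_into U \<phi> = (\<lambda>y. (f \<circ> inv_into U \<phi>) y + (g \<circ> inv_into U \<phi>) y)" by (simp add: o_def)
    then show ?thesis
      using app[OF smooth_fun_at_add[OF A f g], of "\<lambda>v. D f v + D g v" e]
        has_derivative_add[OF D[OF f] D[OF g]] Df[OF f] Df[OF g] by simp
  qed
  show "chart_vector A U \<phi> e p (\<lambda>x. f x * g x) = f p * chart_vector A U \<phi> e p g + g p * chart_vector A U \<phi> e p f"
    if f: "smooth_fun_at A f p" and g: "smooth_fun_at A g p" for f g
  proof -
    have "(\<lambda>x. f x * g x) \<circ> inv_into U \<phi> = (\<lambda>y. (f \<circ> inv_into U \<phi>) y * (g \<circ> inv_into U \<phi>) y)" by (simp add: o_def)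
    then show ?thesis
      using app[OF smooth_fun_at_mult[OF A f g], of "\<lambda>v. f p * D g v + D f v * g p" e]
        has_derivative_mult[OF D[OF f] D[OF g]] Df[OF f] Df[OF g] chart_inv[OF A c] by simp
  qed
qed

text \<open>By Hadamard's lemma \<open>f\<close> is near \<open>p\<close> a constant plus coordinate
  differences times smooth functions. A derivation kills the constant, and the Leibniz rule at
  \<open>p\<close> leaves only its values on the coordinates.\<close>

lemma tangent_chart_expansion:
  fixes A :: "('m::{t2_space,second_countable_topology}, 'e::euclidean_space) atlas"
  assumes A: "smooth_manifold A" and c: "(U, \<phi>) \<in> A" "p \<in> U" and v: "v \<in> tangent_space A p"
  shows "v = (\<Sum>e\<in>Basis. v (\<lambda>q. \<phi> q \<bullet> e) *\<^sub>R chart_vector A U \<phi> e p)"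
proof (rule tangent_eqI[OF v])
  show "(\<Sum>e\<in>Basis. v (\<lambda>q. \<phi> q \<bullet> e) *\<^sub>R chart_vector A U \<phi> e p) \<in> tangent_space A p"
    by (intro tangent_space_sum tangent_space_scaleR chart_vector_in_tangent_space[OF A c])
  fix f assume f: "smooth_fun_at A f p"
  obtain N where N: "open N" "p \<in> N" "N \<subseteq> U" and s: "smooth_on (\<phi> ` N) (f \<circ> inv_into U \<phi>)"
    using smooth_at_std_chart[OF A f c] .
  have "open (\<phi> ` N)" by (rule chart_image_open_subset[OF A c(1) N(1,3)])
  then obtain r where r: "r > 0" "ball (\<phi> p) r \<subseteq> \<phi> ` N" using N(2) open_contains_ball by blast
  \<comment> \<open>Hadamard's lemma needs a convex domain, hence a ball inside the chart
    image.\<close>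
  define S where "S = ball (\<phi> p) r"
  have "smooth_on S (f \<circ> inv_into U \<phi>)" using s r(2) smooth_on_subset S_def by blast
  moreover have "open S" "convex S" "\<phi> p \<in> S" using r(1) by (simp_all add: S_def)
  ultimately obtain g where g: "\<And>e. smooth_on S (g e)"
    "\<And>e. g e (\<phi> p) = frechet_derivative (f \<circ> inv_into U \<phi>) (at (\<phi> p)) e"
    "\<And>x. x \<in> S \<Longrightarrow> (f \<circ> inv_into U \<phi>) x = (f \<circ> inv_into U \<phi>) (\<phi> p) + (\<Sum>e\<in>Basis. ((x - \<phi> p) \<bullet> e) * g e x)"
    by (rule hadamard) blast
  define M where "M = {q \<in> U. \<phi> q \<in> S}"
  have M: "open M" "p \<in> M" "M \<subseteq> U"
    using chart_preimage_open[OF A c(1), of S] c(2) r(1) by (simp_all add: M_def S_def)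
  have fM: "f q = f p + (\<Sum>e\<in>Basis. (\<phi> q \<bullet> e + - (\<phi> p \<bullet> e)) * g e (\<phi> q))" if "q \<in> M" for q
    using g(3)[of "\<phi> q"] that chart_inv[OF A c(1)] c(2) by (simp add: M_def inner_diff_left)
  have sg: "smooth_fun_at A (\<lambda>q. g e (\<phi> q)) p" for e
  proof (rule smooth_at_compose[OF A smooth_manifold_std smooth_manifold_std smooth_at_chart_map[OF A c]])
    show "smooth_fun_at std_atlas (g e) (\<phi> p)"
      by (rule smooth_at_std_std[OF _ _ g(1)]) (simp_all add: S_def r(1))
  qed
  have sx: "smooth_fun_at A (\<lambda>q. \<phi> q \<bullet> e + - (\<phi> p \<bullet> e)) p" for e
    by (intro smooth_fun_at_add[OF A] smooth_fun_at_coordinate[OF A c] smooth_fun_at_const[OF A])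
  have sm: "smooth_fun_at A (\<lambda>q. (\<phi> q \<bullet> e + - (\<phi> p \<bullet> e)) * g e (\<phi> q)) p" for e
    by (rule smooth_fun_at_mult[OF A sx sg])
  have vx: "v (\<lambda>q. \<phi> q \<bullet> e + - (\<phi> p \<bullet> e)) = v (\<lambda>q. \<phi> q \<bullet> e)" for e
    by (subst tangent_add[OF v smooth_fun_at_coordinate[OF A c] smooth_fun_at_const[OF A]])
       (simp only: tangent_const[OF A v] add_0_right)
  have "v f = v (\<lambda>q. f p + (\<Sum>e\<in>Basis. (\<phi> q \<bullet> e + - (\<phi> p \<bullet> e)) * g e (\<phi> q)))"
    by (rule tangent_germ[OF A v M(1,2) fM])
  also have "\<dots> = (\<Sum>e\<in>Basis. v (\<lambda>q. (\<phi> q \<bullet> e + - (\<phi> p \<bullet> e)) * g e (\<phi> q)))"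
    by (subst tangent_add[OF v smooth_fun_at_const[OF A] smooth_fun_at_sum[OF A finite_Basis sm]])
       (simp only: tangent_sum[OF A v finite_Basis sm] tangent_const[OF A v] add_0_left)
  also have "\<dots> = (\<Sum>e\<in>Basis. v (\<lambda>q. \<phi> q \<bullet> e) * frechet_derivative (f \<circ> inv_into U \<phi>) (at (\<phi> p)) e)"
  proof (rule sum.cong[OF refl])
    fix e
    have "v (\<lambda>q. (\<phi> q \<bullet> e + - (\<phi> p \<bullet> e)) * g e (\<phi> q)) =
        (\<phi> p \<bullet> e + - (\<phi> p \<bullet> e)) * v (\<lambda>q. g e (\<phi> q)) + g e (\<phi> p) * v (\<lambda>q. \<phi> q \<bullet> e + - (\<phi> p \<bullet> e))"
      by (rule tangent_mult[OF v sx sg])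
    then show "v (\<lambda>q. (\<phi> q \<bullet> e + - (\<phi> p \<bullet> e)) * g e (\<phi> q)) =
        v (\<lambda>q. \<phi> q \<bullet> e) * frechet_derivative (f \<circ> inv_into U \<phi>) (at (\<phi> p)) e"
      unfolding vx g(2) by (simp only: add.right_inverse mult_zero_left add_0_left mult.commute)
  qed
  also have "\<dots> = (\<Sum>e\<in>Basis. v (\<lambda>q. \<phi> q \<bullet> e) *\<^sub>R chart_vector A U \<phi> e p) f"
    using f by (simp add: sum_fun_apply scaleR_fun_def chart_vector_def)
  finally show "v f = (\<Sum>e\<in>Basis. v (\<lambda>q. \<phi> q \<bullet> e) *\<^sub>R chart_vector A U \<phi> e p) f" .
qed

section \<open>Smooth vector fields, local extensions and tensoriality\<close>

lemma smooth_vfieldI: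
  assumes "\<And>p. p \<in> U \<Longrightarrow> X p \<in> tangent_space A p"
    "\<And>f p. p \<in> U \<Longrightarrow> smooth_fun_at A f p \<Longrightarrow> smooth_fun_at A (\<lambda>q. X q f) p"
  shows "smooth_vfield_on A U X"
  using assms unfolding smooth_vfield_on_def by blast

lemma smooth_vfield_tangent: "smooth_vfield_on A U X \<Longrightarrow> p \<in> U \<Longrightarrow> X p \<in> tangent_space A p"
  unfolding smooth_vfield_on_def by blast

lemma smooth_vfield_smooth:
  "smooth_vfield_on A U X \<Longrightarrow> p \<in> U \<Longrightarrow> smooth_fun_at A f p \<Longrightarrow> smooth_fun_at A (\<lambda>q. X q f) p"
  unfolding smooth_vfield_on_def by blast

lemma smooth_vfield_subset: "smooth_vfield_on A U X \<Longrightarrow> V \<subseteq> U \<Longrightarrow> smooth_vfield_on A V X"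
  unfolding smooth_vfield_on_def by blast

lemma smooth_vfield_cong:
  assumes A: "smooth_manifold A" and "smooth_vfield_on A U X" "open U" "\<And>q. q \<in> U \<Longrightarrow> X q = Y q"
  shows "smooth_vfield_on A U Y"
proof (rule smooth_vfieldI)
  show "Y p \<in> tangent_space A p" if "p \<in> U" for p
    using smooth_vfield_tangent[OF assms(2) that] assms(4)[OF that] by simp
  show "smooth_fun_at A (\<lambda>q. Y q f) p" if "p \<in> U" "smooth_fun_at A f p" for f p
    by (rule smooth_at_cong[OF smooth_vfield_smooth[OF assms(2) that] A assms(3) that(1)]) (simp add: assms(4))
qed

lemma smooth_vfield_locality:
  assumes "\<And>p. p \<in> U \<Longrightarrow> \<exists>V. p \<in> V \<and> smooth_vfield_on A V X"
  shows "smooth_vfield_on A U X"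
  using assms unfolding smooth_vfield_on_def by meson

lemma smooth_vfield_zero: "smooth_manifold A \<Longrightarrow> smooth_vfield_on A U (\<lambda>_. 0)"
  by (rule smooth_vfieldI) (simp_all add: tangent_space_zero smooth_fun_at_const)

lemma smooth_vfield_add:
  assumes "smooth_manifold A" "smooth_vfield_on A U X" "smooth_vfield_on A U Y"
  shows "smooth_vfield_on A U (\<lambda>q. X q + Y q)"
  by (rule smooth_vfieldI)
     (simp_all add: tangent_space_plus smooth_vfield_tangent[OF assms(2)] smooth_vfield_tangent[OF assms(3)]
       smooth_fun_at_add[OF assms(1)] smooth_vfield_smooth[OF assms(2)] smooth_vfield_smooth[OF assms(3)])

lemma smooth_vfield_scaleR:
  assumes "smooth_manifold A" "\<And>q. q \<in> U \<Longrightarrow> smooth_fun_at A f q" "smooth_vfield_on A U X"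
  shows "smooth_vfield_on A U (\<lambda>q. f q *\<^sub>R X q)"
proof (rule smooth_vfieldI)
  show "f p *\<^sub>R X p \<in> tangent_space A p" if "p \<in> U" for p
    by (rule tangent_space_scaleR[OF smooth_vfield_tangent[OF assms(3) that]])
  show "smooth_fun_at A (\<lambda>q. (f q *\<^sub>R X q) g) p" if "p \<in> U" "smooth_fun_at A g p" for g p
    unfolding scaleR_fun_def real_scaleR_def
    by (rule smooth_fun_at_mult[OF assms(1) assms(2)[OF that(1)] smooth_vfield_smooth[OF assms(3) that]])
qed

lemma smooth_vfield_sum:
  assumes "smooth_manifold A" "\<And>i. i \<in> I \<Longrightarrow> smooth_vfield_on A U (X i)"
  shows "smooth_vfield_on A U (\<lambda>q. \<Sum>i\<in>I. X i q)"
  using assms(2)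
  by (induction I rule: infinite_finite_induct) (simp_all add: smooth_vfield_zero smooth_vfield_add assms(1))

lemma smooth_vfield_chart_vector:
  assumes A: "smooth_manifold A" and c: "(U, \<phi>) \<in> A"
  shows "smooth_vfield_on A U (chart_vector A U \<phi> e)"
proof (rule smooth_vfieldI)
  show "chart_vector A U \<phi> e p \<in> tangent_space A p" if "p \<in> U" for p
    by (rule chart_vector_in_tangent_space[OF A c that])
  fix f p assume p: "p \<in> U" and f: "smooth_fun_at A f p"
  obtain N where N: "open N" "p \<in> N" "N \<subseteq> U" and s: "smooth_on (\<phi> ` N) (f \<circ> inv_into U \<phi>)"
    using smooth_at_std_chart[OF A f c p] .
  have fN: "smooth_fun_at A f q" if "q \<in> N" for q
    by (rule smooth_at_stdI[OF c N(1) that N(3) s])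
  have eq: "frechet_derivative (f \<circ> inv_into U \<phi>) (at x) e = ((\<lambda>q. chart_vector A U \<phi> e q f) \<circ> inv_into U \<phi>) x"
    if x: "x \<in> \<phi> ` N" for x
  proof -
    obtain q where q: "q \<in> N" "x = \<phi> q" using x by blast
    then have "inv_into U \<phi> x = q" using chart_inv[OF A c] N(3) by blast
    with fN[OF q(1)] q(2) show ?thesis by (simp add: chart_vector_def)
  qed
  have "smooth_on (\<phi> ` N) ((\<lambda>q. chart_vector A U \<phi> e q f) \<circ> inv_into U \<phi>)"
    by (rule smooth_on_cong[OF smooth_on_frechet_derivative[OF s] chart_image_open_subset[OF A c N(1,3)] eq])
  then show "smooth_fun_at A (\<lambda>q. chart_vector A U \<phi> e q f) p"
    by (rule smooth_at_stdI[OF c N])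
qed

text \<open>Constant coefficients in one chart suffice. Since fields are only required on an open
  set around the point, no cutoff functions occur.\<close>

lemma tangent_extension:
  assumes A: "smooth_manifold A" and v: "v \<in> tangent_space A p"
  obtains U X where "open U" "p \<in> U" "smooth_vfield_on A U X" "X p = v"
proof -
  obtain U \<phi> where c: "(U, \<phi>) \<in> A" "p \<in> U" using chart_exists[OF A] .
  define X where "X q = (\<Sum>e\<in>Basis. v (\<lambda>q. \<phi> q \<bullet> e) *\<^sub>R chart_vector A U \<phi> e q)" for q
  have "smooth_vfield_on A U X" unfolding X_def
    by (intro smooth_vfield_sum[OF A] smooth_vfield_scaleR[OF A] smooth_fun_at_const[OF A]
        smooth_vfield_chart_vector[OF A c(1)])
  moreover have "X p = v" unfolding X_def by (rule tangent_chart_expansion[OF A c v, symmetric])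
  ultimately show thesis using that chart_open[OF A c(1)] c(2) by blast
qed

text \<open>
  In a chart around \<open>p\<close>, the field \<open>X\<close> is a combination of coordinate fields with coefficients that
  are smooth functions vanishing at \<open>p\<close>.
\<close>

lemma tensorial_zero:
  fixes A :: "('m::{t2_space,second_countable_topology}, 'e::euclidean_space) atlas"
    and F :: "'m vfield \<Rightarrow> 'v::real_vector"
  assumes A: "smooth_manifold A"
    and add: "\<And>V X Y. open V \<Longrightarrow> p \<in> V \<Longrightarrow> smooth_vfield_on A V X \<Longrightarrow> smooth_vfield_on A V Y \<Longrightarrow>
      F (\<lambda>q. X q + Y q) = F X + F Y"
    and scale: "\<And>V X f. open V \<Longrightarrow> p \<in> V \<Longrightarrow> smooth_vfield_on A V X \<Longrightarrow> (\<And>q. q \<in> V \<Longrightarrow> smooth_fun_at A f q) \<Longrightarrow>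
      F (\<lambda>q. f q *\<^sub>R X q) = f p *\<^sub>R F X"
    and germ: "\<And>V X Y. open V \<Longrightarrow> p \<in> V \<Longrightarrow> smooth_vfield_on A V X \<Longrightarrow> smooth_vfield_on A V Y \<Longrightarrow>
      (\<And>q. q \<in> V \<Longrightarrow> X q = Y q) \<Longrightarrow> F X = F Y"
    and X: "open V" "p \<in> V" "smooth_vfield_on A V X" "X p = 0"
  shows "F X = 0"
proof -
  obtain U \<phi> where c: "(U, \<phi>) \<in> A" "p \<in> U" using chart_exists[OF A] .
  define N where "N = V \<inter> U"
  have N: "open N" "p \<in> N" "N \<subseteq> U" "N \<subseteq> V" using X(1,2) c chart_open[OF A c(1)] by (simp_all add: N_def open_Int)
  define a where "a e q = X q (\<lambda>r. \<phi> r \<bullet> e)" for e q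
  define E where "E = chart_vector A U \<phi>"
  have E: "smooth_vfield_on A N (E e)" for e
    unfolding E_def by (rule smooth_vfield_subset[OF smooth_vfield_chart_vector[OF A c(1)] N(3)])
  have a: "smooth_fun_at A (a e) q" if "q \<in> N" for e q
    unfolding a_def using that N by (intro smooth_vfield_smooth[OF X(3)] smooth_fun_at_coordinate[OF A c(1)]) blast+
  have aE: "smooth_vfield_on A N (\<lambda>q. a e q *\<^sub>R E e q)" for e
    by (rule smooth_vfield_scaleR[OF A a E])
  have XN: "X q = (\<Sum>e\<in>Basis. a e q *\<^sub>R E e q)" if "q \<in> N" for q
    unfolding a_def E_def using that N smooth_vfield_tangent[OF X(3)]
    by (intro tangent_chart_expansion[OF A c(1)]) blast+
  have F0: "F (\<lambda>_. 0) = 0"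
    using scale[OF N(1,2) smooth_vfield_zero[OF A] smooth_fun_at_const[OF A, of 0]]
    by (simp only: scaleR_zero_left)
  have sum: "F (\<lambda>q. \<Sum>e\<in>I. a e q *\<^sub>R E e q) = (\<Sum>e\<in>I. a e p *\<^sub>R F (E e))" if "finite I" for I
    using that
  proof (induction I rule: finite_induct)
    case empty
    show ?case by (simp only: sum.empty F0)
  next
    case (insert e I)
    have "F (\<lambda>q. \<Sum>e\<in>insert e I. a e q *\<^sub>R E e q) = F (\<lambda>q. a e q *\<^sub>R E e q + (\<Sum>e\<in>I. a e q *\<^sub>R E e q))"
      using insert(1,2) by simp
    also have "\<dots> = F (\<lambda>q. a e q *\<^sub>R E e q) + F (\<lambda>q. \<Sum>e\<in>I. a e q *\<^sub>R E e q)"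
      by (rule add[OF N(1,2) aE smooth_vfield_sum[OF A aE]])
    also have "F (\<lambda>q. a e q *\<^sub>R E e q) = a e p *\<^sub>R F (E e)" by (rule scale[OF N(1,2) E a])
    finally show ?case using insert by simp
  qed
  have "F X = F (\<lambda>q. \<Sum>e\<in>Basis. a e q *\<^sub>R E e q)"
    by (rule germ[OF N(1,2) smooth_vfield_subset[OF X(3) N(4)] smooth_vfield_sum[OF A aE] XN])
  also have "\<dots> = (\<Sum>e\<in>Basis. a e p *\<^sub>R F (E e))" by (rule sum) simp
  also have "\<dots> = 0" using X(4) by (simp add: a_def)
  finally show ?thesis .
qed

text \<open>The vanishing case is applied to the difference of the two fields on their common
  domain.\<close>

lemma tensorial:
  fixes A :: "('m::{t2_space,second_countable_topology}, 'e::euclidean_space) atlas"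
    and F :: "'m vfield \<Rightarrow> 'v::real_vector"
  assumes A: "smooth_manifold A"
    and add: "\<And>V X Y. open V \<Longrightarrow> p \<in> V \<Longrightarrow> smooth_vfield_on A V X \<Longrightarrow> smooth_vfield_on A V Y \<Longrightarrow>
      F (\<lambda>q. X q + Y q) = F X + F Y"
    and scale: "\<And>V X f. open V \<Longrightarrow> p \<in> V \<Longrightarrow> smooth_vfield_on A V X \<Longrightarrow> (\<And>q. q \<in> V \<Longrightarrow> smooth_fun_at A f q) \<Longrightarrow>
      F (\<lambda>q. f q *\<^sub>R X q) = f p *\<^sub>R F X"
    and germ: "\<And>V X Y. open V \<Longrightarrow> p \<in> V \<Longrightarrow> smooth_vfield_on A V X \<Longrightarrow> smooth_vfield_on A V Y \<Longrightarrow>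
      (\<And>q. q \<in> V \<Longrightarrow> X q = Y q) \<Longrightarrow> F X = F Y"
    and X: "open V" "p \<in> V" "smooth_vfield_on A V X" and Y: "open V'" "p \<in> V'" "smooth_vfield_on A V' Y"
    and eq: "X p = Y p"
  shows "F X = F Y"
proof -
  define N where "N = V \<inter> V'"
  have N: "open N" "p \<in> N" "smooth_vfield_on A N X" "smooth_vfield_on A N Y"
    using X Y by (auto simp: N_def intro: smooth_vfield_subset)
  \<comment> \<open>The difference is written with a sum and a scalar multiple, the two operations
    for which \<open>F\<close> is known to be compatible.\<close>
  define D where "D q = X q + (- 1) *\<^sub>R Y q" for q
  have D: "smooth_vfield_on A N D" unfolding D_def
    by (intro smooth_vfield_add[OF A N(3)] smooth_vfield_scaleR[OF A _ N(4)] smooth_fun_at_const[OF A])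
  have "F D = 0"
    by (rule tensorial_zero[where F = F, OF A add scale germ N(1,2) D]) (simp_all add: D_def eq)
  moreover have "F (\<lambda>q. D q + Y q) = F D + F Y" by (rule add[OF N(1,2) D N(4)])
  moreover have "(\<lambda>q. D q + Y q) = X" by (simp add: D_def fun_eq_iff scaleR_fun_def)
  ultimately show ?thesis by simp
qed

section \<open>Push-forward of tangent vectors\<close>

lemma push_forward_tangent:
  assumes A: "smooth_manifold A" and A': "smooth_manifold A'"
    and F: "smooth_at A A' F p" and v: "v \<in> tangent_space A p"
  shows "push_forward A' F p v \<in> tangent_space A' (F p)"
proof (rule tangent_spaceI)
  note sm = smooth_at_compose[OF A A' smooth_manifold_std F]
  note P = push_forward_def o_def
  show "push_forward A' F p v f = 0" if "\<not> smooth_fun_at A' f (F p)" for f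
    using that by (simp add: P)
  show "push_forward A' F p v (\<lambda>x. c * f x) = c * push_forward A' F p v f" if "smooth_fun_at A' f (F p)" for f c
    using tangent_cmult[OF v sm[OF that]] that
      smooth_fun_at_mult[OF A' smooth_fun_at_const[OF A'] that] by (simp add: P)
  show "push_forward A' F p v (\<lambda>x. f x + g x) = push_forward A' F p v f + push_forward A' F p v g"
    if "smooth_fun_at A' f (F p)" "smooth_fun_at A' g (F p)" for f g
    using tangent_add[OF v sm[OF that(1)] sm[OF that(2)]] that smooth_fun_at_add[OF A' that] by (simp add: P)
  show "push_forward A' F p v (\<lambda>x. f x * g x) = f (F p) * push_forward A' F p v g + g (F p) * push_forward A' F p v f"
    if "smooth_fun_at A' f (F p)" "smooth_fun_at A' g (F p)" for f g
    using tangent_mult[OF v sm[OF that(1)] sm[OF that(2)]] that smooth_fun_at_mult[OF A' that] by (simp add: P)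
qed

lemma push_forward_add: "push_forward A' F p (v + w) = push_forward A' F p v + push_forward A' F p w"
  by (auto simp: push_forward_def fun_eq_iff)

lemma push_forward_scaleR: "push_forward A' F p (c *\<^sub>R v) = c *\<^sub>R push_forward A' F p v"
  by (auto simp: push_forward_def fun_eq_iff scaleR_fun_def)

lemma push_forward_uminus: "push_forward A' F p (- v) = - push_forward A' F p v"
  using push_forward_scaleR[of A' F p "- 1" v] by simp

lemma push_forward_diff: "push_forward A' F p (v - w) = push_forward A' F p v - push_forward A' F p w"
  using push_forward_add[of A' F p v "- w"] by (simp add: push_forward_uminus)

lemma push_forward_zero: "push_forward A' F p 0 = 0"
  using push_forward_scaleR[of A' F p 0 0] by simp

lemma push_forward_sum: "push_forward A' F p (\<Sum>i\<in>I. v i) = (\<Sum>i\<in>I. push_forward A' F p (v i))"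
  by (induction I rule: infinite_finite_induct) (simp_all add: push_forward_zero push_forward_add del: zero_fun_apply plus_fun_apply)

section \<open>Germs of vector fields, Lie brackets and the exterior derivative of 1-forms\<close>

text \<open>Tangent vectors are functions; the simplifier should not replace sums of them by pointwise sums.\<close>

declare plus_fun_apply [simp del] zero_fun_apply [simp del]

lemma scaleR_fun_apply: "(c *\<^sub>R f) x = c *\<^sub>R f x"
  by (simp add: scaleR_fun_def)

lemmas tvec_apply = plus_fun_apply zero_fun_apply minus_apply uminus_apply scaleR_fun_apply

text \<open>All tensors are evaluated at a single point, so a field matters only through its germ
  there. Hiding the domain in the quantifier avoids intersecting domains in every later
  statement.\<close>

definition vfield_near ::
    "('m::topological_space, 'e::euclidean_space) atlas \<Rightarrow> 'm \<Rightarrow> 'm vfield \<Rightarrow> bool"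
  where "vfield_near A p X \<longleftrightarrow> (\<exists>U. open U \<and> p \<in> U \<and> smooth_vfield_on A U X)"

lemma vfield_nearI: "smooth_vfield_on A U X \<Longrightarrow> open U \<Longrightarrow> p \<in> U \<Longrightarrow> vfield_near A p X"
  unfolding vfield_near_def by blast

lemma vfield_near_tangent: "vfield_near A p X \<Longrightarrow> X p \<in> tangent_space A p"
  unfolding vfield_near_def using smooth_vfield_tangent by blast

lemma vfield_near_smooth: "vfield_near A p X \<Longrightarrow> smooth_fun_at A f p \<Longrightarrow> smooth_fun_at A (\<lambda>q. X q f) p"
  unfolding vfield_near_def using smooth_vfield_smooth by blast

lemma vfield_near_eventually: "vfield_near A p X \<Longrightarrow> \<forall>\<^sub>F q in nhds p. vfield_near A q X"
  unfolding vfield_near_def eventually_nhds by blast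

lemma vfield_near_eventually_tangent:
  "vfield_near A p X \<Longrightarrow> \<forall>\<^sub>F q in nhds p. X q \<in> tangent_space A q"
  by (rule eventually_mono[OF vfield_near_eventually vfield_near_tangent])

lemma smooth_vfield_iff_near:
  "open U \<Longrightarrow> smooth_vfield_on A U X \<longleftrightarrow> (\<forall>p\<in>U. vfield_near A p X)"
  unfolding vfield_near_def using smooth_vfield_locality[of U A X] by blast

lemma smooth_at_eventually: "smooth_at A A' F p \<Longrightarrow> \<forall>\<^sub>F q in nhds p. smooth_at A A' F q"
  by (erule smooth_at_nbhd) (auto simp: eventually_nhds)

lemma smooth_at_cong_eventually:
  assumes "smooth_manifold A" "smooth_at A A' F p" "\<forall>\<^sub>F q in nhds p. F q = G q"
  shows "smooth_at A A' G p"
  using assms(3) smooth_at_cong[OF assms(2,1)] unfolding eventually_nhds by blast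

lemma tangent_germ_eventually:
  assumes "smooth_manifold A" "v \<in> tangent_space A p" "\<forall>\<^sub>F q in nhds p. f q = g q"
  shows "v f = v g"
  using assms(3) tangent_germ[OF assms(1,2)] unfolding eventually_nhds by blast

lemma vfield_near_zero: "smooth_manifold A \<Longrightarrow> vfield_near A p (\<lambda>_. 0)"
  by (rule vfield_nearI[OF smooth_vfield_zero open_UNIV UNIV_I])

lemma vfield_near_add:
  assumes A: "smooth_manifold A" and "vfield_near A p X" "vfield_near A p Y"
  shows "vfield_near A p (\<lambda>q. X q + Y q)"
proof -
  obtain U V where U: "open U" "p \<in> U" "smooth_vfield_on A U X" and V: "open V" "p \<in> V" "smooth_vfield_on A V Y"
    using assms(2,3) unfolding vfield_near_def by blast
  show ?thesis
    by (rule vfield_nearI[OF smooth_vfield_add[OF A smooth_vfield_subset[OF U(3)] smooth_vfield_subset[OF V(3)]]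
          open_Int[OF U(1) V(1)]]) (simp_all add: U V)
qed

lemma vfield_near_scaleR:
  assumes A: "smooth_manifold A" and f: "smooth_fun_at A f p" and X: "vfield_near A p X"
  shows "vfield_near A p (\<lambda>q. f q *\<^sub>R X q)"
proof -
  obtain U where U: "open U" "p \<in> U" "smooth_vfield_on A U X" using X unfolding vfield_near_def by blast
  obtain N where N: "open N" "p \<in> N" "\<And>q. q \<in> N \<Longrightarrow> smooth_fun_at A f q" using smooth_at_nbhd[OF f] by blast
  have "smooth_vfield_on A (N \<inter> U) (\<lambda>q. f q *\<^sub>R X q)"
    by (rule smooth_vfield_scaleR[OF A N(3) smooth_vfield_subset[OF U(3)]]) simp_all
  then show ?thesis by (rule vfield_nearI[OF _ open_Int[OF N(1) U(1)]]) (simp add: U N)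
qed

lemma vfield_near_cmult: "smooth_manifold A \<Longrightarrow> vfield_near A p X \<Longrightarrow> vfield_near A p (\<lambda>q. c *\<^sub>R X q)"
  by (rule vfield_near_scaleR[OF _ smooth_fun_at_const])

lemma vfield_near_sum:
  assumes "smooth_manifold A" "\<And>i. i \<in> I \<Longrightarrow> vfield_near A p (X i)"
  shows "vfield_near A p (\<lambda>q. \<Sum>i\<in>I. X i q)"
  using assms(2)
  by (induction I rule: infinite_finite_induct) (simp_all add: vfield_near_zero vfield_near_add assms(1))

lemma vfield_near_cong:
  assumes A: "smooth_manifold A" and "vfield_near A p X" "\<forall>\<^sub>F q in nhds p. X q = Y q"
  shows "vfield_near A p Y"
proof -
  obtain U V where U: "open U" "p \<in> U" "smooth_vfield_on A U X" and V: "open V" "p \<in> V" "\<And>q. q \<in> V \<Longrightarrow> X q = Y q"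
    using assms(2,3) unfolding vfield_near_def eventually_nhds by blast
  have "smooth_vfield_on A (U \<inter> V) Y"
    by (rule smooth_vfield_cong[OF A smooth_vfield_subset[OF U(3)] open_Int[OF U(1) V(1)] V(3)]) simp_all
  then show ?thesis by (rule vfield_nearI[OF _ open_Int[OF U(1) V(1)]]) (simp add: U V)
qed

lemma vfield_near_extension:
  assumes "smooth_manifold A" "v \<in> tangent_space A p"
  obtains X where "vfield_near A p X" "X p = v"
  using tangent_extension[OF assms] vfield_nearI by metis

lemma tensorial_near:
  fixes A :: "('m::{t2_space,second_countable_topology}, 'e::euclidean_space) atlas"
    and F :: "'m vfield \<Rightarrow> 'v::real_vector"
  assumes A: "smooth_manifold A"
    and add: "\<And>X Y. vfield_near A p X \<Longrightarrow> vfield_near A p Y \<Longrightarrow> F (\<lambda>q. X q + Y q) = F X + F Y"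
    and scale: "\<And>X f. vfield_near A p X \<Longrightarrow> smooth_fun_at A f p \<Longrightarrow> F (\<lambda>q. f q *\<^sub>R X q) = f p *\<^sub>R F X"
    and germ: "\<And>X Y. vfield_near A p X \<Longrightarrow> vfield_near A p Y \<Longrightarrow> \<forall>\<^sub>F q in nhds p. X q = Y q \<Longrightarrow> F X = F Y"
    and X: "vfield_near A p X" and Y: "vfield_near A p Y" and eq: "X p = Y p"
  shows "F X = F Y"
proof -
  obtain U V where U: "open U" "p \<in> U" "smooth_vfield_on A U X" and V: "open V" "p \<in> V" "smooth_vfield_on A V Y"
    using X Y unfolding vfield_near_def by blast
  show ?thesis
  proof (rule tensorial[where F = F, OF A _ _ _ U V eq])
    fix W X Y assume W: "open W" "p \<in> W" "smooth_vfield_on A W X" "smooth_vfield_on A W Y"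
    then have n: "vfield_near A p X" "vfield_near A p Y" using vfield_nearI by blast+
    show "F (\<lambda>q. X q + Y q) = F X + F Y" by (rule add[OF n])
    show "F X = F Y" if "\<And>q. q \<in> W \<Longrightarrow> X q = Y q"
      by (rule germ[OF n]) (use W that in \<open>auto simp: eventually_nhds\<close>)
  next
    fix W X f assume W: "open W" "p \<in> W" "smooth_vfield_on A W X" "\<And>q. q \<in> W \<Longrightarrow> smooth_fun_at A f q"
    show "F (\<lambda>q. f q *\<^sub>R X q) = f p *\<^sub>R F X"
      by (rule scale[OF vfield_nearI[OF W(3,1,2)] W(4)[OF W(2)]])
  qed
qed

section \<open>Lie brackets\<close>

lemma lie_bracket_apply:
  "smooth_fun_at A f p \<Longrightarrow> lie_bracket A X Y p f = X p (\<lambda>q. Y q f) - Y p (\<lambda>q. X q f)"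
  by (simp add: lie_bracket_def)

text \<open>A bracket differentiates the function \<open>q \<mapsto> X q f\<close>, so the
  derivation rules are needed on a neighbourhood of \<open>p\<close> and not only at
  \<open>p\<close>.\<close>

lemma vfield_near_add_apply:
  assumes "vfield_near A p X" "smooth_fun_at A f p" "smooth_fun_at A g p"
  shows "\<forall>\<^sub>F q in nhds p. X q (\<lambda>x. f x + g x) = X q f + X q g"
    and "\<forall>\<^sub>F q in nhds p. X q (\<lambda>x. f x * g x) = f q * X q g + g q * X q f"
    and "\<forall>\<^sub>F q in nhds p. X q (\<lambda>x. c * f x) = c * X q f"
  using vfield_near_eventually_tangent[OF assms(1)] smooth_at_eventually[OF assms(2)] smooth_at_eventually[OF assms(3)]
  by (eventually_elim, simp add: tangent_add tangent_mult tangent_cmult)+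

lemma lie_bracket_tangent:
  assumes A: "smooth_manifold A" and X: "vfield_near A p X" and Y: "vfield_near A p Y"
  shows "lie_bracket A X Y p \<in> tangent_space A p"
proof -
  note tX = vfield_near_tangent[OF X] and tY = vfield_near_tangent[OF Y]
  note sX = vfield_near_smooth[OF X] and sY = vfield_near_smooth[OF Y]
  show ?thesis
  proof (rule tangent_spaceI)
    fix f assume "\<not> smooth_fun_at A f p"
    then show "lie_bracket A X Y p f = 0" by (simp add: lie_bracket_def)
  next
    fix f c assume f: "smooth_fun_at A f p"
    have "X p (\<lambda>q. Y q (\<lambda>x. c * f x)) = c * X p (\<lambda>q. Y q f)"
      using tangent_germ_eventually[OF A tX vfield_near_add_apply(3)[OF Y f f]] tangent_cmult[OF tX sY[OF f]] by simp
    moreover have "Y p (\<lambda>q. X q (\<lambda>x. c * f x)) = c * Y p (\<lambda>q. X q f)"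
      using tangent_germ_eventually[OF A tY vfield_near_add_apply(3)[OF X f f]] tangent_cmult[OF tY sX[OF f]] by simp
    ultimately show "lie_bracket A X Y p (\<lambda>x. c * f x) = c * lie_bracket A X Y p f"
      using f smooth_fun_at_mult[OF A smooth_fun_at_const[OF A] f] by (simp add: lie_bracket_apply algebra_simps)
  next
    fix f g assume f: "smooth_fun_at A f p" and g: "smooth_fun_at A g p"
    have "X p (\<lambda>q. Y q (\<lambda>x. f x + g x)) = X p (\<lambda>q. Y q f) + X p (\<lambda>q. Y q g)"
      using tangent_germ_eventually[OF A tX vfield_near_add_apply(1)[OF Y f g]] tangent_add[OF tX sY[OF f] sY[OF g]] by simp
    moreover have "Y p (\<lambda>q. X q (\<lambda>x. f x + g x)) = Y p (\<lambda>q. X q f) + Y p (\<lambda>q. X q g)"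
      using tangent_germ_eventually[OF A tY vfield_near_add_apply(1)[OF X f g]] tangent_add[OF tY sX[OF f] sX[OF g]] by simp
    ultimately show "lie_bracket A X Y p (\<lambda>x. f x + g x) = lie_bracket A X Y p f + lie_bracket A X Y p g"
      using f g smooth_fun_at_add[OF A f g] by (simp add: lie_bracket_apply)
    \<comment> \<open>The products of first derivatives on the right are symmetric under exchanging
      \<open>V\<close> and \<open>Z\<close>; they cancel in the bracket, which makes it a
      derivation.\<close>
    have twice: "V p (\<lambda>q. Z q (\<lambda>x. f x * g x)) =
        f p * V p (\<lambda>q. Z q g) + Z p g * V p f + (g p * V p (\<lambda>q. Z q f) + Z p f * V p g)"
      if V: "vfield_near A p V" and Z: "vfield_near A p Z" for V Z
    proof -
      note tV = vfield_near_tangent[OF V] and sZ = vfield_near_smooth[OF Z]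
      show ?thesis
        using tangent_germ_eventually[OF A tV vfield_near_add_apply(2)[OF Z f g]]
          tangent_add[OF tV smooth_fun_at_mult[OF A f sZ[OF g]] smooth_fun_at_mult[OF A g sZ[OF f]]]
          tangent_mult[OF tV f sZ[OF g]] tangent_mult[OF tV g sZ[OF f]] by simp
    qed
    show "lie_bracket A X Y p (\<lambda>x. f x * g x) = f p * lie_bracket A X Y p g + g p * lie_bracket A X Y p f"
      using f g smooth_fun_at_mult[OF A f g] twice[OF X Y] twice[OF Y X]
      by (simp add: lie_bracket_apply algebra_simps)
  qed
qed

lemma lie_bracket_antisym: "lie_bracket A X Y p = - lie_bracket A Y X p"
  by (simp add: lie_bracket_def fun_eq_iff)

lemma lie_bracket_germ:
  assumes A: "smooth_manifold A" and X: "vfield_near A p X" and Y: "vfield_near A p Y"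
    and eX: "\<forall>\<^sub>F q in nhds p. X q = X' q" and eY: "\<forall>\<^sub>F q in nhds p. Y q = Y' q"
  shows "lie_bracket A X Y p = lie_bracket A X' Y' p"
proof -
  have pX: "X p = X' p" by (rule eventually_nhds_x_imp_x[OF eX])
  have pY: "Y p = Y' p" by (rule eventually_nhds_x_imp_x[OF eY])
  have "X p (\<lambda>q. Y q f) = X p (\<lambda>q. Y' q f)" "Y p (\<lambda>q. X q f) = Y p (\<lambda>q. X' q f)" for f
    by (rule tangent_germ_eventually[OF A vfield_near_tangent[OF X] eventually_mono[OF eY]], simp,
        rule tangent_germ_eventually[OF A vfield_near_tangent[OF Y] eventually_mono[OF eX]], simp)
  then show ?thesis by (simp add: lie_bracket_def pX pY fun_eq_iff)
qed

lemma lie_bracket_add_left: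
  assumes A: "smooth_manifold A" and X: "vfield_near A p X" and X': "vfield_near A p X'" and Y: "vfield_near A p Y"
  shows "lie_bracket A (\<lambda>q. X q + X' q) Y p = lie_bracket A X Y p + lie_bracket A X' Y p"
proof -
  have "Y p (\<lambda>q. X q f + X' q f) = Y p (\<lambda>q. X q f) + Y p (\<lambda>q. X' q f)" if "smooth_fun_at A f p" for f
    by (rule tangent_add[OF vfield_near_tangent[OF Y] vfield_near_smooth[OF X that] vfield_near_smooth[OF X' that]])
  then show ?thesis by (auto simp: lie_bracket_def fun_eq_iff plus_fun_apply)
qed

lemma lie_bracket_scaleR_left:
  assumes A: "smooth_manifold A" and X: "vfield_near A p X" and Y: "vfield_near A p Y" and f: "smooth_fun_at A f p"
  shows "lie_bracket A (\<lambda>q. f q *\<^sub>R X q) Y p = f p *\<^sub>R lie_bracket A X Y p - Y p f *\<^sub>R X p"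
proof
  fix g
  show "lie_bracket A (\<lambda>q. f q *\<^sub>R X q) Y p g = (f p *\<^sub>R lie_bracket A X Y p - Y p f *\<^sub>R X p) g"
  proof (cases "smooth_fun_at A g p")
    case True
    have "Y p (\<lambda>q. f q * X q g) = f p * Y p (\<lambda>q. X q g) + X p g * Y p f"
      by (rule tangent_mult[OF vfield_near_tangent[OF Y] f vfield_near_smooth[OF X True]])
    with True show ?thesis by (simp add: lie_bracket_apply tvec_apply algebra_simps)
  next
    case False
    then show ?thesis
      by (simp add: lie_bracket_def tvec_apply tangent_not_smooth[OF vfield_near_tangent[OF X] False])
  qed
qed

lemma lie_bracket_cmult_left:
  assumes A: "smooth_manifold A" and X: "vfield_near A p X" and Y: "vfield_near A p Y"
  shows "lie_bracket A (\<lambda>q. c *\<^sub>R X q) Y p = c *\<^sub>R lie_bracket A X Y p"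
  using lie_bracket_scaleR_left[OF A X Y smooth_fun_at_const[OF A], of c]
  by (simp add: tangent_const[OF A vfield_near_tangent[OF Y]])

lemma smooth_at_compose_eventually:
  assumes A: "smooth_manifold A" and B: "smooth_manifold B"
    and F: "smooth_at A B F p" and P: "\<forall>\<^sub>F q in nhds (F p). P q"
  shows "\<forall>\<^sub>F q in nhds p. P (F q)"
proof -
  obtain T where T: "open T" "F p \<in> T" "\<And>q. q \<in> T \<Longrightarrow> P q" using P unfolding eventually_nhds by blast
  obtain S where "open S" "p \<in> S" "\<And>q. q \<in> S \<Longrightarrow> F q \<in> T"
    using continuous_at_open[THEN iffD1, OF smooth_at_imp_isCont[OF A B F], rule_format, of T] T(1,2) by blast
  with T(3) show ?thesis
    by (intro eventually_nhds[THEN iffD2] exI[of _ S]) simp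
qed

text \<open>Relatedness near \<open>p\<close> makes each iterated derivative of a function pulled
  back along \<open>F\<close> computable on the target. Through this fact the horizontal parts of
  brackets on a total space become brackets on the base.\<close>

lemma lie_bracket_related:
  assumes A: "smooth_manifold A" and B: "smooth_manifold B"
    and F: "smooth_at A B F p"
    and X: "vfield_near A p X" and Y: "vfield_near A p Y"
    and X': "vfield_near B (F p) X'" and Y': "vfield_near B (F p) Y'"
    and rX: "\<forall>\<^sub>F q in nhds p. push_forward B F q (X q) = X' (F q)"
    and rY: "\<forall>\<^sub>F q in nhds p. push_forward B F q (Y q) = Y' (F q)"
  shows "push_forward B F p (lie_bracket A X Y p) = lie_bracket B X' Y' (F p)"
proof (rule tangent_eqI)
  show "push_forward B F p (lie_bracket A X Y p) \<in> tangent_space B (F p)"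
    by (rule push_forward_tangent[OF A B F lie_bracket_tangent[OF A X Y]])
  show "lie_bracket B X' Y' (F p) \<in> tangent_space B (F p)"
    by (rule lie_bracket_tangent[OF B X' Y'])
  fix f assume f: "smooth_fun_at B f (F p)"
  have fF: "smooth_fun_at A (f \<circ> F) p"
    using smooth_at_compose[OF A B smooth_manifold_std F f] by (simp add: o_def)
  have ef: "\<forall>\<^sub>F q in nhds p. smooth_fun_at B f (F q)"
    by (rule smooth_at_compose_eventually[OF A B F smooth_at_eventually[OF f]])
  have eZ: "\<forall>\<^sub>F q in nhds p. Z q (f \<circ> F) = Z' (F q) f"
    if "\<forall>\<^sub>F q in nhds p. push_forward B F q (Z q) = Z' (F q)" for Z Z'
    using that ef by eventually_elim (auto simp: push_forward_def dest: fun_cong[where x = f])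
  have iter: "V p (\<lambda>q. Z q (f \<circ> F)) = V' (F p) (\<lambda>y. Z' y f)"
    if V: "vfield_near A p V" "\<forall>\<^sub>F q in nhds p. push_forward B F q (V q) = V' (F q)"
      and Z: "vfield_near B (F p) Z'" "\<forall>\<^sub>F q in nhds p. push_forward B F q (Z q) = Z' (F q)" for V V' Z Z'
  proof -
    have "V p (\<lambda>q. Z q (f \<circ> F)) = V p ((\<lambda>y. Z' y f) \<circ> F)"
      by (rule tangent_germ_eventually[OF A vfield_near_tangent[OF V(1)]]) (use eZ[OF Z(2)] in \<open>simp only: comp_def\<close>)
    also have "\<dots> = push_forward B F p (V p) (\<lambda>y. Z' y f)"
      using vfield_near_smooth[OF Z(1) f] by (simp add: push_forward_def)
    also have "\<dots> = V' (F p) (\<lambda>y. Z' y f)"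
      using eventually_nhds_x_imp_x[OF V(2)] by simp
    finally show ?thesis .
  qed
  show "push_forward B F p (lie_bracket A X Y p) f = lie_bracket B X' Y' (F p) f"
    using f fF iter[OF X rX Y' rY] iter[OF Y rY X' rX] by (simp add: push_forward_def lie_bracket_apply comp_def)
qed

section \<open>Forms of degree one and their exterior derivative\<close>

lemma
  assumes \<omega>: "differential_form A 1 \<omega>" and v: "v \<in> tangent_space A p"
  shows form1_add: "w \<in> tangent_space A p \<Longrightarrow> \<omega> p [v + w] = \<omega> p [v] + \<omega> p [w]"
    and form1_scaleR: "\<omega> p [c *\<^sub>R v] = c * \<omega> p [v]"
proof -
  have "[v] \<in> tangent_lists A 1 p" using v by (simp add: tangent_lists_def)
  then have *: "\<omega> p ([v][0 := v + w]) = \<omega> p ([v][0 := v]) + \<omega> p ([v][0 := w]) \<and>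
      \<omega> p ([v][0 := c *\<^sub>R v]) = c * \<omega> p ([v][0 := v])" if "w \<in> tangent_space A p" for w
    using \<omega> v that unfolding differential_form_def by blast
  then show "w \<in> tangent_space A p \<Longrightarrow> \<omega> p [v + w] = \<omega> p [v] + \<omega> p [w]" by simp
  show "\<omega> p [c *\<^sub>R v] = c * \<omega> p [v]" using *[OF v] by simp
qed

lemma form1_diff:
  assumes "differential_form A 1 \<omega>" "v \<in> tangent_space A p" "w \<in> tangent_space A p"
  shows "\<omega> p [v - w] = \<omega> p [v] - \<omega> p [w]"
  using form1_add[OF assms(1,2) tangent_space_uminus[OF assms(3)]] form1_scaleR[OF assms(1,3), of "- 1"] by simp

lemma form1_zero:
  assumes "differential_form A 1 \<omega>"
  shows "\<omega> p [0] = 0"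
  using form1_scaleR[OF assms tangent_space_zero, of p 0] by simp

lemma form1_uminus:
  assumes "differential_form A 1 \<omega>" "v \<in> tangent_space A p"
  shows "\<omega> p [- v] = - \<omega> p [v]"
  using form1_scaleR[OF assms, of "- 1"] by simp

lemma form1_smooth:
  assumes "differential_form A 1 \<omega>" "vfield_near A p X"
  shows "smooth_fun_at A (\<lambda>q. \<omega> q [X q]) p"
proof -
  obtain U where U: "open U" "p \<in> U" "smooth_vfield_on A U X" using assms(2) unfolding vfield_near_def by blast
  have "\<forall>U Xs. open U \<longrightarrow> length Xs = 1 \<longrightarrow> (\<forall>X\<in>set Xs. smooth_vfield_on A U X) \<longrightarrow>
      (\<forall>p\<in>U. smooth_fun_at A (\<lambda>q. \<omega> q (map (\<lambda>X. X q) Xs)) p)"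
    using assms(1) unfolding differential_form_def by (rule conjunct2)
  from this[rule_format, of U "[X]" p] show ?thesis using U by simp
qed

text \<open>The invariant formula as a function of two fields; \<open>ext_deriv\<close> takes
  vectors and hides this formula behind a definite description over all extensions.\<close>

definition ext_deriv1 ::
    "('m::topological_space, 'e::euclidean_space) atlas \<Rightarrow> 'm dform \<Rightarrow> 'm vfield \<Rightarrow> 'm vfield \<Rightarrow> 'm \<Rightarrow> real" where
  "ext_deriv1 A \<omega> X Y p = X p (\<lambda>q. \<omega> q [Y q]) - Y p (\<lambda>q. \<omega> q [X q]) - \<omega> p [lie_bracket A X Y p]"

lemma ext_deriv1_antisym:
  assumes "smooth_manifold A" "differential_form A 1 \<omega>" "vfield_near A p X" "vfield_near A p Y"
  shows "ext_deriv1 A \<omega> X Y p = - ext_deriv1 A \<omega> Y X p"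
  using form1_uminus[OF assms(2) lie_bracket_tangent[OF assms(1,4,3)]]
  by (subst ext_deriv1_def, subst lie_bracket_antisym) (simp add: ext_deriv1_def)

text \<open>When \<open>X\<close> is multiplied by \<open>f\<close>, the term
  \<open>Y p f * \<omega> p [X p]\<close> arises once from differentiating \<omega>(f X) along
  \<open>Y\<close> and once from the bracket, with opposite signs.\<close>

lemma ext_deriv1_tensorial_left:
  assumes A: "smooth_manifold A" and \<omega>: "differential_form A 1 \<omega>"
    and X: "vfield_near A p X" and X': "vfield_near A p X'" and Y: "vfield_near A p Y" and eq: "X p = X' p"
  shows "ext_deriv1 A \<omega> X Y p = ext_deriv1 A \<omega> X' Y p"
proof (rule tensorial_near[where F = "\<lambda>X. ext_deriv1 A \<omega> X Y p", OF A _ _ _ X X' eq])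
  note tY = vfield_near_tangent[OF Y]
  fix X X' assume X: "vfield_near A p X" and X': "vfield_near A p X'"
  note b = lie_bracket_tangent[OF A X Y] lie_bracket_tangent[OF A X' Y]
  have "\<forall>\<^sub>F q in nhds p. \<omega> q [X q + X' q] = \<omega> q [X q] + \<omega> q [X' q]"
    using vfield_near_eventually_tangent[OF X] vfield_near_eventually_tangent[OF X']
    by eventually_elim (rule form1_add[OF \<omega>])
  then have "Y p (\<lambda>q. \<omega> q [X q + X' q]) = Y p (\<lambda>q. \<omega> q [X q]) + Y p (\<lambda>q. \<omega> q [X' q])"
    using tangent_germ_eventually[OF A tY] tangent_add[OF tY form1_smooth[OF \<omega> X] form1_smooth[OF \<omega> X']] by simp
  then show "ext_deriv1 A \<omega> (\<lambda>q. X q + X' q) Y p = ext_deriv1 A \<omega> X Y p + ext_deriv1 A \<omega> X' Y p"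
    using lie_bracket_add_left[OF A X X' Y] form1_add[OF \<omega> b] by (simp add: ext_deriv1_def plus_fun_apply)
next
  note tY = vfield_near_tangent[OF Y]
  fix X f assume X: "vfield_near A p X" and f: "smooth_fun_at A f p"
  note tX = vfield_near_tangent[OF X] and b = lie_bracket_tangent[OF A X Y]
  have "\<forall>\<^sub>F q in nhds p. \<omega> q [f q *\<^sub>R X q] = f q * \<omega> q [X q]"
    using vfield_near_eventually_tangent[OF X] by eventually_elim (rule form1_scaleR[OF \<omega>])
  then have "Y p (\<lambda>q. \<omega> q [f q *\<^sub>R X q]) = f p * Y p (\<lambda>q. \<omega> q [X q]) + \<omega> p [X p] * Y p f"
    using tangent_germ_eventually[OF A tY] tangent_mult[OF tY f form1_smooth[OF \<omega> X]] by simp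
  moreover have "\<omega> p [lie_bracket A (\<lambda>q. f q *\<^sub>R X q) Y p] = f p * \<omega> p [lie_bracket A X Y p] - Y p f * \<omega> p [X p]"
    using lie_bracket_scaleR_left[OF A X Y f] form1_diff[OF \<omega> tangent_space_scaleR[OF b] tangent_space_scaleR[OF tX]]
      form1_scaleR[OF \<omega> b] form1_scaleR[OF \<omega> tX] by simp
  ultimately show "ext_deriv1 A \<omega> (\<lambda>q. f q *\<^sub>R X q) Y p = f p *\<^sub>R ext_deriv1 A \<omega> X Y p"
    by (simp add: ext_deriv1_def scaleR_fun_apply algebra_simps)
next
  note tY = vfield_near_tangent[OF Y]
  fix X X' assume X: "vfield_near A p X" and X': "vfield_near A p X'" and e: "\<forall>\<^sub>F q in nhds p. X q = X' q"
  have "Y p (\<lambda>q. \<omega> q [X q]) = Y p (\<lambda>q. \<omega> q [X' q])"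
    by (rule tangent_germ_eventually[OF A tY eventually_mono[OF e]]) simp
  moreover have "lie_bracket A X Y p = lie_bracket A X' Y p"
    by (rule lie_bracket_germ[OF A X Y e]) simp
  ultimately show "ext_deriv1 A \<omega> X Y p = ext_deriv1 A \<omega> X' Y p"
    using eventually_nhds_x_imp_x[OF e] by (simp add: ext_deriv1_def)
qed

lemma ext_deriv1_tensorial:
  assumes A: "smooth_manifold A" and \<omega>: "differential_form A 1 \<omega>"
    and X: "vfield_near A p X" "vfield_near A p X'" "X p = X' p"
    and Y: "vfield_near A p Y" "vfield_near A p Y'" "Y p = Y' p"
  shows "ext_deriv1 A \<omega> X Y p = ext_deriv1 A \<omega> X' Y' p"
  using ext_deriv1_tensorial_left[OF A \<omega> X(1,2) Y(1) X(3)] ext_deriv1_tensorial_left[OF A \<omega> Y(1,2) X(2) Y(3)]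
    ext_deriv1_antisym[OF A \<omega> X(2) Y(1)] ext_deriv1_antisym[OF A \<omega> X(2) Y(2)] by simp

lemma cartan_formula_1: "cartan_formula A 1 \<omega> [X, Y] p = ext_deriv1 A \<omega> X Y p"
proof -
  have "{..1::nat} = {0, 1}" "{..<1::nat} = {0}" by auto
  then show ?thesis by (simp add: cartan_formula_def ext_deriv1_def delete_at_def)
qed

text \<open>Tensoriality is exactly what makes the definite description in \<open>ext_deriv\<close>
  meaningful: all extensions of the two vectors give the same value.\<close>

lemma ext_deriv_1_eq:
  assumes A: "smooth_manifold A" and \<omega>: "differential_form A 1 \<omega>"
    and X: "vfield_near A p X" and Y: "vfield_near A p Y"
  shows "ext_deriv A 1 \<omega> p [X p, Y p] = ext_deriv1 A \<omega> X Y p"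
  unfolding ext_deriv_def
proof (rule the_equality)
  show "\<forall>U Xs. open U \<longrightarrow> p \<in> U \<longrightarrow> (\<forall>X\<in>set Xs. smooth_vfield_on A U X) \<longrightarrow>
        map (\<lambda>X. X p) Xs = [X p, Y p] \<longrightarrow> cartan_formula A 1 \<omega> Xs p = ext_deriv1 A \<omega> X Y p"
  proof (intro allI impI)
    fix U Xs assume U: "open U" "p \<in> U" "\<forall>X\<in>set Xs. smooth_vfield_on A U X" and m: "map (\<lambda>X. X p) Xs = [X p, Y p]"
    then obtain X' Y' where Xs: "Xs = [X', Y']" "X' p = X p" "Y' p = Y p" by (auto simp: map_eq_Cons_conv)
    then have "vfield_near A p X'" "vfield_near A p Y'" using U by (auto intro: vfield_nearI)
    then show "cartan_formula A 1 \<omega> Xs p = ext_deriv1 A \<omega> X Y p"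
      unfolding Xs(1) cartan_formula_1 using ext_deriv1_tensorial[OF A \<omega>] X Y Xs(2,3) by blast
  qed
next
  fix c assume c: "\<forall>U Xs. open U \<longrightarrow> p \<in> U \<longrightarrow> (\<forall>X\<in>set Xs. smooth_vfield_on A U X) \<longrightarrow>
        map (\<lambda>X. X p) Xs = [X p, Y p] \<longrightarrow> cartan_formula A 1 \<omega> Xs p = c"
  \<comment> \<open>For uniqueness some admissible family must exist, and \<open>ext_deriv\<close>
    asks for one domain for both fields: their intersection.\<close>
  obtain U V where U: "open U" "p \<in> U" "smooth_vfield_on A U X" and V: "open V" "p \<in> V" "smooth_vfield_on A V Y"
    using X Y unfolding vfield_near_def by blast
  have "\<forall>Z\<in>set [X, Y]. smooth_vfield_on A (U \<inter> V) Z"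
    using smooth_vfield_subset[OF U(3), of "U \<inter> V"] smooth_vfield_subset[OF V(3), of "U \<inter> V"] by simp
  moreover have "open (U \<inter> V)" "p \<in> U \<inter> V" "map (\<lambda>X. X p) [X, Y] = [X p, Y p]"
    using open_Int[OF U(1) V(1)] U(2) V(2) by simp_all
  ultimately have "cartan_formula A 1 \<omega> [X, Y] p = c"
    by (intro c[rule_format, of "U \<inter> V"]) auto
  then show "c = ext_deriv1 A \<omega> X Y p" using cartan_formula_1[of A \<omega> X Y p] by simp
qed

section \<open>The Nijenhuis tensor\<close>

lemma endomorphism_field_iff:
  "endomorphism_field A J \<longleftrightarrow>
     (\<forall>p. \<forall>v\<in>tangent_space A p. J p v \<in> tangent_space A p) \<and>
     (\<forall>p. \<forall>v\<in>tangent_space A p. \<forall>w\<in>tangent_space A p. \<forall>c.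
        J p (v + w) = J p v + J p w \<and> J p (c *\<^sub>R v) = c *\<^sub>R J p v) \<and>
     (\<forall>p X. vfield_near A p X \<longrightarrow> vfield_near A p (\<lambda>q. J q (X q)))"
proof -
  have "(\<forall>U X. open U \<longrightarrow> smooth_vfield_on A U X \<longrightarrow> smooth_vfield_on A U (\<lambda>p. J p (X p))) \<longleftrightarrow>
      (\<forall>p X. vfield_near A p X \<longrightarrow> vfield_near A p (\<lambda>q. J q (X q)))" (is "?L \<longleftrightarrow> ?R")
  proof
    assume ?L
    then have "vfield_near A p (\<lambda>q. J q (X q))" if "vfield_near A p X" for p X
      using that unfolding vfield_near_def by metis
    then show ?R by blast
  next
    assume R: ?R
    show ?L
    proof (intro allI impI)
      fix U X assume "open U" "smooth_vfield_on A U X"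
      then show "smooth_vfield_on A U (\<lambda>p. J p (X p))"
        using R by (simp add: smooth_vfield_iff_near)
    qed
  qed
  then show ?thesis unfolding endomorphism_field_def by (simp only:)
qed

lemma
  assumes "endomorphism_field A J"
  shows endomorphism_tangent: "v \<in> tangent_space A p \<Longrightarrow> J p v \<in> tangent_space A p"
    and endomorphism_add: "v \<in> tangent_space A p \<Longrightarrow> w \<in> tangent_space A p \<Longrightarrow> J p (v + w) = J p v + J p w"
    and endomorphism_scaleR: "v \<in> tangent_space A p \<Longrightarrow> J p (c *\<^sub>R v) = c *\<^sub>R J p v"
    and endomorphism_near: "vfield_near A p X \<Longrightarrow> vfield_near A p (\<lambda>q. J q (X q))"
  using assms unfolding endomorphism_field_iff by blast+

lemma
  assumes "endomorphism_field A J"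
  shows endomorphism_zero: "J p 0 = 0"
    and endomorphism_uminus: "v \<in> tangent_space A p \<Longrightarrow> J p (- v) = - J p v"
    and endomorphism_diff: "v \<in> tangent_space A p \<Longrightarrow> w \<in> tangent_space A p \<Longrightarrow> J p (v - w) = J p v - J p w"
proof -
  show "J p 0 = 0" using endomorphism_scaleR[OF assms tangent_space_zero, of p 0] by simp
  show u: "J p (- v) = - J p v" if "v \<in> tangent_space A p" for v
    using endomorphism_scaleR[OF assms that, of "- 1"] by simp
  show "J p (v - w) = J p v - J p w" if v: "v \<in> tangent_space A p" and w: "w \<in> tangent_space A p"
    using endomorphism_add[OF assms v tangent_space_uminus[OF w]] u[OF w] by simp
qed

lemma integrable_acs_iff_near:
  "integrable_acs A J \<longleftrightarrow> (\<forall>p X Y. vfield_near A p X \<longrightarrow> vfield_near A p Y \<longrightarrow> nijenhuis A J X Y p = 0)"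
proof
  assume J: "integrable_acs A J"
  show "\<forall>p X Y. vfield_near A p X \<longrightarrow> vfield_near A p Y \<longrightarrow> nijenhuis A J X Y p = 0"
  proof (intro allI impI)
    fix p X Y assume "vfield_near A p X" "vfield_near A p Y"
    then obtain U V where "open U" "p \<in> U" "smooth_vfield_on A U X" "open V" "p \<in> V" "smooth_vfield_on A V Y"
      unfolding vfield_near_def by blast
    then have "open (U \<inter> V)" "p \<in> U \<inter> V" "smooth_vfield_on A (U \<inter> V) X" "smooth_vfield_on A (U \<inter> V) Y"
      using smooth_vfield_subset[of A _ _ "U \<inter> V"] by blast+
    then show "nijenhuis A J X Y p = 0" using J unfolding integrable_acs_def by blast
  qed
next
  assume "\<forall>p X Y. vfield_near A p X \<longrightarrow> vfield_near A p Y \<longrightarrow> nijenhuis A J X Y p = 0"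
  then show "integrable_acs A J" unfolding integrable_acs_def by (meson vfield_nearI)
qed

text \<open>Fills the place of an unchanged argument in \<open>lie_bracket_germ\<close>.\<close>

lemma eventually_refl: "\<forall>\<^sub>F q in F. f q = f q"
  by simp

context
  fixes A :: "('m::{t2_space,second_countable_topology}, 'e::euclidean_space) atlas" and J
  assumes A: "smooth_manifold A" and J: "endomorphism_field A J"
begin

lemma nijenhuis_antisym:
  assumes X: "vfield_near A p X" and Y: "vfield_near A p Y"
  shows "nijenhuis A J X Y p = - nijenhuis A J Y X p"
proof -
  note JX = endomorphism_near[OF J X] and JY = endomorphism_near[OF J Y]
  note t = lie_bracket_tangent[OF A]
  have n: "J p (- v) = - J p v" if "v \<in> tangent_space A p" for v by (rule endomorphism_uminus[OF J that])
  have s: "lie_bracket A (\<lambda>q. J q (X q)) (\<lambda>q. J q (Y q)) p = - lie_bracket A (\<lambda>q. J q (Y q)) (\<lambda>q. J q (X q)) p"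
    "lie_bracket A (\<lambda>q. J q (X q)) Y p = - lie_bracket A Y (\<lambda>q. J q (X q)) p"
    "lie_bracket A X (\<lambda>q. J q (Y q)) p = - lie_bracket A (\<lambda>q. J q (Y q)) X p"
    "lie_bracket A X Y p = - lie_bracket A Y X p"
    by (rule lie_bracket_antisym)+
  show ?thesis
    unfolding nijenhuis_def s using n[OF t[OF Y JX]] n[OF t[OF JY X]] n[OF t[OF Y X]]
      n[OF endomorphism_tangent[OF J t[OF Y X]]] by simp
qed

lemma nijenhuis_add_left:
  assumes X: "vfield_near A p X" and X': "vfield_near A p X'" and Y: "vfield_near A p Y"
  shows "nijenhuis A J (\<lambda>q. X q + X' q) Y p = nijenhuis A J X Y p + nijenhuis A J X' Y p"
proof -
  note JX = endomorphism_near[OF J X] and JX' = endomorphism_near[OF J X'] and JY = endomorphism_near[OF J Y]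
  note t = lie_bracket_tangent[OF A]
  note S = vfield_near_add[OF A X X']
  have e: "\<forall>\<^sub>F q in nhds p. J q (X q + X' q) = J q (X q) + J q (X' q)"
    using vfield_near_eventually_tangent[OF X] vfield_near_eventually_tangent[OF X']
    by eventually_elim (rule endomorphism_add[OF J])
  have b: "lie_bracket A (\<lambda>q. J q (X q + X' q)) Z p =
      lie_bracket A (\<lambda>q. J q (X q)) Z p + lie_bracket A (\<lambda>q. J q (X' q)) Z p" if Z: "vfield_near A p Z" for Z
    using lie_bracket_germ[OF A endomorphism_near[OF J S] Z e eventually_refl] lie_bracket_add_left[OF A JX JX' Z] by simp
  note l = lie_bracket_add_left[OF A X X']
  note a = endomorphism_add[OF J]
  show ?thesis
    unfolding nijenhuis_def b[OF JY] b[OF Y] l[OF JY] l[OF Y]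
      a[OF t[OF JX Y] t[OF JX' Y]] a[OF t[OF X JY] t[OF X' JY]] a[OF t[OF X Y] t[OF X' Y]]
      a[OF endomorphism_tangent[OF J t[OF X Y]] endomorphism_tangent[OF J t[OF X' Y]]]
    by (simp add: algebra_simps)
qed

text \<open>The derivatives of \<open>f\<close> along \<open>Y\<close> and along \<open>J Y\<close>
  each occur twice with opposite signs, multiplied by \<open>J (J X)\<close> and by
  \<open>J X\<close> respectively. This holds for an arbitrary endomorphism field.\<close>

lemma nijenhuis_scaleR_left:
  assumes X: "vfield_near A p X" and Y: "vfield_near A p Y" and f: "smooth_fun_at A f p"
  shows "nijenhuis A J (\<lambda>q. f q *\<^sub>R X q) Y p = f p *\<^sub>R nijenhuis A J X Y p"
proof -
  note JX = endomorphism_near[OF J X] and JY = endomorphism_near[OF J Y]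
  note t = lie_bracket_tangent[OF A]
  note S = vfield_near_scaleR[OF A f X]
  note tX = vfield_near_tangent[OF X] and tJX = vfield_near_tangent[OF JX]
  note c = tangent_space_scaleR and r = endomorphism_scaleR[OF J] and d = endomorphism_diff[OF J]
  note jt = endomorphism_tangent[OF J]
  have e: "\<forall>\<^sub>F q in nhds p. J q (f q *\<^sub>R X q) = f q *\<^sub>R J q (X q)"
    using vfield_near_eventually_tangent[OF X] by eventually_elim (rule r)
  have b: "lie_bracket A (\<lambda>q. J q (f q *\<^sub>R X q)) Z p =
      f p *\<^sub>R lie_bracket A (\<lambda>q. J q (X q)) Z p - Z p f *\<^sub>R J p (X p)" if Z: "vfield_near A p Z" for Z
    using lie_bracket_germ[OF A endomorphism_near[OF J S] Z e eventually_refl] lie_bracket_scaleR_left[OF A JX Z f] by simp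
  have l: "lie_bracket A (\<lambda>q. f q *\<^sub>R X q) Z p = f p *\<^sub>R lie_bracket A X Z p - Z p f *\<^sub>R X p"
    if "vfield_near A p Z" for Z by (rule lie_bracket_scaleR_left[OF A X that f])
  have 1: "J p (f p *\<^sub>R lie_bracket A (\<lambda>q. J q (X q)) Y p - Y p f *\<^sub>R J p (X p)) =
      f p *\<^sub>R J p (lie_bracket A (\<lambda>q. J q (X q)) Y p) - Y p f *\<^sub>R J p (J p (X p))"
    using d[OF c[OF t[OF JX Y]] c[OF tJX]] r[OF t[OF JX Y]] r[OF tJX] by simp
  have 2: "J p (f p *\<^sub>R lie_bracket A X Z p - Z p f *\<^sub>R X p) = f p *\<^sub>R J p (lie_bracket A X Z p) - Z p f *\<^sub>R J p (X p)"
    if Z: "vfield_near A p Z" for Z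
    using d[OF c[OF t[OF X Z]] c[OF tX]] r[OF t[OF X Z]] r[OF tX] by simp
  have 3: "J p (f p *\<^sub>R J p (lie_bracket A X Y p) - Y p f *\<^sub>R J p (X p)) =
      f p *\<^sub>R J p (J p (lie_bracket A X Y p)) - Y p f *\<^sub>R J p (J p (X p))"
    using d[OF c[OF jt[OF t[OF X Y]]] c[OF tJX]] r[OF jt[OF t[OF X Y]]] r[OF tJX] by simp
  show ?thesis
    unfolding nijenhuis_def b[OF JY] b[OF Y] l[OF JY] l[OF Y] 1 2[OF JY] 2[OF Y] 3
    by (simp add: algebra_simps)
qed

lemma nijenhuis_germ_left:
  assumes X: "vfield_near A p X" and e: "\<forall>\<^sub>F q in nhds p. X q = X' q" and Y: "vfield_near A p Y"
  shows "nijenhuis A J X Y p = nijenhuis A J X' Y p"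
proof -
  note JX = endomorphism_near[OF J X] and JY = endomorphism_near[OF J Y]
  have Je: "\<forall>\<^sub>F q in nhds p. J q (X q) = J q (X' q)" using e by eventually_elim simp
  show ?thesis
    unfolding nijenhuis_def lie_bracket_germ[OF A JX JY Je eventually_refl] lie_bracket_germ[OF A JX Y Je eventually_refl]
      lie_bracket_germ[OF A X JY e eventually_refl] lie_bracket_germ[OF A X Y e eventually_refl] ..
qed

text \<open>The left argument is settled by \<open>tensorial_near\<close>, the right one by
  antisymmetry. This is what permits testing integrability on horizontal lifts and the vertical
  generator alone.\<close>

lemma nijenhuis_tensorial:
  assumes X: "vfield_near A p X" "vfield_near A p X'" "X p = X' p"
    and Y: "vfield_near A p Y" "vfield_near A p Y'" "Y p = Y' p"
  shows "nijenhuis A J X Y p = nijenhuis A J X' Y' p"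
proof -
  have left: "nijenhuis A J X Y p = nijenhuis A J X' Y p"
    if "vfield_near A p X" "vfield_near A p X'" "X p = X' p" "vfield_near A p Y" for X X' Y
    by (rule tensorial_near[where F = "\<lambda>X. nijenhuis A J X Y p", OF A _ _ _ that(1-3)])
       (intro nijenhuis_add_left nijenhuis_scaleR_left nijenhuis_germ_left that(4); assumption)+
  show ?thesis
    using left[OF X Y(1)] left[OF Y X(2)] nijenhuis_antisym[OF X(2) Y(1)] nijenhuis_antisym[OF X(2) Y(2)] by simp
qed

lemma nijenhuis_add_right:
  assumes X: "vfield_near A p X" and Y: "vfield_near A p Y" and Y': "vfield_near A p Y'"
  shows "nijenhuis A J X (\<lambda>q. Y q + Y' q) p = nijenhuis A J X Y p + nijenhuis A J X Y' p"
  using nijenhuis_antisym[OF X vfield_near_add[OF A Y Y']] nijenhuis_add_left[OF Y Y' X]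
    nijenhuis_antisym[OF X Y] nijenhuis_antisym[OF X Y'] by simp

lemma nijenhuis_cmult_left:
  assumes X: "vfield_near A p X" and Y: "vfield_near A p Y"
  shows "nijenhuis A J (\<lambda>q. c *\<^sub>R X q) Y p = c *\<^sub>R nijenhuis A J X Y p"
  by (rule nijenhuis_scaleR_left[OF X Y smooth_fun_at_const[OF A]])

lemma nijenhuis_self:
  assumes X: "vfield_near A p X"
  shows "nijenhuis A J X X p = 0"
proof -
  have "nijenhuis A J X X p + nijenhuis A J X X p = 0"
    using nijenhuis_antisym[OF X X] by (simp add: eq_neg_iff_add_eq_0)
  then have "2 *\<^sub>R nijenhuis A J X X p = 0" by (simp only: scaleR_2)
  then show ?thesis by simp
qed

text \<open>Endomorphism fields are total functions whose values off the tangent spaces are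
  arbitrary. Structures given by different formulas can be identified only on tangent vectors, and
  that has to be enough.\<close>

lemma integrable_acs_cong:
  assumes eq: "\<And>p v. v \<in> tangent_space A p \<Longrightarrow> J p v = J' p v"
  shows "integrable_acs A J \<longleftrightarrow> integrable_acs A J'"
proof -
  have "nijenhuis A J X Y p = nijenhuis A J' X Y p" if X: "vfield_near A p X" and Y: "vfield_near A p Y" for p X Y
  proof -
    note JX = endomorphism_near[OF J X] and JY = endomorphism_near[OF J Y]
    have e: "\<forall>\<^sub>F q in nhds p. J q (Z q) = J' q (Z q)" if "vfield_near A p Z" for Z
      using vfield_near_eventually_tangent[OF that] by eventually_elim (rule eq)
      note t = lie_bracket_tangent[OF A]
    show ?thesis
      unfolding nijenhuis_def
        lie_bracket_germ[OF A JX JY e[OF X] e[OF Y], symmetric] lie_bracket_germ[OF A JX Y e[OF X] eventually_refl, symmetric]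
        lie_bracket_germ[OF A X JY eventually_refl e[OF Y], symmetric]
        eq[OF t[OF JX Y], symmetric] eq[OF t[OF X JY], symmetric] eq[OF t[OF X Y], symmetric]
        eq[OF endomorphism_tangent[OF J t[OF X Y]], symmetric] ..
  qed
  then show ?thesis unfolding integrable_acs_iff_near by metis
qed

end

section \<open>Pullback of 1-forms\<close>

lemma form1I:
  assumes "\<And>p v w. v \<in> tangent_space A p \<Longrightarrow> w \<in> tangent_space A p \<Longrightarrow> \<omega> p [v + w] = \<omega> p [v] + \<omega> p [w]"
    "\<And>p v c. v \<in> tangent_space A p \<Longrightarrow> \<omega> p [c *\<^sub>R v] = c * \<omega> p [v]"
    "\<And>p X. vfield_near A p X \<Longrightarrow> smooth_fun_at A (\<lambda>q. \<omega> q [X q]) p"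
  shows "differential_form A 1 \<omega>"
  unfolding differential_form_def
proof (intro conjI allI ballI impI)
  fix p vs i v w c
  assume "vs \<in> tangent_lists A 1 p" and i: "i < (1::nat)" and v: "v \<in> tangent_space A p" "w \<in> tangent_space A p"
  then obtain u where vs: "vs = [u]" by (auto simp: tangent_lists_def length_Suc_conv)
  show "\<omega> p (vs[i := v + w]) = \<omega> p (vs[i := v]) + \<omega> p (vs[i := w])"
    using i vs assms(1)[OF v] by simp
  show "\<omega> p (vs[i := c *\<^sub>R v]) = c * \<omega> p (vs[i := v])"
    using i vs assms(2)[OF v(1)] by simp
next
  fix U p and Xs :: "'a vfield list"
  assume U: "open U" "length Xs = 1" "\<forall>X\<in>set Xs. smooth_vfield_on A U X" "p \<in> U"
  then obtain X where "Xs = [X]" by (auto simp: length_Suc_conv)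
  with U assms(3)[of p X] show "smooth_fun_at A (\<lambda>q. \<omega> q (map (\<lambda>X. X q) Xs)) p"
    by (simp add: vfield_nearI)
qed simp

lemma push_forward_expansion:
  fixes B :: "('n::{t2_space,second_countable_topology}, 'f::euclidean_space) atlas"
  assumes A: "smooth_manifold A" and B: "smooth_manifold B" and F: "smooth_at A B F q"
    and c: "(U, \<phi>) \<in> B" "F q \<in> U" and v: "v \<in> tangent_space A q"
  shows "push_forward B F q v = (\<Sum>e\<in>Basis. v (\<lambda>r. \<phi> (F r) \<bullet> e) *\<^sub>R chart_vector B U \<phi> e (F q))"
  using tangent_chart_expansion[OF B c push_forward_tangent[OF A B F v]] smooth_fun_at_coordinate[OF B c]
  by (simp add: push_forward_def comp_def)

lemma form1_sum:
  assumes "differential_form A 1 \<omega>" "finite I" "\<And>i. i \<in> I \<Longrightarrow> v i \<in> tangent_space A p"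
  shows "\<omega> p [\<Sum>i\<in>I. c i *\<^sub>R v i] = (\<Sum>i\<in>I. c i * \<omega> p [v i])"
  using assms(2,3)
  by (induction I rule: finite_induct)
     (simp_all add: form1_zero[OF assms(1)] form1_add[OF assms(1)] form1_scaleR[OF assms(1)]
       tangent_space_scaleR tangent_space_sum)

text \<open>Only smoothness needs an argument. The push-forward of a field is in general not a field
  on the target, so it is expanded in coordinate vectors of the target, with coefficients that are
  functions on the source.\<close>

lemma differential_form_pullback:
  fixes B :: "('n::{t2_space,second_countable_topology}, 'f::euclidean_space) atlas"
  assumes A: "smooth_manifold A" and B: "smooth_manifold B" and F: "\<And>q. smooth_at A B F q"
    and \<omega>: "differential_form B 1 \<omega>"
  shows "differential_form A 1 (pullback B F \<omega>)"
proof (rule form1I)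
  fix p v w assume v: "v \<in> tangent_space A p" and w: "w \<in> tangent_space A p"
  show "pullback B F \<omega> p [v + w] = pullback B F \<omega> p [v] + pullback B F \<omega> p [w]"
    using form1_add[OF \<omega> push_forward_tangent[OF A B F v] push_forward_tangent[OF A B F w]]
    by (simp add: pullback_def push_forward_add)
next
  fix p v c assume v: "v \<in> tangent_space A p"
  show "pullback B F \<omega> p [c *\<^sub>R v] = c * pullback B F \<omega> p [v]"
    using form1_scaleR[OF \<omega> push_forward_tangent[OF A B F v]]
    by (simp add: pullback_def push_forward_scaleR)
next
  fix p X assume X: "vfield_near A p X"
  obtain U \<phi> where c: "(U, \<phi>) \<in> B" "F p \<in> U" using chart_exists[OF B] .
  have "\<forall>\<^sub>F q in nhds (F p). q \<in> U" using chart_open[OF B c(1)] c(2) by (simp add: eventually_nhds_in_open)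
  then have eU: "\<forall>\<^sub>F q in nhds p. F q \<in> U" by (rule smooth_at_compose_eventually[OF A B F])
  have s: "smooth_fun_at A (\<lambda>q. \<Sum>e\<in>Basis. X q (\<lambda>r. \<phi> (F r) \<bullet> e) * \<omega> (F q) [chart_vector B U \<phi> e (F q)]) p"
  proof (intro smooth_fun_at_sum[OF A finite_Basis] smooth_fun_at_mult[OF A])
    fix e
    show "smooth_fun_at A (\<lambda>q. X q (\<lambda>r. \<phi> (F r) \<bullet> e)) p"
      by (rule vfield_near_smooth[OF X smooth_at_compose[OF A B smooth_manifold_std F smooth_fun_at_coordinate[OF B c]]])
    have "vfield_near B (F p) (chart_vector B U \<phi> e)"
      by (rule vfield_nearI[OF smooth_vfield_chart_vector[OF B c(1)] chart_open[OF B c(1)] c(2)])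
    from smooth_at_compose[OF A B smooth_manifold_std F form1_smooth[OF \<omega> this]]
    show "smooth_fun_at A (\<lambda>q. \<omega> (F q) [chart_vector B U \<phi> e (F q)]) p" .
  qed
  show "smooth_fun_at A (\<lambda>q. pullback B F \<omega> q [X q]) p"
  proof (rule smooth_at_cong_eventually[OF A s])
    show "\<forall>\<^sub>F q in nhds p. (\<Sum>e\<in>Basis. X q (\<lambda>r. \<phi> (F r) \<bullet> e) * \<omega> (F q) [chart_vector B U \<phi> e (F q)])
        = pullback B F \<omega> q [X q]"
      using eU vfield_near_eventually_tangent[OF X]
    proof eventually_elim
      case (elim q)
      show ?case
        unfolding pullback_def list.map push_forward_expansion[OF A B F c(1) elim]
        by (rule form1_sum[OF \<omega> finite_Basis chart_vector_in_tangent_space[OF B c(1) elim(1)], symmetric])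
    qed
  qed
qed


section \<open>Connections on line and circle bundles\<close>

text \<open>What the circle bundle and the product with the line have in common.
  \<open>vertical\<close> says that the fibres are one-dimensional and \<open>local_lift\<close>
  that \<pi> is a submersion; \<open>curvature\<close> is stated for fields, ready to be solved for
  brackets.\<close>

locale connection_bundle =
  fixes AB :: "('b::{t2_space,second_countable_topology}, 'e::euclidean_space) atlas"
    and AM :: "('m::{t2_space,second_countable_topology}, 'f::euclidean_space) atlas"
    and \<pi> :: "'m \<Rightarrow> 'b" and \<xi> :: "'m vfield" and \<alpha> :: "'m dform" and \<eta> :: "'b dform"
  assumes B: "smooth_manifold AB" and M: "smooth_manifold AM"
    and pi_smooth: "smooth_at AM AB \<pi> p" and pi_surj: "surj \<pi>"
    and alpha_form: "differential_form AM 1 \<alpha>"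
    and xi_near: "vfield_near AM p \<xi>" and alpha_xi: "\<alpha> p [\<xi> p] = 1"
    and push_xi: "push_forward AB \<pi> p (\<xi> p) = 0"
    and vertical: "v \<in> tangent_space AM p \<Longrightarrow> push_forward AB \<pi> p v = 0 \<Longrightarrow> \<exists>c. v = c *\<^sub>R \<xi> p"
    and local_lift: "(U, \<phi>) \<in> AB \<Longrightarrow> \<pi> p \<in> U \<Longrightarrow> \<exists>Y. vfield_near AM p Y \<and>
      (\<forall>\<^sub>F q in nhds p. push_forward AB \<pi> q (Y q) = chart_vector AB U \<phi> e (\<pi> q))"
    and curvature: "vfield_near AM p X \<Longrightarrow> vfield_near AM p Y \<Longrightarrow>
      ext_deriv1 AM \<alpha> X Y p = \<eta> (\<pi> p) [push_forward AB \<pi> p (X p), push_forward AB \<pi> p (Y p)]"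
begin

abbreviation push where "push \<equiv> push_forward AB \<pi>"
abbreviation hlift where "hlift \<equiv> horizontal_lift AB AM \<pi> \<alpha>"

lemma push_tangent: "v \<in> tangent_space AM p \<Longrightarrow> push p v \<in> tangent_space AB (\<pi> p)"
  by (rule push_forward_tangent[OF M B pi_smooth])

lemma xi_tangent: "\<xi> p \<in> tangent_space AM p"
  by (rule vfield_near_tangent[OF xi_near])

lemma tangent_zeroI:
  assumes "v \<in> tangent_space AM p" "push p v = 0" "\<alpha> p [v] = 0"
  shows "v = 0"
proof -
  obtain c where "v = c *\<^sub>R \<xi> p" using vertical[OF assms(1,2)] by blast
  with assms(3) form1_scaleR[OF alpha_form xi_tangent] alpha_xi show ?thesis by simp
qed

text \<open>A vertical vector is a multiple of \<xi>, on which \<alpha> is nonzero. Every identity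
  between vectors upstairs is checked through these two components.\<close>

lemma tangent_eq_iff:
  assumes "v \<in> tangent_space AM p" "w \<in> tangent_space AM p"
  shows "v = w \<longleftrightarrow> push p v = push p w \<and> \<alpha> p [v] = \<alpha> p [w]"
  using tangent_zeroI[OF tangent_space_diff[OF assms]] form1_diff[OF alpha_form assms]
  by (auto simp: push_forward_diff)

section \<open>Horizontal lifts and their smoothness\<close>

text \<open>Lifts of the coordinate vectors combine to some lift \<open>v\<close>; subtracting
  \<open>\<alpha> p [v] *\<^sub>R \<xi> p\<close> makes it horizontal and does not change the
  projection.\<close>

lemma horizontal_exists:
  assumes y: "y \<in> tangent_space AB (\<pi> p)"
  obtains w where "w \<in> tangent_space AM p" "\<alpha> p [w] = 0" "push p w = y"
proof -
  obtain U \<phi> where c: "(U, \<phi>) \<in> AB" "\<pi> p \<in> U" using chart_exists[OF B] .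
  have "\<exists>Y. vfield_near AM p Y \<and> push p (Y p) = chart_vector AB U \<phi> e (\<pi> p)" for e
    using local_lift[OF c, of e] eventually_nhds_x_imp_x by blast
  then obtain Y where Y: "\<And>e. vfield_near AM p (Y e)" "\<And>e. push p (Y e p) = chart_vector AB U \<phi> e (\<pi> p)"
    by metis
  define v where "v = (\<Sum>e\<in>Basis. y (\<lambda>q. \<phi> q \<bullet> e) *\<^sub>R Y e p)"
  have v: "v \<in> tangent_space AM p"
    unfolding v_def by (intro tangent_space_sum tangent_space_scaleR vfield_near_tangent Y)
  have pv: "push p v = y"
    unfolding v_def push_forward_sum push_forward_scaleR Y(2) by (rule tangent_chart_expansion[OF B c y, symmetric])
  show thesis
  proof
    show "v - \<alpha> p [v] *\<^sub>R \<xi> p \<in> tangent_space AM p"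
      by (intro tangent_space_diff tangent_space_scaleR v xi_tangent)
    show "\<alpha> p [v - \<alpha> p [v] *\<^sub>R \<xi> p] = 0"
      using form1_diff[OF alpha_form v tangent_space_scaleR[OF xi_tangent]]
        form1_scaleR[OF alpha_form xi_tangent] alpha_xi by simp
    show "push p (v - \<alpha> p [v] *\<^sub>R \<xi> p) = y"
      by (simp add: push_forward_diff push_forward_scaleR push_xi pv)
  qed
qed

lemma hlift_eqI:
  assumes "w \<in> tangent_space AM p" "\<alpha> p [w] = 0" "push p w = y"
  shows "hlift p y = w"
  unfolding horizontal_lift_def
proof (rule the_equality)
  show "v = w" if "v \<in> tangent_space AM p \<and> \<alpha> p [v] = 0 \<and> push p v = y" for v
    using tangent_eq_iff[of v p w] that assms by simp
qed (use assms in simp)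

lemma
  assumes "y \<in> tangent_space AB (\<pi> p)"
  shows hlift_tangent: "hlift p y \<in> tangent_space AM p"
    and alpha_hlift: "\<alpha> p [hlift p y] = 0" and push_hlift: "push p (hlift p y) = y"
  using horizontal_exists[OF assms] hlift_eqI by metis+

lemma hlift_scaleR:
  assumes "y \<in> tangent_space AB (\<pi> p)"
  shows "hlift p (c *\<^sub>R y) = c *\<^sub>R hlift p y"
  using assms form1_scaleR[OF alpha_form hlift_tangent[OF assms]]
  by (intro hlift_eqI) (simp_all add: tangent_space_scaleR hlift_tangent alpha_hlift push_hlift push_forward_scaleR)

lemma hlift_add:
  assumes "y \<in> tangent_space AB (\<pi> p)" "z \<in> tangent_space AB (\<pi> p)"
  shows "hlift p (y + z) = hlift p y + hlift p z"
  using assms form1_add[OF alpha_form hlift_tangent[OF assms(1)] hlift_tangent[OF assms(2)]]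
  by (intro hlift_eqI) (simp_all add: tangent_space_plus hlift_tangent alpha_hlift push_hlift push_forward_add)

lemma hlift_zero: "hlift p 0 = 0"
  by (rule hlift_eqI) (simp_all add: tangent_space_zero form1_zero[OF alpha_form] push_forward_zero)

lemma hlift_sum:
  assumes "\<And>i. i \<in> I \<Longrightarrow> y i \<in> tangent_space AB (\<pi> p)"
  shows "hlift p (\<Sum>i\<in>I. y i) = (\<Sum>i\<in>I. hlift p (y i))"
  using assms
  by (induction I rule: infinite_finite_induct) (simp_all add: hlift_zero hlift_add tangent_space_sum)

lemma tangent_decomposition:
  assumes "v \<in> tangent_space AM p"
  shows "v = hlift p (push p v) + \<alpha> p [v] *\<^sub>R \<xi> p"
proof -
  note y = push_tangent[OF assms] and s = tangent_space_scaleR[OF xi_tangent]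
  show ?thesis
    by (rule tangent_eq_iff[THEN iffD2, OF assms tangent_space_plus[OF hlift_tangent[OF y] s]])
       (simp add: push_forward_add push_hlift[OF y] push_forward_scaleR push_xi
         form1_add[OF alpha_form hlift_tangent[OF y] s] alpha_hlift[OF y]
         form1_scaleR[OF alpha_form xi_tangent] alpha_xi)
qed

lemma pi_eventually: "\<forall>\<^sub>F b in nhds (\<pi> p). P b \<Longrightarrow> \<forall>\<^sub>F q in nhds p. P (\<pi> q)"
  by (rule smooth_at_compose_eventually[OF M B pi_smooth])

text \<open>\<open>horizontal_lift\<close> is a pointwise definite description and carries no
  smoothness. It is recovered here by writing the lift as a smooth lift minus its vertical
  part.\<close>

lemma hlift_chart_vector_near:
  assumes c: "(U, \<phi>) \<in> AB" "\<pi> p \<in> U"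
  shows "vfield_near AM p (\<lambda>q. hlift q (chart_vector AB U \<phi> e (\<pi> q)))"
proof -
  obtain Y where Y: "vfield_near AM p Y"
    and eY: "\<forall>\<^sub>F q in nhds p. push q (Y q) = chart_vector AB U \<phi> e (\<pi> q)"
    using local_lift[OF c] by blast
  have "vfield_near AM p (\<lambda>q. Y q + (- 1 * \<alpha> q [Y q]) *\<^sub>R \<xi> q)"
    by (intro vfield_near_add[OF M Y] vfield_near_scaleR[OF M _ xi_near] smooth_fun_at_mult[OF M]
        smooth_fun_at_const[OF M] form1_smooth[OF alpha_form Y])
  moreover have "\<forall>\<^sub>F q in nhds p. Y q + (- 1 * \<alpha> q [Y q]) *\<^sub>R \<xi> q = hlift q (chart_vector AB U \<phi> e (\<pi> q))"
    using eY vfield_near_eventually_tangent[OF Y]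
  proof eventually_elim
    case (elim q)
    show ?case
      using tangent_decomposition[OF elim(2)] unfolding elim(1) by (simp add: diff_eq_eq)
  qed
  ultimately show ?thesis by (rule vfield_near_cong[OF M])
qed

text \<open>The coefficients live on the total space, so \<open>Z\<close> may be a field along \<pi>
  rather than a field on the base.\<close>

lemma hlift_along_near:
  fixes a :: "'e \<Rightarrow> 'm \<Rightarrow> real"
  assumes c: "(U, \<phi>) \<in> AB" "\<pi> p \<in> U" and a: "\<And>e. smooth_fun_at AM (a e) p"
    and Z: "\<forall>\<^sub>F q in nhds p. Z q = (\<Sum>e\<in>Basis. a e q *\<^sub>R chart_vector AB U \<phi> e (\<pi> q))"
  shows "vfield_near AM p (\<lambda>q. hlift q (Z q))"
proof -
  have "vfield_near AM p (\<lambda>q. \<Sum>e\<in>Basis. a e q *\<^sub>R hlift q (chart_vector AB U \<phi> e (\<pi> q)))"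
    by (intro vfield_near_sum[OF M] vfield_near_scaleR[OF M a] hlift_chart_vector_near[OF c])
  moreover have "\<forall>\<^sub>F b in nhds (\<pi> p). b \<in> U"
    using chart_open[OF B c(1)] c(2) by (simp add: eventually_nhds_in_open)
  from Z pi_eventually[OF this]
  have "\<forall>\<^sub>F q in nhds p. (\<Sum>e\<in>Basis. a e q *\<^sub>R hlift q (chart_vector AB U \<phi> e (\<pi> q))) = hlift q (Z q)"
  proof eventually_elim
    case (elim q)
    note t = chart_vector_in_tangent_space[OF B c(1) elim(2)]
    show ?case
      unfolding elim(1) by (simp add: hlift_sum tangent_space_scaleR t hlift_scaleR)
  qed
  ultimately show ?thesis by (rule vfield_near_cong[OF M])
qed

lemma hlift_near:
  assumes X: "vfield_near AB (\<pi> p) X"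
  shows "vfield_near AM p (\<lambda>q. hlift q (X (\<pi> q)))"
proof -
  obtain U \<phi> where c: "(U, \<phi>) \<in> AB" "\<pi> p \<in> U" using chart_exists[OF B] .
  show ?thesis
  proof (rule hlift_along_near[OF c])
    fix e
    show "smooth_fun_at AM (\<lambda>q. X (\<pi> q) (\<lambda>b. \<phi> b \<bullet> e)) p"
      by (rule smooth_at_compose[OF M B smooth_manifold_std pi_smooth
            vfield_near_smooth[OF X smooth_fun_at_coordinate[OF B c]]])
  next
    have "\<forall>\<^sub>F b in nhds (\<pi> p). b \<in> U"
      using chart_open[OF B c(1)] c(2) by (simp add: eventually_nhds_in_open)
    from this vfield_near_eventually_tangent[OF X]
    have "\<forall>\<^sub>F b in nhds (\<pi> p). X b = (\<Sum>e\<in>Basis. X b (\<lambda>b. \<phi> b \<bullet> e) *\<^sub>R chart_vector AB U \<phi> e b)"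
      by eventually_elim (rule tangent_chart_expansion[OF B c(1)])
    then show "\<forall>\<^sub>F q in nhds p. X (\<pi> q) = (\<Sum>e\<in>Basis. X (\<pi> q) (\<lambda>b. \<phi> b \<bullet> e) *\<^sub>R chart_vector AB U \<phi> e (\<pi> q))"
      by (rule pi_eventually)
  qed
qed

text \<open>The projection of \<open>V\<close> depends on the point in the fibre, so
  \<open>J\<close> cannot be applied to it as a field on the base. It is applied to coordinate
  fields, where its smoothness is known.\<close>

lemma hlift_endomorphism_near:
  assumes J: "endomorphism_field AB J" and V: "vfield_near AM p V"
  shows "vfield_near AM p (\<lambda>q. hlift q (J (\<pi> q) (push q (V q))))"
proof -
  obtain U \<phi> where c: "(U, \<phi>) \<in> AB" "\<pi> p \<in> U" using chart_exists[OF B] .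
  define a where "a e q = V q (\<lambda>r. \<phi> (\<pi> r) \<bullet> e)" for e q
  have a: "smooth_fun_at AM (a e) p" for e
    unfolding a_def
    by (rule vfield_near_smooth[OF V smooth_at_compose[OF M B smooth_manifold_std pi_smooth smooth_fun_at_coordinate[OF B c]]])
  have E: "vfield_near AB (\<pi> p) (chart_vector AB U \<phi> e)" for e
    by (rule vfield_nearI[OF smooth_vfield_chart_vector[OF B c(1)] chart_open[OF B c(1)] c(2)])
  have "vfield_near AM p (\<lambda>q. \<Sum>e\<in>Basis. a e q *\<^sub>R hlift q (J (\<pi> q) (chart_vector AB U \<phi> e (\<pi> q))))"
    by (intro vfield_near_sum[OF M] vfield_near_scaleR[OF M a] hlift_near endomorphism_near[OF J E])
  moreover have "\<forall>\<^sub>F b in nhds (\<pi> p). b \<in> U"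
    using chart_open[OF B c(1)] c(2) by (simp add: eventually_nhds_in_open)
  from pi_eventually[OF this] vfield_near_eventually_tangent[OF V]
  have "\<forall>\<^sub>F q in nhds p. (\<Sum>e\<in>Basis. a e q *\<^sub>R hlift q (J (\<pi> q) (chart_vector AB U \<phi> e (\<pi> q))))
      = hlift q (J (\<pi> q) (push q (V q)))"
  proof eventually_elim
    case (elim q)
    note t = chart_vector_in_tangent_space[OF B c(1) elim(1)]
    have "J (\<pi> q) (\<Sum>e\<in>I. a e q *\<^sub>R chart_vector AB U \<phi> e (\<pi> q)) =
        (\<Sum>e\<in>I. a e q *\<^sub>R J (\<pi> q) (chart_vector AB U \<phi> e (\<pi> q)))" if "finite I" for I
      using that
      by (induction I rule: finite_induct)
         (simp_all add: endomorphism_zero[OF J] endomorphism_add[OF J] endomorphism_scaleR[OF J] t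
           tangent_space_scaleR tangent_space_sum)
    then show ?case
      unfolding push_forward_expansion[OF M B pi_smooth c(1) elim] a_def[symmetric]
      by (simp add: hlift_sum tangent_space_scaleR endomorphism_tangent[OF J t] hlift_scaleR)
  qed
  ultimately show ?thesis by (rule vfield_near_cong[OF M])
qed

lemma lifted_endomorphism_field:
  assumes J: "endomorphism_field AB J"
  shows "endomorphism_field AM (\<lambda>p v. hlift p (J (\<pi> p) (push p v)))"
  unfolding endomorphism_field_iff
proof (intro conjI allI ballI impI)
  fix p v w c assume v: "v \<in> tangent_space AM p"
  note jv = endomorphism_tangent[OF J push_tangent[OF v]]
  show "hlift p (J (\<pi> p) (push p v)) \<in> tangent_space AM p" by (rule hlift_tangent[OF jv])
  show "hlift p (J (\<pi> p) (push p (c *\<^sub>R v))) = c *\<^sub>R hlift p (J (\<pi> p) (push p v))"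
    by (simp add: push_forward_scaleR endomorphism_scaleR[OF J push_tangent[OF v]] hlift_scaleR[OF jv])
  assume w: "w \<in> tangent_space AM p"
  show "hlift p (J (\<pi> p) (push p (v + w))) = hlift p (J (\<pi> p) (push p v)) + hlift p (J (\<pi> p) (push p w))"
    by (simp add: push_forward_add endomorphism_add[OF J push_tangent[OF v] push_tangent[OF w]]
        hlift_add[OF jv endomorphism_tangent[OF J push_tangent[OF w]]])
next
  fix p X assume "vfield_near AM p X"
  then show "vfield_near AM p (\<lambda>q. hlift q (J (\<pi> q) (push q (X q))))" by (rule hlift_endomorphism_near[OF J])
qed

section \<open>Horizontal and vertical components of brackets\<close>

lemma push_lie_bracket:
  assumes "vfield_near AM p V" "vfield_near AM p V'" "vfield_near AB (\<pi> p) X" "vfield_near AB (\<pi> p) X'"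
    "\<forall>\<^sub>F q in nhds p. push q (V q) = X (\<pi> q)" "\<forall>\<^sub>F q in nhds p. push q (V' q) = X' (\<pi> q)"
  shows "push p (lie_bracket AM V V' p) = lie_bracket AB X X' (\<pi> p)"
  by (rule lie_bracket_related[OF M B pi_smooth assms])

lemma push_hlift_eventually:
  assumes "vfield_near AB (\<pi> p) X"
  shows "\<forall>\<^sub>F q in nhds p. push q (hlift q (X (\<pi> q))) = X (\<pi> q)"
  using pi_eventually[OF vfield_near_eventually_tangent[OF assms]] by eventually_elim (rule push_hlift)

lemma alpha_hlift_eventually:
  assumes "vfield_near AB (\<pi> p) X"
  shows "\<forall>\<^sub>F q in nhds p. \<alpha> q [hlift q (X (\<pi> q))] = 0"
  using pi_eventually[OF vfield_near_eventually_tangent[OF assms]] by eventually_elim (rule alpha_hlift)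

text \<open>The invariant formula for d\<alpha>, solved for the vertical component of the bracket.
  This is how the curvature enters the computation of Nijenhuis tensors.\<close>

lemma alpha_lie_bracket:
  assumes V: "vfield_near AM p V" and V': "vfield_near AM p V'"
  shows "\<alpha> p [lie_bracket AM V V' p] =
    V p (\<lambda>q. \<alpha> q [V' q]) - V' p (\<lambda>q. \<alpha> q [V q]) - \<eta> (\<pi> p) [push p (V p), push p (V' p)]"
  using curvature[OF V V'] by (simp add: ext_deriv1_def)

end

section \<open>Almost complex structures lifted from an almost contact structure\<close>

text \<open>
  These are the three tensors \<open>N\<^sup>(\<^sup>1\<^sup>)\<close>, \<open>N\<^sup>(\<^sup>2\<^sup>)\<close> and \<open>N\<^sup>(\<^sup>3\<^sup>)\<close> of an almost contact structure, where in the
  first one \<open>\<psi>\<^sup>2 = - Id + \<beta> \<otimes> W\<close> has been inserted.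
\<close>

definition contact_tensor1 ::
    "('b::topological_space, 'e::euclidean_space) atlas \<Rightarrow> 'b dform \<Rightarrow> 'b vfield \<Rightarrow> ('b \<Rightarrow> 'b tvec \<Rightarrow> 'b tvec) \<Rightarrow>
     'b vfield \<Rightarrow> 'b vfield \<Rightarrow> 'b vfield" where
  "contact_tensor1 A \<beta> W \<psi> X Y b =
     lie_bracket A (\<lambda>q. \<psi> q (X q)) (\<lambda>q. \<psi> q (Y q)) b
     - \<psi> b (lie_bracket A (\<lambda>q. \<psi> q (X q)) Y b) - \<psi> b (lie_bracket A X (\<lambda>q. \<psi> q (Y q)) b)
     - lie_bracket A X Y b + (X b (\<lambda>q. \<beta> q [Y q]) - Y b (\<lambda>q. \<beta> q [X q])) *\<^sub>R W b"

definition contact_tensor2 ::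
    "('b::topological_space, 'e::euclidean_space) atlas \<Rightarrow> 'b dform \<Rightarrow> ('b \<Rightarrow> 'b tvec \<Rightarrow> 'b tvec) \<Rightarrow>
     'b vfield \<Rightarrow> 'b vfield \<Rightarrow> 'b \<Rightarrow> real" where
  "contact_tensor2 A \<beta> \<psi> X Y b =
     \<psi> b (X b) (\<lambda>q. \<beta> q [Y q]) - \<psi> b (Y b) (\<lambda>q. \<beta> q [X q])
     - \<beta> b [lie_bracket A (\<lambda>q. \<psi> q (X q)) Y b] - \<beta> b [lie_bracket A X (\<lambda>q. \<psi> q (Y q)) b]"

definition contact_tensor3 ::
    "('b::topological_space, 'e::euclidean_space) atlas \<Rightarrow> 'b vfield \<Rightarrow> ('b \<Rightarrow> 'b tvec \<Rightarrow> 'b tvec) \<Rightarrow>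
     'b vfield \<Rightarrow> 'b vfield" where
  "contact_tensor3 A W \<psi> X b = lie_bracket A W (\<lambda>q. \<psi> q (X q)) b - \<psi> b (lie_bracket A W X b)"

definition contact_tensors_vanish ::
    "('b::topological_space, 'e::euclidean_space) atlas \<Rightarrow> 'b dform \<Rightarrow> 'b vfield \<Rightarrow> ('b \<Rightarrow> 'b tvec \<Rightarrow> 'b tvec) \<Rightarrow> bool"
  where
  "contact_tensors_vanish A \<beta> W \<psi> \<longleftrightarrow>
     (\<forall>b X Y. vfield_near A b X \<longrightarrow> vfield_near A b Y \<longrightarrow>
        contact_tensor1 A \<beta> W \<psi> X Y b = 0 \<and> contact_tensor2 A \<beta> \<psi> X Y b = 0 \<and> contact_tensor3 A W \<psi> X b = 0)"

text \<open>
  The sign \<open>s\<close> distinguishes the structures \<open>J\<close> (\<open>s = -1\<close>) and \<open>T\<close> (\<open>s = 1\<close>) on the circle bundle; the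
  almost complex structure on the product with the real line is the case \<open>s = 1\<close>, \<open>\<eta> = 0\<close>.
\<close>

locale lifted_contact_structure = connection_bundle AB AM \<pi> \<xi> \<alpha> \<eta>
  for AB :: "('b::{t2_space,second_countable_topology}, 'e::euclidean_space) atlas"
    and AM :: "('m::{t2_space,second_countable_topology}, 'f::euclidean_space) atlas"
    and \<pi> \<xi> \<alpha> \<eta> +
  fixes \<beta> :: "'b dform" and W :: "'b vfield" and \<psi> :: "'b \<Rightarrow> 'b tvec \<Rightarrow> 'b tvec"
  assumes beta_form: "differential_form AB 1 \<beta>" and W_near: "vfield_near AB b W"
    and psi_field: "endomorphism_field AB \<psi>"
    and psi_psi: "v \<in> tangent_space AB b \<Longrightarrow> \<psi> b (\<psi> b v) = - v + \<beta> b [v] *\<^sub>R W b"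
    and psi_W: "\<psi> b (W b) = 0" and beta_W: "\<beta> b [W b] = 1"
    and dbeta_W: "vfield_near AB b X \<Longrightarrow> ext_deriv1 AB \<beta> W X b = 0"
    and eta_invariant: "v \<in> tangent_space AB b \<Longrightarrow> w \<in> tangent_space AB b \<Longrightarrow> \<eta> b [\<psi> b v, \<psi> b w] = \<eta> b [v, w]"
    and eta_skew: "v \<in> tangent_space AB b \<Longrightarrow> w \<in> tangent_space AB b \<Longrightarrow> \<eta> b [\<psi> b v, w] + \<eta> b [v, \<psi> b w] = 0"
    and eta_W: "v \<in> tangent_space AB b \<Longrightarrow> \<eta> b [c *\<^sub>R W b, v] = 0"
begin

text \<open>The common shape of \<open>acs_J\<close>, \<open>acs_T\<close> and
  \<open>cone_acs\<close>. It becomes almost complex under \<open>s * s = 1\<close>, which is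
  assumed where needed.\<close>

definition lifted_acs :: "real \<Rightarrow> 'm \<Rightarrow> 'm tvec \<Rightarrow> 'm tvec" where
  "lifted_acs s p v = hlift p (\<psi> (\<pi> p) (push p v))
     + (s * \<beta> (\<pi> p) [push p v]) *\<^sub>R \<xi> p - (s * \<alpha> p [v]) *\<^sub>R hlift p (W (\<pi> p))"

lemma W_tangent: "W b \<in> tangent_space AB b"
  by (rule vfield_near_tangent[OF W_near])

lemma psi_tangent: "v \<in> tangent_space AB b \<Longrightarrow> \<psi> b v \<in> tangent_space AB b"
  by (rule endomorphism_tangent[OF psi_field])

text \<open>The third power of \<psi> is computed in two ways. As \<psi> W = 0, applying \<psi> to
  \<psi>^2 v gives - \<psi> v; the formula for \<psi>^2 at \<psi> v gives - \<psi> v +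
  \<beta>(\<psi> v) W.\<close>

lemma beta_psi:
  assumes v: "v \<in> tangent_space AB b"
  shows "\<beta> b [\<psi> b v] = 0"
proof -
  have "\<psi> b (\<psi> b (\<psi> b v)) = - \<psi> b v"
    unfolding psi_psi[OF v]
    using endomorphism_add[OF psi_field tangent_space_uminus[OF v] tangent_space_scaleR[OF W_tangent]]
      endomorphism_uminus[OF psi_field v] endomorphism_scaleR[OF psi_field W_tangent] psi_W by simp
  then have "\<beta> b [\<psi> b v] *\<^sub>R W b = 0" using psi_psi[OF psi_tangent[OF v]] by simp
  then have "\<beta> b [\<beta> b [\<psi> b v] *\<^sub>R W b] = 0" by (simp only: form1_zero[OF beta_form])
  then show ?thesis using form1_scaleR[OF beta_form W_tangent] beta_W by simp
qed

lemma
  assumes v: "v \<in> tangent_space AM p"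
  shows lifted_acs_tangent: "lifted_acs s p v \<in> tangent_space AM p"
    and push_lifted_acs: "push p (lifted_acs s p v) = \<psi> (\<pi> p) (push p v) - (s * \<alpha> p [v]) *\<^sub>R W (\<pi> p)"
    and alpha_lifted_acs: "\<alpha> p [lifted_acs s p v] = s * \<beta> (\<pi> p) [push p v]"
proof -
  note j = psi_tangent[OF push_tangent[OF v]]
  note t1 = hlift_tangent[OF j] and t2 = tangent_space_scaleR[OF xi_tangent] and t3 = hlift_tangent[OF W_tangent]
  show "lifted_acs s p v \<in> tangent_space AM p"
    unfolding lifted_acs_def by (intro tangent_space_diff tangent_space_plus tangent_space_scaleR t1 t2 t3)
  show "push p (lifted_acs s p v) = \<psi> (\<pi> p) (push p v) - (s * \<alpha> p [v]) *\<^sub>R W (\<pi> p)"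
    unfolding lifted_acs_def
    by (simp add: push_forward_diff push_forward_add push_forward_scaleR push_xi push_hlift[OF j] push_hlift[OF W_tangent])
  show "\<alpha> p [lifted_acs s p v] = s * \<beta> (\<pi> p) [push p v]"
    unfolding lifted_acs_def form1_diff[OF alpha_form tangent_space_plus[OF t1 t2] tangent_space_scaleR[OF t3]]
      form1_add[OF alpha_form t1 t2] form1_scaleR[OF alpha_form t3] form1_scaleR[OF alpha_form xi_tangent]
    by (simp add: alpha_hlift[OF j] alpha_hlift[OF W_tangent] alpha_xi)
qed

lemma pullback_beta_form: "differential_form AM 1 (pullback AB \<pi> \<beta>)"
  by (rule differential_form_pullback[OF M B pi_smooth beta_form])

lemma lifted_acs_endomorphism: "endomorphism_field AM (lifted_acs s)"
  unfolding endomorphism_field_iff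
proof (intro conjI allI ballI impI)
  fix p v w c assume v: "v \<in> tangent_space AM p"
  note L = lifted_acs_tangent
  show "lifted_acs s p v \<in> tangent_space AM p" by (rule L[OF v])
  note cv = tangent_space_scaleR[OF v] and pv = push_tangent[OF v]
  show "lifted_acs s p (c *\<^sub>R v) = c *\<^sub>R lifted_acs s p v"
    by (rule tangent_eq_iff[THEN iffD2, OF L[OF cv] tangent_space_scaleR[OF L[OF v]]])
       (simp add: push_lifted_acs[OF cv] push_lifted_acs[OF v] alpha_lifted_acs[OF cv] alpha_lifted_acs[OF v]
         push_forward_scaleR endomorphism_scaleR[OF psi_field pv] form1_scaleR[OF alpha_form v]
         form1_scaleR[OF alpha_form L[OF v]] form1_scaleR[OF beta_form pv] algebra_simps)
  assume w: "w \<in> tangent_space AM p"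
  note vw = tangent_space_plus[OF v w] and pw = push_tangent[OF w]
  show "lifted_acs s p (v + w) = lifted_acs s p v + lifted_acs s p w"
    by (rule tangent_eq_iff[THEN iffD2, OF L[OF vw] tangent_space_plus[OF L[OF v] L[OF w]]])
       (simp add: push_lifted_acs[OF vw] push_lifted_acs[OF v] push_lifted_acs[OF w]
         alpha_lifted_acs[OF vw] alpha_lifted_acs[OF v] alpha_lifted_acs[OF w]
         push_forward_add endomorphism_add[OF psi_field pv pw] form1_add[OF alpha_form v w]
         form1_add[OF alpha_form L[OF v] L[OF w]] form1_add[OF beta_form pv pw] algebra_simps)
next
  fix p X assume X: "vfield_near AM p X"
  have "vfield_near AM p (\<lambda>q. hlift q (\<psi> (\<pi> q) (push q (X q)))
      + (s * pullback AB \<pi> \<beta> q [X q]) *\<^sub>R \<xi> q + (- s * \<alpha> q [X q]) *\<^sub>R hlift q (W (\<pi> q)))"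
    by (intro vfield_near_add[OF M] hlift_endomorphism_near[OF psi_field X] vfield_near_scaleR[OF M _ xi_near]
        vfield_near_scaleR[OF M _ hlift_near[OF W_near]] smooth_fun_at_mult[OF M] smooth_fun_at_const[OF M]
        form1_smooth[OF pullback_beta_form X] form1_smooth[OF alpha_form X])
  then show "vfield_near AM p (\<lambda>q. lifted_acs s q (X q))"
    by (simp add: lifted_acs_def pullback_def)
qed

text \<open>The square is - Id because \<open>s * s = 1\<close>, \<psi> W = 0 and \<beta>(\<psi> v)
  = 0. It is stated by components because the Nijenhuis tensor is evaluated by components.\<close>

lemma
  assumes s: "s * s = 1" and v: "v \<in> tangent_space AM p"
  shows push_lifted_acs2: "push p (lifted_acs s p (lifted_acs s p v)) = - push p v"
    and alpha_lifted_acs2: "\<alpha> p [lifted_acs s p (lifted_acs s p v)] = - \<alpha> p [v]"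
proof -
  note L = lifted_acs_tangent[OF v] and pv = push_tangent[OF v]
  note cW = tangent_space_scaleR[OF W_tangent]
  have ss: "s * (s * x) = x" for x using s by (simp add: mult.assoc[symmetric])
  have "\<psi> (\<pi> p) (\<psi> (\<pi> p) (push p v) - (s * \<alpha> p [v]) *\<^sub>R W (\<pi> p)) = \<psi> (\<pi> p) (\<psi> (\<pi> p) (push p v))"
    by (simp add: endomorphism_diff[OF psi_field psi_tangent[OF pv] cW] endomorphism_scaleR[OF psi_field W_tangent] psi_W)
  then show "push p (lifted_acs s p (lifted_acs s p v)) = - push p v"
    unfolding push_lifted_acs[OF L] push_lifted_acs[OF v] alpha_lifted_acs[OF v] by (simp add: psi_psi[OF pv] ss)
  show "\<alpha> p [lifted_acs s p (lifted_acs s p v)] = - \<alpha> p [v]"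
    unfolding alpha_lifted_acs[OF L] push_lifted_acs[OF v]
    by (simp add: form1_diff[OF beta_form psi_tangent[OF pv] cW] form1_scaleR[OF beta_form W_tangent] beta_W beta_psi[OF pv] ss)
qed

text \<open>The indices of the four brackets record to which arguments \<open>E\<close> is applied.
  Inserting the square of \<open>E\<close> leaves an expression in the projections and connection
  values of these brackets alone.\<close>

lemma
  assumes s: "s * s = 1" and V: "vfield_near AM p V" and V': "vfield_near AM p V'"
  defines "E \<equiv> lifted_acs s"
  defines "B11 \<equiv> lie_bracket AM (\<lambda>q. E q (V q)) (\<lambda>q. E q (V' q)) p" and "B10 \<equiv> lie_bracket AM (\<lambda>q. E q (V q)) V' p"
    and "B01 \<equiv> lie_bracket AM V (\<lambda>q. E q (V' q)) p" and "B00 \<equiv> lie_bracket AM V V' p"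
  shows nijenhuis_lifted_tangent: "nijenhuis AM E V V' p \<in> tangent_space AM p"
    and push_nijenhuis_lifted: "push p (nijenhuis AM E V V' p) = push p B11 - \<psi> (\<pi> p) (push p B10)
      - \<psi> (\<pi> p) (push p B01) - push p B00 + (s * (\<alpha> p [B10] + \<alpha> p [B01])) *\<^sub>R W (\<pi> p)"
    and alpha_nijenhuis_lifted: "\<alpha> p [nijenhuis AM E V V' p] =
      \<alpha> p [B11] - s * \<beta> (\<pi> p) [push p B10] - s * \<beta> (\<pi> p) [push p B01] - \<alpha> p [B00]"
proof -
  note EV = endomorphism_near[OF lifted_acs_endomorphism V, of s] and EV' = endomorphism_near[OF lifted_acs_endomorphism V', of s]
  have b: "B11 \<in> tangent_space AM p" "B10 \<in> tangent_space AM p" "B01 \<in> tangent_space AM p" "B00 \<in> tangent_space AM p"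
    unfolding B11_def B10_def B01_def B00_def E_def
    by (rule lie_bracket_tangent[OF M EV EV'] lie_bracket_tangent[OF M EV V'] lie_bracket_tangent[OF M V EV']
        lie_bracket_tangent[OF M V V'])+
  note L = lifted_acs_tangent
  have N: "nijenhuis AM E V V' p = B11 - E p B10 - E p B01 + E p (E p B00)"
    unfolding nijenhuis_def B11_def B10_def B01_def B00_def ..
  have t1: "B11 - E p B10 \<in> tangent_space AM p"
    and t2: "B11 - E p B10 - E p B01 \<in> tangent_space AM p"
    unfolding E_def by (intro tangent_space_diff b L)+
  have t3: "E p (E p B00) \<in> tangent_space AM p" unfolding E_def by (intro L b)
  show "nijenhuis AM E V V' p \<in> tangent_space AM p"
    unfolding N by (rule tangent_space_plus[OF t2 t3])
  show "push p (nijenhuis AM E V V' p) = push p B11 - \<psi> (\<pi> p) (push p B10)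
      - \<psi> (\<pi> p) (push p B01) - push p B00 + (s * (\<alpha> p [B10] + \<alpha> p [B01])) *\<^sub>R W (\<pi> p)"
    unfolding N push_forward_add push_forward_diff
    unfolding E_def push_lifted_acs2[OF s b(4)]
      push_lifted_acs[OF b(2)] push_lifted_acs[OF b(3)]
    by (simp add: algebra_simps)
  show "\<alpha> p [nijenhuis AM E V V' p] =
      \<alpha> p [B11] - s * \<beta> (\<pi> p) [push p B10] - s * \<beta> (\<pi> p) [push p B01] - \<alpha> p [B00]"
    unfolding N form1_add[OF alpha_form t2 t3] form1_diff[OF alpha_form t1 L[OF b(3), of s, folded E_def]]
      form1_diff[OF alpha_form b(1) L[OF b(2), of s, folded E_def]]
    unfolding E_def alpha_lifted_acs2[OF s b(4)] alpha_lifted_acs[OF b(2)] alpha_lifted_acs[OF b(3)]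
    by simp
qed

context
  fixes s :: real and p :: 'm and X :: "'b vfield"
  assumes X: "vfield_near AB (\<pi> p) X"
begin

lemma lifted_hlift_near: "vfield_near AM p (\<lambda>q. lifted_acs s q (hlift q (X (\<pi> q))))"
  by (rule endomorphism_near[OF lifted_acs_endomorphism hlift_near[OF X]])

lemma psi_near: "vfield_near AB (\<pi> p) (\<lambda>b. \<psi> b (X b))"
  by (rule endomorphism_near[OF psi_field X])

lemma push_lifted_hlift_eventually:
  "\<forall>\<^sub>F q in nhds p. push q (lifted_acs s q (hlift q (X (\<pi> q)))) = \<psi> (\<pi> q) (X (\<pi> q))"
  using pi_eventually[OF vfield_near_eventually_tangent[OF X]]
  by eventually_elim (simp add: push_lifted_acs[OF hlift_tangent] push_hlift alpha_hlift)

lemma alpha_lifted_hlift_eventually: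
  "\<forall>\<^sub>F q in nhds p. \<alpha> q [lifted_acs s q (hlift q (X (\<pi> q)))] = s * \<beta> (\<pi> q) [X (\<pi> q)]"
  using pi_eventually[OF vfield_near_eventually_tangent[OF X]]
  by eventually_elim (simp add: alpha_lifted_acs[OF hlift_tangent] push_hlift)

lemma push_apply:
  assumes v: "v \<in> tangent_space AM p"
  shows "v (\<lambda>q. s * \<beta> (\<pi> q) [X (\<pi> q)]) = s * push p v (\<lambda>b. \<beta> b [X b])"
proof -
  note f = form1_smooth[OF beta_form X]
  have "smooth_fun_at AM (\<lambda>q. \<beta> (\<pi> q) [X (\<pi> q)]) p"
    by (rule smooth_at_compose[OF M B smooth_manifold_std pi_smooth f])
  from tangent_cmult[OF v this, of s] f show ?thesis by (simp add: push_forward_def comp_def)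
qed

end

section \<open>The Nijenhuis tensor on horizontal lifts and on the generator\<close>

lemma nijenhuis_lifted_horizontal:
  assumes s: "s * s = 1" and X: "vfield_near AB (\<pi> p) X" and Y: "vfield_near AB (\<pi> p) Y"
  defines "N \<equiv> nijenhuis AM (lifted_acs s) (\<lambda>q. hlift q (X (\<pi> q))) (\<lambda>q. hlift q (Y (\<pi> q))) p"
  shows "push p N = contact_tensor1 AB \<beta> W \<psi> X Y (\<pi> p)" and "\<alpha> p [N] = s * contact_tensor2 AB \<beta> \<psi> X Y (\<pi> p)"
proof -
  let ?E = "lifted_acs s" and ?X = "\<lambda>q. hlift q (X (\<pi> q))" and ?Y = "\<lambda>q. hlift q (Y (\<pi> q))"
  note nX = hlift_near[OF X] and nY = hlift_near[OF Y]
  note nEX = lifted_hlift_near[OF X, of s] and nEY = lifted_hlift_near[OF Y, of s]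
  note rX = push_hlift_eventually[OF X] and rY = push_hlift_eventually[OF Y]
  note rEX = push_lifted_hlift_eventually[OF X, of s] and rEY = push_lifted_hlift_eventually[OF Y, of s]
  note b11 = push_lie_bracket[OF nEX nEY psi_near[OF X] psi_near[OF Y] rEX rEY]
    and b10 = push_lie_bracket[OF nEX nY psi_near[OF X] Y rEX rY]
    and b01 = push_lie_bracket[OF nX nEY X psi_near[OF Y] rX rEY]
    and b00 = push_lie_bracket[OF nX nY X Y rX rY]
  note pX = eventually_nhds_x_imp_x[OF rX] and pY = eventually_nhds_x_imp_x[OF rY]
    and pEX = eventually_nhds_x_imp_x[OF rEX] and pEY = eventually_nhds_x_imp_x[OF rEY]
  note tX = vfield_near_tangent[OF X] and tY = vfield_near_tangent[OF Y]
  have ss: "s * (s * x) = x" for x using s by (simp add: mult.assoc[symmetric])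
  \<comment> \<open>Near \<open>p\<close> the connection value of a lift is 0, and that of its image
    under \<open>?E\<close> is a function pulled back from the base, whose derivative depends only
    on the projection of \<open>v\<close>.\<close>
  have z: "v (\<lambda>q. \<alpha> q [hlift q (Z (\<pi> q))]) = 0" if "v \<in> tangent_space AM p" "vfield_near AB (\<pi> p) Z" for v Z
    using tangent_germ_eventually[OF M that(1) alpha_hlift_eventually[OF that(2)]] tangent_const[OF M that(1), of 0] by simp
  have e: "v (\<lambda>q. \<alpha> q [?E q (hlift q (Z (\<pi> q)))]) = s * push p v (\<lambda>b. \<beta> b [Z b])"
    if "v \<in> tangent_space AM p" "vfield_near AB (\<pi> p) Z" for v Z
    using tangent_germ_eventually[OF M that(1) alpha_lifted_hlift_eventually[OF that(2), of s]]
      push_apply[OF that(2,1), of s] by simp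
  note vX = vfield_near_tangent[OF nX] and vY = vfield_near_tangent[OF nY]
    and vEX = vfield_near_tangent[OF nEX] and vEY = vfield_near_tangent[OF nEY]
  have a00: "\<alpha> p [lie_bracket AM ?X ?Y p] = - \<eta> (\<pi> p) [X (\<pi> p), Y (\<pi> p)]"
    using alpha_lie_bracket[OF nX nY] z[OF vX Y] z[OF vY X] pX pY by simp
  have a10: "\<alpha> p [lie_bracket AM (\<lambda>q. ?E q (?X q)) ?Y p] =
      - s * Y (\<pi> p) (\<lambda>b. \<beta> b [X b]) - \<eta> (\<pi> p) [\<psi> (\<pi> p) (X (\<pi> p)), Y (\<pi> p)]"
    using alpha_lie_bracket[OF nEX nY] z[OF vEX Y] e[OF vY X] pEX pY by simp
  have a01: "\<alpha> p [lie_bracket AM ?X (\<lambda>q. ?E q (?Y q)) p] =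
      s * X (\<pi> p) (\<lambda>b. \<beta> b [Y b]) - \<eta> (\<pi> p) [X (\<pi> p), \<psi> (\<pi> p) (Y (\<pi> p))]"
    using alpha_lie_bracket[OF nX nEY] z[OF vEY X] e[OF vX Y] pX pEY by simp
  \<comment> \<open>By invariance the curvature term is \<eta>(X, Y) instead of \<eta>(\<psi> X,
    \<psi> Y), so that it cancels against the one in \<open>a00\<close>.\<close>
  have a11: "\<alpha> p [lie_bracket AM (\<lambda>q. ?E q (?X q)) (\<lambda>q. ?E q (?Y q)) p] =
      s * \<psi> (\<pi> p) (X (\<pi> p)) (\<lambda>b. \<beta> b [Y b]) - s * \<psi> (\<pi> p) (Y (\<pi> p)) (\<lambda>b. \<beta> b [X b])
      - \<eta> (\<pi> p) [X (\<pi> p), Y (\<pi> p)]"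
    using alpha_lie_bracket[OF nEX nEY] e[OF vEX Y] e[OF vEY X] pEX pEY eta_invariant[OF tX tY] by simp
  have "s * (\<alpha> p [lie_bracket AM (\<lambda>q. ?E q (?X q)) ?Y p] + \<alpha> p [lie_bracket AM ?X (\<lambda>q. ?E q (?Y q)) p]) =
      s * (s * (X (\<pi> p) (\<lambda>b. \<beta> b [Y b]) - Y (\<pi> p) (\<lambda>b. \<beta> b [X b])))
      - s * (\<eta> (\<pi> p) [\<psi> (\<pi> p) (X (\<pi> p)), Y (\<pi> p)] + \<eta> (\<pi> p) [X (\<pi> p), \<psi> (\<pi> p) (Y (\<pi> p))])"
    unfolding a10 a01 by (simp add: algebra_simps)
  \<comment> \<open>The curvature terms form the combination killed by \<open>eta_skew\<close>, and
    the two factors \<open>s\<close> multiply to 1: the horizontal part no longer depends on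
    \<open>s\<close>.\<close>
  then have W: "s * (\<alpha> p [lie_bracket AM (\<lambda>q. ?E q (?X q)) ?Y p] + \<alpha> p [lie_bracket AM ?X (\<lambda>q. ?E q (?Y q)) p]) =
      X (\<pi> p) (\<lambda>b. \<beta> b [Y b]) - Y (\<pi> p) (\<lambda>b. \<beta> b [X b])"
    unfolding ss eta_skew[OF tX tY] by simp
  show "push p N = contact_tensor1 AB \<beta> W \<psi> X Y (\<pi> p)"
    unfolding N_def push_nijenhuis_lifted[OF s nX nY] W b11 b10 b01 b00 contact_tensor1_def ..
  show "\<alpha> p [N] = s * contact_tensor2 AB \<beta> \<psi> X Y (\<pi> p)"
    unfolding N_def alpha_nijenhuis_lifted[OF s nX nY] a11 a00 b10 b01 contact_tensor2_def
    by (simp add: algebra_simps)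
qed

text \<open>\<xi> is related to the zero field and its image under the structure to - s W, so only
  brackets with W survive. The vertical part is d\<beta>(W, X) up to sign, which vanishes because W
  is the Reeb field.\<close>

lemma nijenhuis_lifted_vertical:
  assumes s: "s * s = 1" and X: "vfield_near AB (\<pi> p) X"
  defines "N \<equiv> nijenhuis AM (lifted_acs s) \<xi> (\<lambda>q. hlift q (X (\<pi> q))) p"
  shows "push p N = - s *\<^sub>R contact_tensor3 AB W \<psi> X (\<pi> p)" and "\<alpha> p [N] = 0"
proof -
  let ?E = "lifted_acs s" and ?X = "\<lambda>q. hlift q (X (\<pi> q))"
  let ?W = "\<lambda>b. (- s) *\<^sub>R W b"
  note nX = hlift_near[OF X] and nEX = lifted_hlift_near[OF X, of s]
  note rX = push_hlift_eventually[OF X] and rEX = push_lifted_hlift_eventually[OF X, of s]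
  note nxi = xi_near[of p] and nExi = endomorphism_near[OF lifted_acs_endomorphism[of s] xi_near[of p]]
  have rxi: "\<forall>\<^sub>F q in nhds p. push q (\<xi> q) = (\<lambda>_. 0) (\<pi> q)" by (simp add: push_xi)
  have pushE: "push q (?E q (\<xi> q)) = ?W (\<pi> q)" for q
    by (simp add: push_lifted_acs[OF xi_tangent] push_xi alpha_xi endomorphism_zero[OF psi_field])
  then have rExi: "\<forall>\<^sub>F q in nhds p. push q (?E q (\<xi> q)) = ?W (\<pi> q)" by simp
  have aE: "\<alpha> q [?E q (\<xi> q)] = 0" for q
    by (simp add: alpha_lifted_acs[OF xi_tangent] push_xi form1_zero[OF beta_form])
  note n0 = vfield_near_zero[OF B, of "\<pi> p"] and nW = vfield_near_cmult[OF B W_near[of "\<pi> p"], of "- s"]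
  have br0: "lie_bracket AB (\<lambda>_. 0) Z (\<pi> p) = 0" if "vfield_near AB (\<pi> p) Z" for Z
    using lie_bracket_cmult_left[OF B n0 that, of 0] by simp
  have brW: "lie_bracket AB ?W Z (\<pi> p) = - s *\<^sub>R lie_bracket AB W Z (\<pi> p)" if "vfield_near AB (\<pi> p) Z" for Z
    by (rule lie_bracket_cmult_left[OF B W_near that])
  note b11 = push_lie_bracket[OF nExi nEX nW psi_near[OF X] rExi rEX, unfolded brW[OF psi_near[OF X]]]
    and b10 = push_lie_bracket[OF nExi nX nW X rExi rX, unfolded brW[OF X]]
    and b01 = push_lie_bracket[OF nxi nEX n0 psi_near[OF X] rxi rEX, unfolded br0[OF psi_near[OF X]]]
    and b00 = push_lie_bracket[OF nxi nX n0 X rxi rX, unfolded br0[OF X]]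
  note pX = eventually_nhds_x_imp_x[OF rX] and pEX = eventually_nhds_x_imp_x[OF rEX]
  note tX = vfield_near_tangent[OF X]
  note vX = vfield_near_tangent[OF nX] and vEX = vfield_near_tangent[OF nEX]
    and vxi = vfield_near_tangent[OF nxi] and vExi = vfield_near_tangent[OF nExi]
  have z: "v (\<lambda>q. \<alpha> q [?X q]) = 0" if "v \<in> tangent_space AM p" for v
    using tangent_germ_eventually[OF M that alpha_hlift_eventually[OF X]] tangent_const[OF M that, of 0] by simp
  have e: "v (\<lambda>q. \<alpha> q [?E q (?X q)]) = s * push p v (\<lambda>b. \<beta> b [X b])" if "v \<in> tangent_space AM p" for v
    using tangent_germ_eventually[OF M that alpha_lifted_hlift_eventually[OF X, of s]] push_apply[OF X that, of s] by simp
  have eta0: "\<eta> (\<pi> p) [0, v] = 0" if "v \<in> tangent_space AB (\<pi> p)" for v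
    using eta_W[OF that, of 0] by simp
  have etaW: "\<eta> (\<pi> p) [- (s *\<^sub>R W (\<pi> p)), v] = 0" if "v \<in> tangent_space AB (\<pi> p)" for v
    using eta_W[OF that, of "- s"] by simp
  have c: "v (\<lambda>q. \<alpha> q [\<xi> q]) = 0" "v (\<lambda>q. \<alpha> q [?E q (\<xi> q)]) = 0" if "v \<in> tangent_space AM p" for v
    by (simp_all add: alpha_xi aE tangent_const[OF M that])
  have a00: "\<alpha> p [lie_bracket AM \<xi> ?X p] = 0"
    using alpha_lie_bracket[OF nxi nX] z[OF vxi] c(1)[OF vX] pX push_xi eta0[OF tX] by simp
  have a10: "\<alpha> p [lie_bracket AM (\<lambda>q. ?E q (\<xi> q)) ?X p] = 0"
    using alpha_lie_bracket[OF nExi nX] z[OF vExi] c(2)[OF vX] pX pushE etaW[OF tX] by simp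
  have a01: "\<alpha> p [lie_bracket AM \<xi> (\<lambda>q. ?E q (?X q)) p] = 0"
    using alpha_lie_bracket[OF nxi nEX] e[OF vxi] c(1)[OF vEX] pEX push_xi eta0[OF psi_tangent[OF tX]]
    by (simp add: zero_fun_apply)
  have a11: "\<alpha> p [lie_bracket AM (\<lambda>q. ?E q (\<xi> q)) (\<lambda>q. ?E q (?X q)) p] = - W (\<pi> p) (\<lambda>b. \<beta> b [X b])"
  proof -
    have "s * ((- s) *\<^sub>R W (\<pi> p)) (\<lambda>b. \<beta> b [X b]) = - W (\<pi> p) (\<lambda>b. \<beta> b [X b])"
      using s by (simp add: tvec_apply mult.assoc[symmetric])
    then show ?thesis
      using alpha_lie_bracket[OF nExi nEX] e[OF vExi] c(2)[OF vEX] pEX pushE etaW[OF psi_tangent[OF tX]] by simp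
  qed
  \<comment> \<open>As \<beta>(W) is constant, its derivative along X drops out of the invariant
    formula.\<close>
  have "W (\<pi> p) (\<lambda>b. \<beta> b [X b]) - \<beta> (\<pi> p) [lie_bracket AB W X (\<pi> p)] = 0"
    using dbeta_W[OF X] by (simp add: ext_deriv1_def beta_W tangent_const[OF B tX])
  then have dW: "W (\<pi> p) (\<lambda>b. \<beta> b [X b]) = \<beta> (\<pi> p) [lie_bracket AB W X (\<pi> p)]" by simp
  note tWX = lie_bracket_tangent[OF B W_near X]
  show "push p N = - s *\<^sub>R contact_tensor3 AB W \<psi> X (\<pi> p)"
    unfolding N_def push_nijenhuis_lifted[OF s nxi nX] b11 b10 b01 b00 a10 a01 contact_tensor3_def
    by (simp add: endomorphism_zero[OF psi_field] endomorphism_uminus[OF psi_field tangent_space_scaleR[OF tWX]]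
        endomorphism_scaleR[OF psi_field tWX] algebra_simps)
  show "\<alpha> p [N] = 0"
    unfolding N_def alpha_nijenhuis_lifted[OF s nxi nX] a11 a00 b10 b01 dW form1_scaleR[OF beta_form tWX]
    using s by (simp add: form1_zero[OF beta_form] mult.assoc[symmetric])
qed

text \<open>In one direction the tensor is evaluated on lifts, and surjectivity of \<pi> reaches
  every point of the base. In the other, a vector is a lift plus a multiple of \<xi>, and
  bilinearity reduces to pairs of lifts, mixed pairs and the pair of \<xi> with itself.\<close>

theorem integrable_lifted_acs_iff:
  assumes s: "s * s = 1"
  shows "integrable_acs AM (lifted_acs s) \<longleftrightarrow> contact_tensors_vanish AB \<beta> W \<psi>"
proof
  assume I: "integrable_acs AM (lifted_acs s)"
  have s0: "s \<noteq> 0" using s by auto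
  show "contact_tensors_vanish AB \<beta> W \<psi>"
    unfolding contact_tensors_vanish_def
  proof (intro allI impI)
    fix b X Y assume XY: "vfield_near AB b X" "vfield_near AB b Y"
    obtain p where p: "b = \<pi> p" using pi_surj by blast
    note X = XY(1)[unfolded p] and Y = XY(2)[unfolded p]
    have "nijenhuis AM (lifted_acs s) (\<lambda>q. hlift q (X (\<pi> q))) (\<lambda>q. hlift q (Y (\<pi> q))) p = 0"
      "nijenhuis AM (lifted_acs s) \<xi> (\<lambda>q. hlift q (X (\<pi> q))) p = 0"
      using I hlift_near[OF X] hlift_near[OF Y] xi_near unfolding integrable_acs_iff_near by blast+
    then show "contact_tensor1 AB \<beta> W \<psi> X Y b = 0 \<and> contact_tensor2 AB \<beta> \<psi> X Y b = 0 \<and> contact_tensor3 AB W \<psi> X b = 0"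
      using nijenhuis_lifted_horizontal[OF s X Y] nijenhuis_lifted_vertical(1)[OF s X] s0
      unfolding p by (simp add: push_forward_zero form1_zero[OF alpha_form])
  qed
next
  assume C: "contact_tensors_vanish AB \<beta> W \<psi>"
  let ?E = "lifted_acs s"
  note E = lifted_acs_endomorphism
  show "integrable_acs AM ?E"
    unfolding integrable_acs_iff_near
  proof (intro allI impI)
    fix p V V' assume V: "vfield_near AM p V" and V': "vfield_near AM p V'"
    have hh: "nijenhuis AM ?E (\<lambda>q. hlift q (X (\<pi> q))) (\<lambda>q. hlift q (Y (\<pi> q))) p = 0"
      if X: "vfield_near AB (\<pi> p) X" and Y: "vfield_near AB (\<pi> p) Y" for X Y
      using C nijenhuis_lifted_horizontal[OF s X Y] X Y unfolding contact_tensors_vanish_def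
      by (intro tangent_zeroI[OF nijenhuis_lifted_tangent[OF s hlift_near[OF X] hlift_near[OF Y]]]) simp_all
    have vh: "nijenhuis AM ?E \<xi> (\<lambda>q. hlift q (X (\<pi> q))) p = 0"
      if X: "vfield_near AB (\<pi> p) X" for X
      using C nijenhuis_lifted_vertical[OF s X] X unfolding contact_tensors_vanish_def
      by (intro tangent_zeroI[OF nijenhuis_lifted_tangent[OF s xi_near hlift_near[OF X]]]) simp_all
    note hv = nijenhuis_antisym[OF M E hlift_near xi_near]
    have ext: "\<exists>X. vfield_near AB (\<pi> p) X \<and> v = hlift p (X (\<pi> p)) + \<alpha> p [v] *\<^sub>R \<xi> p"
      if v: "v \<in> tangent_space AM p" for v
    proof -
      obtain X where "vfield_near AB (\<pi> p) X" "X (\<pi> p) = push p v"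
        using vfield_near_extension[OF B push_tangent[OF v]] .
      then show ?thesis using tangent_decomposition[OF v] by auto
    qed
    obtain X where X: "vfield_near AB (\<pi> p) X" "V p = hlift p (X (\<pi> p)) + \<alpha> p [V p] *\<^sub>R \<xi> p"
      using ext[OF vfield_near_tangent[OF V]] by blast
    obtain Y where Y: "vfield_near AB (\<pi> p) Y" "V' p = hlift p (Y (\<pi> p)) + \<alpha> p [V' p] *\<^sub>R \<xi> p"
      using ext[OF vfield_near_tangent[OF V']] by blast
    \<comment> \<open>Tensoriality only asks for agreement at \<open>p\<close>, so the vertical
      coefficients may be frozen to constants.\<close>
    define c d where "c = \<alpha> p [V p]" and "d = \<alpha> p [V' p]"
    note hX = hlift_near[OF X(1)] and hY = hlift_near[OF Y(1)]
    note cxi = vfield_near_cmult[OF M xi_near, of p c] and dxi = vfield_near_cmult[OF M xi_near, of p d]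
    note sY = vfield_near_add[OF M hY dxi]
    have "nijenhuis AM ?E V V' p =
        nijenhuis AM ?E (\<lambda>q. hlift q (X (\<pi> q)) + c *\<^sub>R \<xi> q) (\<lambda>q. hlift q (Y (\<pi> q)) + d *\<^sub>R \<xi> q) p"
      by (rule nijenhuis_tensorial[OF M E V vfield_near_add[OF M hX cxi] _ V' sY])
         (simp_all add: X(2)[folded c_def] Y(2)[folded d_def])
    also have "\<dots> = nijenhuis AM ?E (\<lambda>q. hlift q (X (\<pi> q))) (\<lambda>q. hlift q (Y (\<pi> q)) + d *\<^sub>R \<xi> q) p
        + c *\<^sub>R nijenhuis AM ?E \<xi> (\<lambda>q. hlift q (Y (\<pi> q)) + d *\<^sub>R \<xi> q) p"
      by (simp only: nijenhuis_add_left[OF M E hX cxi sY] nijenhuis_cmult_left[OF M E xi_near sY])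
    also have "\<dots> = 0"
      unfolding nijenhuis_add_right[OF M E hX hY dxi] nijenhuis_add_right[OF M E xi_near hY dxi]
        hh[OF X(1) Y(1)] vh[OF Y(1)]
        nijenhuis_antisym[OF M E hX dxi] nijenhuis_cmult_left[OF M E xi_near hX] vh[OF X(1)]
        nijenhuis_antisym[OF M E xi_near dxi] nijenhuis_cmult_left[OF M E xi_near xi_near]
        nijenhuis_self[OF M E xi_near] by simp
    finally show "nijenhuis AM ?E V V' p = 0" .
  qed
qed

end

section \<open>Exterior products\<close>

text \<open>Every argument list in the sum over permutations has its entries in \<open>vs\<close>.
  Agreement on such lists suffices, and this is all that is known: the forms are related only on
  tangent vectors. It is applied with the projection as \<open>F\<close>.\<close>

lemma wedge_transfer:
  assumes "length vs = p + q"
    and "\<And>us. length us = p \<Longrightarrow> set us \<subseteq> set vs \<Longrightarrow> \<omega> x us = \<omega>' y (map F us)"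
    and "\<And>us. length us = q \<Longrightarrow> set us \<subseteq> set vs \<Longrightarrow> \<tau> x us = \<tau>' y (map F us)"
  shows "wedge p q \<omega> \<tau> x vs = wedge p q \<omega>' \<tau>' y (map F vs)"
proof -
  have "\<omega> x (map (\<lambda>i. vs ! \<sigma> i) [0..<p]) = \<omega>' y (map (\<lambda>i. map F vs ! \<sigma> i) [0..<p])"
    "\<tau> x (map (\<lambda>i. vs ! \<sigma> i) [p..<p + q]) = \<tau>' y (map (\<lambda>i. map F vs ! \<sigma> i) [p..<p + q])"
    if "\<sigma> permutes {..<p + q}" for \<sigma>
  proof -
    have b: "\<sigma> i < length vs" if "i < p + q" for i
      using permutes_in_image[OF \<open>\<sigma> permutes {..<p + q}\<close>] that assms(1) by simp
    have 1: "set (map (\<lambda>i. vs ! \<sigma> i) [0..<p]) \<subseteq> set vs" "set (map (\<lambda>i. vs ! \<sigma> i) [p..<p + q]) \<subseteq> set vs"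
      using b by auto
    have 2: "map F (map (\<lambda>i. vs ! \<sigma> i) [0..<p]) = map (\<lambda>i. map F vs ! \<sigma> i) [0..<p]"
      "map F (map (\<lambda>i. vs ! \<sigma> i) [p..<p + q]) = map (\<lambda>i. map F vs ! \<sigma> i) [p..<p + q]"
      using b by auto
    show "\<omega> x (map (\<lambda>i. vs ! \<sigma> i) [0..<p]) = \<omega>' y (map (\<lambda>i. map F vs ! \<sigma> i) [0..<p])"
      unfolding 2(1)[symmetric] by (rule assms(2)[OF _ 1(1)]) simp
    show "\<tau> x (map (\<lambda>i. vs ! \<sigma> i) [p..<p + q]) = \<tau>' y (map (\<lambda>i. map F vs ! \<sigma> i) [p..<p + q])"
      unfolding 2(2)[symmetric] by (rule assms(3)[OF _ 1(2)]) simp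
  qed
  then show ?thesis unfolding wedge_def by (intro arg_cong2[where f = "(/)"] sum.cong refl) simp
qed

lemma wedge_power_transfer:
  assumes "length vs = 2 * n"
    and "\<And>us. length us = 2 \<Longrightarrow> set us \<subseteq> set vs \<Longrightarrow> \<omega> x us = \<omega>' y (map F us)"
  shows "wedge_power \<omega> n x vs = wedge_power \<omega>' n y (map F vs)"
  using assms
proof (induction n arbitrary: vs)
  case (Suc n)
  have "wedge 2 (2 * n) \<omega> (wedge_power \<omega> n) x vs = wedge 2 (2 * n) \<omega>' (wedge_power \<omega>' n) y (map F vs)"
  proof (rule wedge_transfer)
    fix us assume us: "length us = 2 * n" "set us \<subseteq> set vs"
    show "wedge_power \<omega> n x us = wedge_power \<omega>' n y (map F us)"
      by (rule Suc.IH[OF us(1)]) (use us(2) Suc.prems(2) in blast)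
  qed (use Suc.prems in simp_all)
  then show ?case by simp
qed simp

text \<open>Antisymmetry is built into the sum over all permutations, for arbitrary factors: left
  composition with \<rho> permutes the summands and changes each sign by the sign of \<rho>.\<close>

lemma wedge_permute:
  assumes \<rho>: "\<rho> permutes {..<p + q}"
  shows "wedge p q \<omega> \<tau> x (map (\<lambda>i. vs ! \<rho> i) [0..<p + q]) = of_int (sign \<rho>) * wedge p q \<omega> \<tau> x vs"
proof -
  define f where "f \<sigma> = of_int (sign \<sigma>) * \<omega> x (map (\<lambda>i. vs ! \<sigma> i) [0..<p]) * \<tau> x (map (\<lambda>i. vs ! \<sigma> i) [p..<p + q])" for \<sigma>
  let ?ws = "map (\<lambda>i. vs ! \<rho> i) [0..<p + q]"
  have pr: "permutation \<rho>" using permutes_imp_permutation[OF _ \<rho>] by simp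
  have "of_int (sign \<sigma>) * \<omega> x (map (\<lambda>i. ?ws ! \<sigma> i) [0..<p]) * \<tau> x (map (\<lambda>i. ?ws ! \<sigma> i) [p..<p + q])
      = of_int (sign \<rho>) * f (\<rho> \<circ> \<sigma>)" if \<sigma>: "\<sigma> permutes {..<p + q}" for \<sigma>
  proof -
    have "\<sigma> i < p + q" if "i < p + q" for i using permutes_in_image[OF \<sigma>] that by simp
    then have "map (\<lambda>i. ?ws ! \<sigma> i) [0..<p] = map (\<lambda>i. vs ! (\<rho> \<circ> \<sigma>) i) [0..<p]"
      "map (\<lambda>i. ?ws ! \<sigma> i) [p..<p + q] = map (\<lambda>i. vs ! (\<rho> \<circ> \<sigma>) i) [p..<p + q]"
      by (auto simp del: upt_Suc)
    moreover have "sign (\<rho> \<circ> \<sigma>) = sign \<rho> * sign \<sigma>"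
      using permutes_imp_permutation[OF _ \<sigma>] by (intro sign_compose pr) simp
    moreover have "real_of_int (sign \<rho>) * real_of_int (sign \<rho> * sign \<sigma>) = real_of_int (sign \<sigma>)"
      by (simp flip: of_int_mult)
    ultimately show ?thesis unfolding f_def by (metis (no_types, lifting) mult.assoc)
  qed
  then have "(\<Sum>\<sigma> | \<sigma> permutes {..<p + q}. of_int (sign \<sigma>) * \<omega> x (map (\<lambda>i. ?ws ! \<sigma> i) [0..<p])
      * \<tau> x (map (\<lambda>i. ?ws ! \<sigma> i) [p..<p + q])) = (\<Sum>\<sigma> | \<sigma> permutes {..<p + q}. of_int (sign \<rho>) * f (\<rho> \<circ> \<sigma>))"
    by (intro sum.cong refl) simp
  also have "\<dots> = of_int (sign \<rho>) * (\<Sum>\<sigma> | \<sigma> permutes {..<p + q}. f \<sigma>)"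
    unfolding setum_permutations_compose_left[OF \<rho>, of f] by (simp only: sum_distrib_left)
  finally show ?thesis unfolding wedge_def f_def by simp
qed

text \<open>As \<alpha> kills the tail, only permutations fixing 0 contribute. By antisymmetry of
  \<open>R\<close> they contribute equally, and their number \<open>fact n\<close> cancels the
  normalisation.\<close>

lemma wedge_1_Cons:
  assumes len: "length us = n" and \<alpha>: "\<And>u. u \<in> set us \<Longrightarrow> \<alpha> x [u] = 0"
    and R: "\<And>\<rho>. \<rho> permutes {..<n} \<Longrightarrow> R x (map (\<lambda>i. us ! \<rho> i) [0..<n]) = of_int (sign \<rho>) * R x us"
  shows "wedge 1 n \<alpha> R x (v # us) = \<alpha> x [v] * R x us"
proof -
  let ?vs = "v # us"
  let ?f = "\<lambda>\<sigma>. of_int (sign \<sigma>) * \<alpha> x (map (\<lambda>i. ?vs ! \<sigma> i) [0..<1]) * R x (map (\<lambda>i. ?vs ! \<sigma> i) [1..<1 + n])"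
  have sub: "{\<sigma>. \<sigma> permutes {1..<1 + n}} \<subseteq> {\<sigma>. \<sigma> permutes {..<1 + n}}"
    by (rule Collect_mono, rule impI, erule permutes_subset) auto
  have zero: "?f \<sigma> = 0" if "\<sigma> \<in> {\<sigma>. \<sigma> permutes {..<1 + n}} - {\<sigma>. \<sigma> permutes {1..<1 + n}}" for \<sigma>
  proof -
    have s: "\<sigma> permutes {..<1 + n}" and ns: "\<not> \<sigma> permutes {1..<1 + n}" using that by auto
    have "\<sigma> 0 \<noteq> 0"
    proof
      assume z: "\<sigma> 0 = 0"
      have "\<sigma> permutes {1..<1 + n}"
      proof (rule permutes_superset[OF s])
        fix i assume "i \<in> {..<1 + n} - {1..<1 + n}"
        then have "i = 0" by auto
        with z show "\<sigma> i = i" by simp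
      qed
      with ns show False ..
    qed
    moreover have "\<sigma> 0 < 1 + n" using permutes_in_image[OF s, of 0] by simp
    ultimately have "?vs ! \<sigma> 0 \<in> set us" using len by (cases "\<sigma> 0") simp_all
    then show ?thesis using \<alpha> by simp
  qed
  have one: "?f \<sigma> = \<alpha> x [v] * R x us" if "\<sigma> permutes {1..<1 + n}" for \<sigma>
  proof -
    \<comment> \<open>Conjugation by the shift \<open>i - 1\<close> turns \<sigma>, which fixes 0,
      into a permutation of the indices of \<open>us\<close> with the same sign.\<close>
    define \<rho> where "\<rho> = map_permutation {1..<1 + n} (\<lambda>i. i - 1) \<sigma>"
    have b: "bij_betw (\<lambda>i::nat. i - 1) {1..<1 + n} {..<n}"
      by (rule bij_betw_byWitness[where f' = Suc]) auto
    have \<rho>: "\<rho> permutes {..<n}" unfolding \<rho>_def by (rule map_permutation_permutes[OF b that])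
    have sg: "sign \<rho> = sign \<sigma>" unfolding \<rho>_def
      by (rule sign_map_permutation) (use that b in \<open>auto simp: bij_betw_def\<close>)
    have "?vs ! \<sigma> (1 + i) = us ! \<rho> i" if i: "i < n" for i
    proof -
      have "\<rho> ((1 + i) - 1) = \<sigma> (1 + i) - 1" unfolding \<rho>_def
        by (rule map_permutation_apply) (use b i in \<open>auto simp: bij_betw_def\<close>)
      moreover have "\<sigma> (1 + i) \<ge> 1" using permutes_in_image[OF \<open>\<sigma> permutes {1..<1 + n}\<close>, of "1 + i"] i by simp
      ultimately show ?thesis by (simp add: nth_Cons')
    qed
    then have "map (\<lambda>i. ?vs ! \<sigma> i) [1..<1 + n] = map (\<lambda>i. us ! \<rho> i) [0..<n]"
      by (intro nth_equalityI) (simp_all del: upt_Suc)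
    moreover have "\<sigma> 0 = 0" using permutes_not_in[OF that, of 0] by simp
    moreover have "real_of_int (sign \<sigma>) * real_of_int (sign \<sigma>) = 1" by (simp flip: of_int_mult)
    ultimately show ?thesis using R[OF \<rho>] sg by simp
  qed
  have "(\<Sum>\<sigma> | \<sigma> permutes {..<1 + n}. ?f \<sigma>) = (\<Sum>\<sigma> | \<sigma> permutes {1..<1 + n}. ?f \<sigma>)"
    by (rule sum.mono_neutral_right[OF finite_permutations[OF finite_lessThan] sub]) (use zero in blast)
  also have "\<dots> = (\<Sum>\<sigma> | \<sigma> permutes {1..<1 + n}. \<alpha> x [v] * R x us)"
    by (rule sum.cong) (use one in blast)+
  also have "\<dots> = fact n * (\<alpha> x [v] * R x us)"
    by (simp add: card_permutations[where n = n])
  finally show ?thesis unfolding wedge_def by simp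
qed

section \<open>Reordering triple products\<close>

text \<open>The triple product without normalising factorials, a common reference for nested
  products whose factors come in different orders.\<close>

definition wedge3 :: "nat \<Rightarrow> nat \<Rightarrow> nat \<Rightarrow> 'm dform \<Rightarrow> 'm dform \<Rightarrow> 'm dform \<Rightarrow> 'm dform" where
  "wedge3 p q r \<omega> \<tau> \<upsilon> x vs =
     (\<Sum>\<sigma> | \<sigma> permutes {..<p + (q + r)}. of_int (sign \<sigma>) * (\<omega> x (map (\<lambda>i. vs ! \<sigma> i) [0..<p])
        * \<tau> x (map (\<lambda>i. vs ! \<sigma> i) [p..<p + q]) * \<upsilon> x (map (\<lambda>i. vs ! \<sigma> i) [p + q..<p + (q + r)])))"

text \<open>A permutation \<rho> of the inner product, shifted by \<open>p\<close>, is absorbed into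
  the outer one by right composition. Each \<rho> therefore contributes the same sum, and their
  number \<open>fact (q + r)\<close> cancels the outer factorial.\<close>

lemma wedge_wedge:
  "wedge p (q + r) \<omega> (wedge q r \<tau> \<upsilon>) x vs = wedge3 p q r \<omega> \<tau> \<upsilon> x vs / (fact p * fact q * fact r)"
proof -
  define S where "S = {\<sigma>. \<sigma> permutes {..<p + (q + r)}}"
  define g where "g \<sigma> = \<omega> x (map (\<lambda>i. vs ! \<sigma> i) [0..<p])
        * \<tau> x (map (\<lambda>i. vs ! \<sigma> i) [p..<p + q]) * \<upsilon> x (map (\<lambda>i. vs ! \<sigma> i) [p + q..<p + (q + r)])" for \<sigma>
  define sh where "sh = map_permutation {..<q + r} ((+) p)"
  have b: "bij_betw ((+) p) {..<q + r} {p..<p + (q + r)}"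
    by (rule bij_betw_byWitness[where f' = "\<lambda>i. i - p"]) auto
  have inner: "of_int (sign \<sigma>) * \<omega> x (map (\<lambda>i. vs ! \<sigma> i) [0..<p])
      * wedge q r \<tau> \<upsilon> x (map (\<lambda>i. vs ! \<sigma> i) [p..<p + (q + r)]) =
      (\<Sum>\<rho> | \<rho> permutes {..<q + r}. of_int (sign (\<sigma> \<circ> sh \<rho>)) * g (\<sigma> \<circ> sh \<rho>)) / (fact q * fact r)"
    if \<sigma>: "\<sigma> permutes {..<p + (q + r)}" for \<sigma>
  proof -
    let ?ws = "map (\<lambda>i. vs ! \<sigma> i) [p..<p + (q + r)]"
    have "of_int (sign \<sigma>) * \<omega> x (map (\<lambda>i. vs ! \<sigma> i) [0..<p]) *
        (of_int (sign \<rho>) * \<tau> x (map (\<lambda>i. ?ws ! \<rho> i) [0..<q]) * \<upsilon> x (map (\<lambda>i. ?ws ! \<rho> i) [q..<q + r]))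
        = of_int (sign (\<sigma> \<circ> sh \<rho>)) * g (\<sigma> \<circ> sh \<rho>)"
      if \<rho>: "\<rho> permutes {..<q + r}" for \<rho>
    proof -
      have sh1: "sh \<rho> permutes {p..<p + (q + r)}" unfolding sh_def by (rule map_permutation_permutes[OF b \<rho>])
      then have sh2: "sh \<rho> permutes {..<p + (q + r)}" by (rule permutes_subset) auto
      have shp: "sh \<rho> (p + i) = p + \<rho> i" if "i < q + r" for i
        unfolding sh_def by (rule map_permutation_apply) (use that in auto)
      have sh0: "sh \<rho> i = i" if "i < p" for i using permutes_not_in[OF sh1, of i] that by simp
      have \<rho>b: "\<rho> i < q + r" if "i < q + r" for i using permutes_in_image[OF \<rho>, of i] that by simp
      have "sign (sh \<rho>) = sign \<rho>" unfolding sh_def by (rule sign_map_permutation) (use \<rho> in auto)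
      then have sg: "sign (\<sigma> \<circ> sh \<rho>) = sign \<sigma> * sign \<rho>"
        using sign_compose[OF permutes_imp_permutation[OF _ \<sigma>] permutes_imp_permutation[OF _ sh2]] by simp
      have m1: "map (\<lambda>i. vs ! (\<sigma> \<circ> sh \<rho>) i) [0..<p] = map (\<lambda>i. vs ! \<sigma> i) [0..<p]" using sh0 by simp
      have m2: "map (\<lambda>i. vs ! (\<sigma> \<circ> sh \<rho>) i) [p..<p + q] = map (\<lambda>i. ?ws ! \<rho> i) [0..<q]"
        by (intro nth_equalityI) (simp_all add: shp \<rho>b del: upt_Suc)
      have m3: "map (\<lambda>i. vs ! (\<sigma> \<circ> sh \<rho>) i) [p + q..<p + (q + r)] = map (\<lambda>i. ?ws ! \<rho> i) [q..<q + r]"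
        by (intro nth_equalityI) (simp_all add: shp \<rho>b add.assoc del: upt_Suc)
      show ?thesis unfolding g_def sg m1 m2 m3 by simp
    qed
    then show ?thesis
      unfolding wedge_def by (simp add: sum_distrib_left sum_divide_distrib mult.assoc)
  qed
  have outer: "(\<Sum>\<sigma>\<in>S. of_int (sign (\<sigma> \<circ> sh \<rho>)) * g (\<sigma> \<circ> sh \<rho>)) = wedge3 p q r \<omega> \<tau> \<upsilon> x vs"
    if \<rho>: "\<rho> permutes {..<q + r}" for \<rho>
  proof -
    have "sh \<rho> permutes {p..<p + (q + r)}" unfolding sh_def by (rule map_permutation_permutes[OF b \<rho>])
    then have "sh \<rho> permutes {..<p + (q + r)}" by (rule permutes_subset) auto
    from sum_permutations_compose_right[OF this, of "\<lambda>\<sigma>. of_int (sign \<sigma>) * g \<sigma>"]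
    show ?thesis unfolding S_def wedge3_def g_def by simp
  qed
  have "wedge p (q + r) \<omega> (wedge q r \<tau> \<upsilon>) x vs =
      (\<Sum>\<sigma>\<in>S. (\<Sum>\<rho> | \<rho> permutes {..<q + r}. of_int (sign (\<sigma> \<circ> sh \<rho>)) * g (\<sigma> \<circ> sh \<rho>)) / (fact q * fact r))
      / (fact p * fact (q + r))"
    unfolding wedge_def[of p] S_def by (intro arg_cong2[where f = "(/)"] sum.cong refl) (use inner in simp)
  also have "\<dots> = (\<Sum>\<rho> | \<rho> permutes {..<q + r}. \<Sum>\<sigma>\<in>S. of_int (sign (\<sigma> \<circ> sh \<rho>)) * g (\<sigma> \<circ> sh \<rho>))
      / (fact q * fact r) / (fact p * fact (q + r))"
    unfolding sum_divide_distrib[symmetric] by (subst sum.swap) (rule refl)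
  also have "\<dots> = (\<Sum>\<rho> | \<rho> permutes {..<q + r}. wedge3 p q r \<omega> \<tau> \<upsilon> x vs) / (fact q * fact r) / (fact p * fact (q + r))"
    using outer by simp
  also have "\<dots> = wedge3 p q r \<omega> \<tau> \<upsilon> x vs / (fact p * fact q * fact r)"
    by (simp add: card_permutations[where n = "q + r"] field_simps)
  finally show ?thesis .
qed

text \<open>Right composition with a cyclic shift of the blocks. Its sign is left undetermined,
  since only non-vanishing will matter.\<close>

lemma wedge3_rotate:
  "\<exists>\<epsilon>\<in>{1, -1}. wedge3 r p q \<upsilon> \<omega> \<tau> x vs = \<epsilon> * wedge3 p q r \<omega> \<tau> \<upsilon> x vs"
proof -
  define n where "n = p + (q + r)"
  \<comment> \<open>The first \<open>r\<close> positions go to the last block, the others move down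
    by \<open>r\<close>; beyond \<open>n\<close> it is the identity, as \<open>permutes\<close>
    demands.\<close>
  define c where "c i = (if i < r then i + (p + q) else if i < n then i - r else i)" for i
  have "inj_on c {..<n}" unfolding c_def inj_on_def n_def by auto
  moreover have "c ` {..<n} \<subseteq> {..<n}" unfolding c_def n_def by auto
  ultimately have "bij_betw c {..<n} {..<n}" by (simp add: bij_betw_def endo_inj_surj)
  then have c: "c permutes {..<n}" by (rule bij_imp_permutes) (simp add: c_def n_def)
  define g where "g \<sigma> = of_int (sign \<sigma>) * (\<upsilon> x (map (\<lambda>i. vs ! \<sigma> i) [0..<r])
        * \<omega> x (map (\<lambda>i. vs ! \<sigma> i) [r..<r + p]) * \<tau> x (map (\<lambda>i. vs ! \<sigma> i) [r + p..<n]))" for \<sigma>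
  have n': "r + (p + q) = n" by (simp add: n_def)
  have gc: "g (\<sigma> \<circ> c) = of_int (sign c) * (of_int (sign \<sigma>) * (\<omega> x (map (\<lambda>i. vs ! \<sigma> i) [0..<p])
        * \<tau> x (map (\<lambda>i. vs ! \<sigma> i) [p..<p + q]) * \<upsilon> x (map (\<lambda>i. vs ! \<sigma> i) [p + q..<n])))"
    if \<sigma>: "\<sigma> permutes {..<n}" for \<sigma>
  proof -
    have m1: "map (\<lambda>i. vs ! (\<sigma> \<circ> c) i) [0..<r] = map (\<lambda>i. vs ! \<sigma> i) [p + q..<n]"
      by (intro nth_equalityI) (simp_all add: c_def n_def add.commute del: upt_Suc)
    have m2: "map (\<lambda>i. vs ! (\<sigma> \<circ> c) i) [r..<r + p] = map (\<lambda>i. vs ! \<sigma> i) [0..<p]"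
      by (intro nth_equalityI) (simp_all add: c_def n_def del: upt_Suc)
    have m3: "map (\<lambda>i. vs ! (\<sigma> \<circ> c) i) [r + p..<n] = map (\<lambda>i. vs ! \<sigma> i) [p..<p + q]"
      by (intro nth_equalityI) (simp_all add: c_def n_def add.assoc del: upt_Suc)
    have sg: "sign (\<sigma> \<circ> c) = sign \<sigma> * sign c"
      using sign_compose[OF permutes_imp_permutation[OF _ \<sigma>] permutes_imp_permutation[OF _ c]] by simp
    show ?thesis unfolding g_def m1 m2 m3 sg by (simp add: algebra_simps)
  qed
  have "wedge3 r p q \<upsilon> \<omega> \<tau> x vs = (\<Sum>\<sigma> | \<sigma> permutes {..<n}. g (\<sigma> \<circ> c))"
    unfolding wedge3_def n' g_def[symmetric] by (rule sum_permutations_compose_right[OF c])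
  also have "\<dots> = of_int (sign c) * wedge3 p q r \<omega> \<tau> \<upsilon> x vs"
    unfolding wedge3_def n_def[symmetric] sum_distrib_left by (rule sum.cong) (use gc in auto)
  finally have eq: "wedge3 r p q \<upsilon> \<omega> \<tau> x vs = of_int (sign c) * wedge3 p q r \<omega> \<tau> \<upsilon> x vs" .
  show ?thesis by (cases c rule: sign_cases) (use eq in auto)
qed

text \<open>Bridges two orders of factors: \<beta>, d\<beta>, \<eta> in
  \<open>contact_symplectic_pair\<close>, but \<eta>, \<beta>, d\<beta> after \<alpha>1 in the
  lifted contact pair.\<close>

lemma wedge_wedge_rotate_nonzero:
  assumes "wedge p (q + r) \<omega> (wedge q r \<tau> \<upsilon>) x vs \<noteq> 0"
  shows "wedge r (p + q) \<upsilon> (wedge p q \<omega> \<tau>) x vs \<noteq> 0"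
proof -
  have "wedge3 p q r \<omega> \<tau> \<upsilon> x vs \<noteq> 0" using assms unfolding wedge_wedge by simp
  then have "wedge3 r p q \<upsilon> \<omega> \<tau> x vs \<noteq> 0" using wedge3_rotate[of r p q \<upsilon> \<omega> \<tau> x vs] by auto
  then show ?thesis unfolding wedge_wedge by simp
qed

section \<open>Products with a line and local trivialisations\<close>

text \<open>In charts \<open>F\<close> becomes a continuous injection of a nonempty open set, so
  invariance of dimension applies. It is used in both directions between \<open>M\<close> and the
  product of \<open>B\<close> with a line.\<close>

lemma manifold_dimension_le:
  fixes A :: "('m::{t2_space,second_countable_topology}, 'e::euclidean_space) atlas"
    and A' :: "('n::{t2_space,second_countable_topology}, 'f::euclidean_space) atlas"
  assumes A: "smooth_manifold A" and A': "smooth_manifold A'"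
    and S: "open S" "p \<in> S" and F: "\<And>q. q \<in> S \<Longrightarrow> smooth_at A A' F q" and inj: "inj_on F S"
  shows "DIM('e) \<le> DIM('f)"
proof -
  obtain U \<phi> where c: "(U, \<phi>) \<in> A" "p \<in> U" using chart_exists[OF A] .
  obtain V \<zeta> where d: "(V, \<zeta>) \<in> A'" "F p \<in> V" using chart_exists[OF A'] .
  have "\<forall>\<^sub>F y in nhds (F p). y \<in> V" using chart_open[OF A' d(1)] d(2) by (simp add: eventually_nhds_in_open)
  then have "\<forall>\<^sub>F q in nhds p. F q \<in> V" by (rule smooth_at_compose_eventually[OF A A' F[OF S(2)]])
  then obtain N0 where N0: "open N0" "p \<in> N0" "\<And>q. q \<in> N0 \<Longrightarrow> F q \<in> V" unfolding eventually_nhds by blast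
  define N where "N = N0 \<inter> S \<inter> U"
  have N: "open N" "p \<in> N" "N \<subseteq> U" "N \<subseteq> S" "F ` N \<subseteq> V"
    using N0 S c chart_open[OF A c(1)] by (auto simp: N_def)
  let ?f = "\<lambda>x. \<zeta> (F (inv_into U \<phi> x))"
  have cF: "continuous_on N F"
    by (rule continuous_at_imp_continuous_on) (use F N(4) smooth_at_imp_isCont[OF A A'] in blast)
  have ci: "continuous_on (\<phi> ` N) (inv_into U \<phi>)"
    using chart_homeomorphism[OF A c(1)] N(3) by (auto simp: homeomorphism_def intro: continuous_on_subset)
  have cz: "continuous_on V \<zeta>" using chart_homeomorphism[OF A' d(1)] by (simp add: homeomorphism_def)
  have im: "inv_into U \<phi> ` \<phi> ` N = N"
  proof -
    have "inv_into U \<phi> ` \<phi> ` N = (\<lambda>q. q) ` N"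
      unfolding image_image by (rule image_cong[OF refl], rule chart_inv[OF A c(1)]) (use N(3) in blast)
    then show ?thesis by simp
  qed
  have "continuous_on (\<phi> ` N) ?f"
    by (rule continuous_on_compose2[OF cz continuous_on_compose2[OF cF ci]])
       (simp_all only: im order_refl, use im N(5) in blast)
  moreover have "inj_on ?f (\<phi> ` N)"
  proof (rule inj_onI)
    fix x y assume xy: "x \<in> \<phi> ` N" "y \<in> \<phi> ` N" "?f x = ?f y"
    let ?x = "inv_into U \<phi> x" and ?y = "inv_into U \<phi> y"
    have n: "?x \<in> N" "?y \<in> N" using xy(1,2) im by blast+
    have "F ?x \<in> V" "F ?y \<in> V" using n N(5) by blast+
    from chart_inv[OF A' d(1) this(1)] chart_inv[OF A' d(1) this(2)]
    have "F ?x = F ?y" unfolding xy(3) by (rule trans[OF sym])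
    then have e: "?x = ?y" using inj_onD[OF inj] n N(4) by blast
    have "x = \<phi> ?x" by (rule f_inv_into_f[symmetric]) (use xy(1) N(3) in blast)
    also have "\<dots> = \<phi> ?y" by (simp only: e)
    also have "\<dots> = y" by (rule f_inv_into_f) (use xy(2) N(3) in blast)
    finally show "x = y" .
  qed
  ultimately show ?thesis
    using invariance_of_dimension[of "\<phi> ` N" ?f] chart_image_open_subset[OF A c(1) N(1,3)] N(2) by blast
qed

section \<open>The product of a manifold with the real line\<close>

abbreviation line_product ::
    "('b::topological_space, 'e::euclidean_space) atlas \<Rightarrow> ('b \<times> real, 'e \<times> real) atlas"
  where "line_product A \<equiv> prod_atlas A std_atlas"

lemma sum_Basis_prod_real:
  fixes f :: "'a::euclidean_space \<times> real \<Rightarrow> 'b::comm_monoid_add"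
  shows "(\<Sum>i\<in>Basis. f i) = (\<Sum>e\<in>Basis. f (e, 0)) + f (0, 1)"
  unfolding Basis_prod_def
  by (subst sum.union_disjoint) (auto simp: sum.reindex inj_on_def)

text \<open>The field d/dt, given as a velocity to match its use in \<open>cone_acs\<close>.\<close>

definition line_vector :: "('b::topological_space, 'e::euclidean_space) atlas \<Rightarrow> ('b \<times> real) vfield"
  where "line_vector A z = velocity (line_product A) (\<lambda>s. (fst z, s)) (snd z)"

text \<open>The coordinate field that lifts \<open>chart_vector A U \<phi> e\<close> and is tangent
  to the slices where the real coordinate is constant.\<close>

definition slice_vector ::
    "('b::topological_space, 'e::euclidean_space) atlas \<Rightarrow> 'b set \<Rightarrow> ('b \<Rightarrow> 'e) \<Rightarrow> 'e \<Rightarrow> ('b \<times> real) vfield"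
  where "slice_vector A U \<phi> e = chart_vector (line_product A) (U \<times> UNIV) (map_prod \<phi> (\<lambda>t. t)) (e, 0)"

context
  fixes A :: "('b::{t2_space,second_countable_topology}, 'e::euclidean_space) atlas"
  assumes A: "smooth_manifold A"
begin

lemma smooth_manifold_line_product: "smooth_manifold (line_product A)"
  by (rule smooth_manifold_prod[OF A smooth_manifold_std])

lemma line_product_fst: "smooth_at (line_product A) A fst z"
  by (rule smooth_at_fst[OF A smooth_manifold_std])

lemma line_product_snd: "smooth_fun_at (line_product A) snd z"
  by (rule smooth_at_snd[OF A smooth_manifold_std])

lemma push_fst_line_vector: "push_forward A fst z (line_vector A z) = 0"
proof
  fix f :: "'b \<Rightarrow> real"
  have "deriv (f \<circ> fst \<circ> (\<lambda>s. (fst z, s))) (snd z) = 0" unfolding comp_def fst_conv deriv_const ..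
  then show "push_forward A fst z (line_vector A z) f = 0 f"
    by (simp add: push_forward_def line_vector_def velocity_def zero_fun_apply)
qed

context
  fixes U \<phi> assumes c: "(U, \<phi>) \<in> A"
begin

lemma line_chart: "(U \<times> UNIV, map_prod \<phi> (\<lambda>t. t)) \<in> line_product A"
  by (rule prod_chart[OF c std_chart])

lemma line_chart_inv:
  "x \<in> \<phi> ` U \<Longrightarrow> inv_into (U \<times> UNIV) (map_prod \<phi> (\<lambda>t. t)) (x, t::real) = (inv_into U \<phi> x, t)"
  using prod_chart_inv[OF A smooth_manifold_std c std_chart, of x t] by (simp add: inv_into_UNIV_ident)

text \<open>By the chain rule the velocity along the line is a coordinate vector; smoothness of d/dt
  is obtained from this.\<close>

lemma line_vector_eq:
  assumes z: "fst z \<in> U"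
  shows "line_vector A z = chart_vector (line_product A) (U \<times> UNIV) (map_prod \<phi> (\<lambda>t. t)) (0, 1) z"
proof
  fix f
  let ?inv = "inv_into (U \<times> UNIV) (map_prod \<phi> (\<lambda>t. t))"
  have zU: "z \<in> U \<times> UNIV" using z by (simp add: mem_Times_iff)
  have mz: "map_prod \<phi> (\<lambda>t. t) z = (\<phi> (fst z), snd z)" by (cases z) simp
  show "line_vector A z f = chart_vector (line_product A) (U \<times> UNIV) (map_prod \<phi> (\<lambda>t. t)) (0, 1) z f"
  proof (cases "smooth_fun_at (line_product A) f z")
    case True
    define D where "D = frechet_derivative (f \<circ> ?inv) (at (\<phi> (fst z), snd z))"
    have D: "(f \<circ> ?inv has_derivative D) (at (\<phi> (fst z), snd z))"
      using smooth_fun_at_differentiable[OF smooth_manifold_line_product line_chart zU True]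
      unfolding D_def mz frechet_derivative_works .
    have "((\<lambda>s. (\<phi> (fst z), s)) has_derivative (\<lambda>h. (0, h))) (at (snd z))"
      by (rule has_derivative_Pair[OF has_derivative_const has_derivative_ident])
    from has_derivative_compose[OF this D]
    have "((\<lambda>s. (f \<circ> ?inv) (\<phi> (fst z), s)) has_derivative (\<lambda>h. D (0, h))) (at (snd z))" .
    moreover have "(\<lambda>s. (f \<circ> ?inv) (\<phi> (fst z), s)) = f \<circ> (\<lambda>s. (fst z, s))"
      by (simp only: comp_def line_chart_inv[OF imageI[OF z]] chart_inv[OF A c z])
    moreover have "(\<lambda>h. D (0, h)) = (*) (D (0, 1))"
    proof
      fix h show "D (0, h) = D (0, 1) * h"
        using linear_cmul[OF has_derivative_linear[OF D], of h "(0, 1)"] by simp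
    qed
    ultimately have "((f \<circ> (\<lambda>s. (fst z, s))) has_field_derivative D (0, 1)) (at (snd z))"
      unfolding has_field_derivative_def by (simp only:)
    then have "deriv (f \<circ> (\<lambda>s. (fst z, s))) (snd z) = D (0, 1)" by (rule DERIV_imp_deriv)
    with True show ?thesis by (simp add: line_vector_def velocity_def chart_vector_def mz D_def)
  next
    case False
    then show ?thesis by (simp add: line_vector_def velocity_def chart_vector_def)
  qed
qed

lemma slice_vector_near: "fst z \<in> U \<Longrightarrow> vfield_near (line_product A) z (slice_vector A U \<phi> e)"
  unfolding slice_vector_def
  by (rule vfield_nearI[OF smooth_vfield_chart_vector[OF smooth_manifold_line_product line_chart]
        chart_open[OF smooth_manifold_line_product line_chart]])
     (simp add: mem_Times_iff)

lemma push_fst_slice_vector: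
  assumes z: "fst z \<in> U"
  shows "push_forward A fst z (slice_vector A U \<phi> e z) = chart_vector A U \<phi> e (fst z)"
proof (rule tangent_eqI)
  let ?inv = "inv_into (U \<times> UNIV) (map_prod \<phi> (\<lambda>t. t))"
  have zU: "z \<in> U \<times> UNIV" using z by (simp add: mem_Times_iff)
  have mz: "map_prod \<phi> (\<lambda>t. t) z = (\<phi> (fst z), snd z)" by (cases z) simp
  show "push_forward A fst z (slice_vector A U \<phi> e z) \<in> tangent_space A (fst z)"
    by (rule push_forward_tangent[OF smooth_manifold_line_product A line_product_fst
          vfield_near_tangent[OF slice_vector_near[OF z]]])
  show "chart_vector A U \<phi> e (fst z) \<in> tangent_space A (fst z)" by (rule chart_vector_in_tangent_space[OF A c z])
  fix f assume f: "smooth_fun_at A f (fst z)"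
  have ff: "smooth_fun_at (line_product A) (f \<circ> fst) z"
    using smooth_at_compose[OF smooth_manifold_line_product A smooth_manifold_std line_product_fst f]
    by (simp add: comp_def)
  define D where "D = frechet_derivative (f \<circ> inv_into U \<phi>) (at (\<phi> (fst z)))"
  have D: "(f \<circ> inv_into U \<phi> has_derivative D) (at (\<phi> (fst z)))"
    using smooth_fun_at_differentiable[OF A c z f] unfolding D_def frechet_derivative_works .
  have "((\<lambda>y. (f \<circ> inv_into U \<phi>) (fst y)) has_derivative (\<lambda>h. D (fst h))) (at (\<phi> (fst z), snd z))"
    by (rule has_derivative_compose[OF bounded_linear_imp_has_derivative[OF bounded_linear_fst]]) (simp only: fst_conv, rule D)
  then have "(f \<circ> fst \<circ> ?inv has_derivative (\<lambda>h. D (fst h))) (at (map_prod \<phi> (\<lambda>t. t) z))"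
    unfolding mz
    by (rule has_derivative_transform_within_open[of _ _ _ _ "\<phi> ` U \<times> UNIV"])
       (use z line_chart_inv in \<open>auto intro!: open_Times chart_image_open[OF A c]\<close>)
  from chart_vector_apply[OF smooth_manifold_line_product line_chart zU ff this, of "(e, 0)"]
  have "slice_vector A U \<phi> e z (f \<circ> fst) = D e" by (simp add: slice_vector_def)
  moreover have "chart_vector A U \<phi> e (fst z) f = D e" by (rule chart_vector_apply[OF A c z f D])
  ultimately show "push_forward A fst z (slice_vector A U \<phi> e z) f = chart_vector A U \<phi> e (fst z) f"
    using f by (simp add: push_forward_def)
qed

lemma line_product_expansion:
  assumes z: "fst z \<in> U" and w: "w \<in> tangent_space (line_product A) z"
  shows "w = (\<Sum>e\<in>Basis. w (\<lambda>q. \<phi> (fst q) \<bullet> e) *\<^sub>R slice_vector A U \<phi> e z) + w snd *\<^sub>R line_vector A z"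
proof -
  have zU: "z \<in> U \<times> UNIV" using z by (simp add: mem_Times_iff)
  have 1: "map_prod \<phi> (\<lambda>t. t) q \<bullet> (e, 0) = \<phi> (fst q) \<bullet> e" "map_prod \<phi> (\<lambda>t. t) q \<bullet> (0, 1) = snd q" for q e
    by (cases q; simp)+
  show ?thesis
    by (subst tangent_chart_expansion[OF smooth_manifold_line_product line_chart zU w])
       (simp add: sum_Basis_prod_real 1 slice_vector_def line_vector_eq[OF z])
qed

end

lemma line_vector_near: "vfield_near (line_product A) z (line_vector A)"
proof -
  obtain U \<phi> where c: "(U, \<phi>) \<in> A" "fst z \<in> U" using chart_exists[OF A] .
  have "vfield_near (line_product A) z (chart_vector (line_product A) (U \<times> UNIV) (map_prod \<phi> (\<lambda>t. t)) (0, 1))"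
    by (rule vfield_nearI[OF smooth_vfield_chart_vector[OF smooth_manifold_line_product line_chart[OF c(1)]]
          chart_open[OF smooth_manifold_line_product line_chart[OF c(1)]]]) (simp add: mem_Times_iff c(2))
  moreover have "\<forall>\<^sub>F q in nhds z. q \<in> U \<times> UNIV"
    using chart_open[OF A c(1)] c(2) by (intro eventually_nhds_in_open open_Times) (auto simp: mem_Times_iff)
  then have "\<forall>\<^sub>F q in nhds z. chart_vector (line_product A) (U \<times> UNIV) (map_prod \<phi> (\<lambda>t. t)) (0, 1) q = line_vector A q"
    by eventually_elim (simp add: line_vector_eq[OF c(1)] mem_Times_iff)
  ultimately show ?thesis by (rule vfield_near_cong[OF smooth_manifold_line_product])
qed

end

section \<open>Fibrations that are locally products with a line\<close>

text \<open>Locally a circle is a line, so the fibre coordinate \<tau> can be real-valued. \<Psi>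
  only has to invert (\<pi>, \<tau>) from one side near \<open>p\<close>; it may be periodic in the
  real variable.\<close>

locale line_fibration =
  fixes AB :: "('b::{t2_space,second_countable_topology}, 'e::euclidean_space) atlas"
    and AM :: "('m::{t2_space,second_countable_topology}, 'f::euclidean_space) atlas"
    and \<pi> :: "'m \<Rightarrow> 'b" and \<xi> :: "'m vfield"
  assumes B: "smooth_manifold AB" and M: "smooth_manifold AM" and pi_smooth: "smooth_at AM AB \<pi> p"
    and trivialisation: "\<exists>\<Psi> \<tau> N. open N \<and> p \<in> N \<and> (\<forall>q\<in>N. smooth_fun_at AM \<tau> q \<and>
      smooth_at (line_product AB) AM \<Psi> (\<pi> q, \<tau> q) \<and> \<Psi> (\<pi> q, \<tau> q) = q \<and>
      (\<forall>\<^sub>F z in nhds (\<pi> q, \<tau> q). \<pi> (\<Psi> z) = fst z) \<and>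
      \<xi> q = push_forward AM \<Psi> (\<pi> q, \<tau> q) (line_vector AB (\<pi> q, \<tau> q)))"
begin

context
  fixes p \<Psi> \<tau> N
  assumes N: "open N" "p \<in> N"
    and triv: "\<And>q. q \<in> N \<Longrightarrow> smooth_fun_at AM \<tau> q"
      "\<And>q. q \<in> N \<Longrightarrow> smooth_at (line_product AB) AM \<Psi> (\<pi> q, \<tau> q)"
      "\<And>q. q \<in> N \<Longrightarrow> \<Psi> (\<pi> q, \<tau> q) = q"
      "\<And>q. q \<in> N \<Longrightarrow> \<forall>\<^sub>F z in nhds (\<pi> q, \<tau> q). \<pi> (\<Psi> z) = fst z"
      "\<And>q. q \<in> N \<Longrightarrow> \<xi> q = push_forward AM \<Psi> (\<pi> q, \<tau> q) (line_vector AB (\<pi> q, \<tau> q))"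
begin

lemma trivialisation_inverse_smooth:
  "q \<in> N \<Longrightarrow> smooth_at AM (line_product AB) (\<lambda>q. (\<pi> q, \<tau> q)) q"
  by (rule smooth_at_Pair[OF M B smooth_manifold_std pi_smooth triv(1)])

lemma trivialised_tangent:
  assumes q: "q \<in> N" and w: "w \<in> tangent_space (line_product AB) (\<pi> q, \<tau> q)"
  shows "push_forward AM \<Psi> (\<pi> q, \<tau> q) w \<in> tangent_space AM q"
  using push_forward_tangent[OF smooth_manifold_line_product[OF B] M triv(2)[OF q] w] triv(3)[OF q] by simp

text \<open>Applied to \<open>f\<close>, the field is the function \<open>Z\<close> applied to
  \<open>f \<circ> \<Psi>\<close>, evaluated at (\<pi> q, \<tau> q): a smooth function after a
  smooth map.\<close>

lemma trivialised_vfield_near: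
  assumes Z: "\<forall>\<^sub>F q in nhds p. vfield_near (line_product AB) (\<pi> q, \<tau> q) Z"
  shows "vfield_near AM p (\<lambda>q. push_forward AM \<Psi> (\<pi> q, \<tau> q) (Z (\<pi> q, \<tau> q)))"
proof -
  obtain N' where N': "open N'" "p \<in> N'" "\<And>q. q \<in> N' \<Longrightarrow> vfield_near (line_product AB) (\<pi> q, \<tau> q) Z"
    using Z unfolding eventually_nhds by blast
  note R = smooth_manifold_line_product[OF B]
  have "smooth_vfield_on AM (N \<inter> N') (\<lambda>q. push_forward AM \<Psi> (\<pi> q, \<tau> q) (Z (\<pi> q, \<tau> q)))"
  proof (rule smooth_vfieldI)
    fix q assume q: "q \<in> N \<inter> N'"
    note Zq = N'(3)[OF IntD2[OF q]] and qN = IntD1[OF q]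
    show "push_forward AM \<Psi> (\<pi> q, \<tau> q) (Z (\<pi> q, \<tau> q)) \<in> tangent_space AM q"
      by (rule trivialised_tangent[OF qN vfield_near_tangent[OF Zq]])
    fix f assume f: "smooth_fun_at AM f q"
    have "smooth_fun_at (line_product AB) (\<lambda>z. f (\<Psi> z)) (\<pi> q, \<tau> q)"
      by (rule smooth_at_compose[OF R M smooth_manifold_std triv(2)[OF qN]]) (simp add: triv(3)[OF qN] f)
    from smooth_at_compose[OF M R smooth_manifold_std trivialisation_inverse_smooth[OF qN] vfield_near_smooth[OF Zq this]]
    have s: "smooth_fun_at AM (\<lambda>r. Z (\<pi> r, \<tau> r) (\<lambda>z. f (\<Psi> z))) q" .
    have "\<forall>\<^sub>F r in nhds q. r \<in> N" using N(1) qN by (rule eventually_nhds_in_open)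
    with smooth_at_eventually[OF f]
    have "\<forall>\<^sub>F r in nhds q. Z (\<pi> r, \<tau> r) (\<lambda>z. f (\<Psi> z)) = push_forward AM \<Psi> (\<pi> r, \<tau> r) (Z (\<pi> r, \<tau> r)) f"
      by eventually_elim (simp add: push_forward_def triv(3) comp_def)
    then show "smooth_fun_at AM (\<lambda>q. push_forward AM \<Psi> (\<pi> q, \<tau> q) (Z (\<pi> q, \<tau> q)) f) q"
      by (rule smooth_at_cong_eventually[OF M s])
  qed
  then show ?thesis by (rule vfield_nearI[OF _ open_Int[OF N(1) N'(1)]]) (simp add: N(2) N'(2))
qed

lemma push_trivialised:
  assumes q: "q \<in> N" and w: "w \<in> tangent_space (line_product AB) (\<pi> q, \<tau> q)"
  shows "push_forward AB \<pi> q (push_forward AM \<Psi> (\<pi> q, \<tau> q) w) = push_forward AB fst (\<pi> q, \<tau> q) w"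
proof
  fix f
  note R = smooth_manifold_line_product[OF B]
  show "push_forward AB \<pi> q (push_forward AM \<Psi> (\<pi> q, \<tau> q) w) f = push_forward AB fst (\<pi> q, \<tau> q) w f"
  proof (cases "smooth_fun_at AB f (\<pi> q)")
    case True
    have "smooth_fun_at AM (\<lambda>r. f (\<pi> r)) q" by (rule smooth_at_compose[OF M B smooth_manifold_std pi_smooth True])
    moreover have "w (\<lambda>z. f (\<pi> (\<Psi> z))) = w (\<lambda>z. f (fst z))"
      by (rule tangent_germ_eventually[OF R w eventually_mono[OF triv(4)[OF q]]]) simp
    ultimately show ?thesis using True triv(3)[OF q] by (simp add: push_forward_def comp_def)
  next
    case False
    then show ?thesis by (simp add: push_forward_def)
  qed
qed

lemma tangent_via_trivialisation:
  assumes v: "v \<in> tangent_space AM p"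
  shows "v = push_forward AM \<Psi> (\<pi> p, \<tau> p) (push_forward (line_product AB) (\<lambda>q. (\<pi> q, \<tau> q)) p v)"
proof (rule tangent_eqI[OF v])
  note R = smooth_manifold_line_product[OF B]
  show "push_forward AM \<Psi> (\<pi> p, \<tau> p) (push_forward (line_product AB) (\<lambda>q. (\<pi> q, \<tau> q)) p v) \<in> tangent_space AM p"
    by (rule trivialised_tangent[OF N(2) push_forward_tangent[OF M R trivialisation_inverse_smooth[OF N(2)] v]])
  fix f assume f: "smooth_fun_at AM f p"
  have s: "smooth_fun_at (line_product AB) (\<lambda>z. f (\<Psi> z)) (\<pi> p, \<tau> p)"
    by (rule smooth_at_compose[OF R M smooth_manifold_std triv(2)[OF N(2)]]) (simp add: triv(3)[OF N(2)] f)
  have "v f = v (\<lambda>q. f (\<Psi> (\<pi> q, \<tau> q)))"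
    by (rule tangent_germ[OF M v N]) (simp add: triv(3))
  then show "v f = push_forward AM \<Psi> (\<pi> p, \<tau> p) (push_forward (line_product AB) (\<lambda>q. (\<pi> q, \<tau> q)) p v) f"
    using f s triv(3)[OF N(2)] by (simp add: push_forward_def comp_def)
qed

lemma trivialised_xi_near: "vfield_near AM p \<xi>"
proof (rule vfield_near_cong[OF M trivialised_vfield_near[of "line_vector AB"]])
  show "\<forall>\<^sub>F q in nhds p. vfield_near (line_product AB) (\<pi> q, \<tau> q) (line_vector AB)"
    by (simp add: line_vector_near[OF B])
  have "\<forall>\<^sub>F q in nhds p. q \<in> N" using N by (rule eventually_nhds_in_open)
  then show "\<forall>\<^sub>F q in nhds p. push_forward AM \<Psi> (\<pi> q, \<tau> q) (line_vector AB (\<pi> q, \<tau> q)) = \<xi> q"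
    by eventually_elim (simp add: triv(5))
qed

lemma trivialised_push_xi: "push_forward AB \<pi> p (\<xi> p) = 0"
  using push_trivialised[OF N(2) vfield_near_tangent[OF line_vector_near[OF B]]] push_fst_line_vector[OF B]
  by (simp add: triv(5)[OF N(2)])

text \<open>Transported to the product, a vector with zero projection has vanishing base
  coordinates, and its expansion reduces to the d/dt term.\<close>

lemma trivialised_vertical:
  assumes v: "v \<in> tangent_space AM p" and 0: "push_forward AB \<pi> p v = 0"
  shows "\<exists>c. v = c *\<^sub>R \<xi> p"
proof -
  note R = smooth_manifold_line_product[OF B]
  let ?w = "push_forward (line_product AB) (\<lambda>q. (\<pi> q, \<tau> q)) p v"
  have w: "?w \<in> tangent_space (line_product AB) (\<pi> p, \<tau> p)"
    by (rule push_forward_tangent[OF M R trivialisation_inverse_smooth[OF N(2)] v])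
  obtain U \<phi> where c: "(U, \<phi>) \<in> AB" "\<pi> p \<in> U" using chart_exists[OF B] .
  have "?w (\<lambda>q. \<phi> (fst q) \<bullet> e) = 0" for e
  proof -
    have s: "smooth_fun_at AB (\<lambda>b. \<phi> b \<bullet> e) (\<pi> p)" by (rule smooth_fun_at_coordinate[OF B c])
    have "v (\<lambda>q. \<phi> (\<pi> q) \<bullet> e) = push_forward AB \<pi> p v (\<lambda>b. \<phi> b \<bullet> e)" using s by (simp add: push_forward_def comp_def)
    then have "v (\<lambda>q. \<phi> (\<pi> q) \<bullet> e) = 0" by (simp add: 0 zero_fun_apply)
    then show ?thesis by (simp add: push_forward_def comp_def)
  qed
  then have "?w = ?w snd *\<^sub>R line_vector AB (\<pi> p, \<tau> p)"
    using line_product_expansion[OF B c(1) _ w] c(2) by simp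
  then have "v = push_forward AM \<Psi> (\<pi> p, \<tau> p) (?w snd *\<^sub>R line_vector AB (\<pi> p, \<tau> p))"
    using tangent_via_trivialisation[OF v] by metis
  then show ?thesis unfolding push_forward_scaleR triv(5)[OF N(2), symmetric] by blast
qed

lemma trivialised_local_lift:
  assumes c: "(U, \<phi>) \<in> AB" "\<pi> p \<in> U"
  shows "\<exists>Y. vfield_near AM p Y \<and> (\<forall>\<^sub>F q in nhds p. push_forward AB \<pi> q (Y q) = chart_vector AB U \<phi> e (\<pi> q))"
proof (intro exI conjI)
  have "\<forall>\<^sub>F b in nhds (\<pi> p). b \<in> U" using chart_open[OF B c(1)] c(2) by (rule eventually_nhds_in_open)
  from smooth_at_compose_eventually[OF M B pi_smooth this]
  have eU: "\<forall>\<^sub>F q in nhds p. \<pi> q \<in> U" .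
  then show "vfield_near AM p (\<lambda>q. push_forward AM \<Psi> (\<pi> q, \<tau> q) (slice_vector AB U \<phi> e (\<pi> q, \<tau> q)))"
    by (intro trivialised_vfield_near, elim eventually_mono) (rule slice_vector_near[OF B c(1)], simp)
  have "\<forall>\<^sub>F q in nhds p. q \<in> N" using N by (rule eventually_nhds_in_open)
  with eU show "\<forall>\<^sub>F q in nhds p. push_forward AB \<pi> q (push_forward AM \<Psi> (\<pi> q, \<tau> q) (slice_vector AB U \<phi> e (\<pi> q, \<tau> q)))
      = chart_vector AB U \<phi> e (\<pi> q)"
  proof eventually_elim
    case (elim q)
    then show ?case
      using push_trivialised[OF elim(2) vfield_near_tangent[OF slice_vector_near[OF B c(1)]]]
        push_fst_slice_vector[OF B c(1), of "(\<pi> q, \<tau> q)"] by simp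
  qed
qed

end

lemma connection_bundleI:
  assumes "surj \<pi>" "differential_form AM 1 \<alpha>" "\<And>p. \<alpha> p [\<xi> p] = 1"
    and "\<And>p X Y. vfield_near AM p X \<Longrightarrow> vfield_near AM p Y \<Longrightarrow>
      ext_deriv1 AM \<alpha> X Y p = \<eta> (\<pi> p) [push_forward AB \<pi> p (X p), push_forward AB \<pi> p (Y p)]"
  shows "connection_bundle AB AM \<pi> \<xi> \<alpha> \<eta>"
proof (unfold_locales; (rule B M pi_smooth assms; assumption?)?)
  fix p
  obtain \<Psi> \<tau> N where N: "open N" "p \<in> N" and *: "\<forall>q\<in>N. smooth_fun_at AM \<tau> q \<and>
      smooth_at (line_product AB) AM \<Psi> (\<pi> q, \<tau> q) \<and> \<Psi> (\<pi> q, \<tau> q) = q \<and>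
      (\<forall>\<^sub>F z in nhds (\<pi> q, \<tau> q). \<pi> (\<Psi> z) = fst z) \<and>
      \<xi> q = push_forward AM \<Psi> (\<pi> q, \<tau> q) (line_vector AB (\<pi> q, \<tau> q))"
    using trivialisation[of p] by (elim exE conjE) (rule that)
  have t: "smooth_fun_at AM \<tau> q" "smooth_at (line_product AB) AM \<Psi> (\<pi> q, \<tau> q)" "\<Psi> (\<pi> q, \<tau> q) = q"
    "\<forall>\<^sub>F z in nhds (\<pi> q, \<tau> q). \<pi> (\<Psi> z) = fst z"
    "\<xi> q = push_forward AM \<Psi> (\<pi> q, \<tau> q) (line_vector AB (\<pi> q, \<tau> q))" if "q \<in> N" for q
    using *[rule_format, OF that] by simp_all
  show "vfield_near AM p \<xi>" by (rule trivialised_xi_near[OF N t])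
  show "push_forward AB \<pi> p (\<xi> p) = 0" by (rule trivialised_push_xi[OF N t])
  show "\<exists>c. v = c *\<^sub>R \<xi> p" if "v \<in> tangent_space AM p" "push_forward AB \<pi> p v = 0" for v
    by (rule trivialised_vertical[OF N t that])
  show "\<exists>Y. vfield_near AM p Y \<and> (\<forall>\<^sub>F q in nhds p. push_forward AB \<pi> q (Y q) = chart_vector AB U \<phi> e (\<pi> q))"
    if "(U, \<phi>) \<in> AB" "\<pi> p \<in> U" for U \<phi> e
    by (rule trivialised_local_lift[OF N t that])
qed

end

lemma line_fibration_product:
  assumes B: "smooth_manifold AB"
  shows "line_fibration AB (line_product AB) fst (line_vector AB)"
proof
  note R = smooth_manifold_line_product[OF B]
  show "smooth_manifold AB" "smooth_manifold (line_product AB)" "smooth_at (line_product AB) AB fst p" for p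
    by (rule B R line_product_fst[OF B])+
  show "\<exists>\<Psi> \<tau> N. open N \<and> p \<in> N \<and> (\<forall>q\<in>N. smooth_fun_at (line_product AB) \<tau> q \<and>
      smooth_at (line_product AB) (line_product AB) \<Psi> (fst q, \<tau> q) \<and> \<Psi> (fst q, \<tau> q) = q \<and>
      (\<forall>\<^sub>F z in nhds (fst q, \<tau> q). fst (\<Psi> z) = fst z) \<and>
      line_vector AB q = push_forward (line_product AB) \<Psi> (fst q, \<tau> q) (line_vector AB (fst q, \<tau> q)))" for p
  proof (intro exI[of _ "\<lambda>z. z"] exI[of _ snd] exI[of _ UNIV] conjI ballI)
    fix q
    \<comment> \<open>Restricted to tangent vectors, because \<open>push_forward\<close> truncates
      values on functions that are not smooth at the point.\<close>
    have "push_forward (line_product AB) (\<lambda>z. z) q v = v" if "v \<in> tangent_space (line_product AB) q" for v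
      using tangent_not_smooth[OF that] by (auto simp: push_forward_def comp_def fun_eq_iff)
    from this[OF vfield_near_tangent[OF line_vector_near[OF B]]]
    show "line_vector AB q = push_forward (line_product AB) (\<lambda>z. z) (fst q, snd q) (line_vector AB (fst q, snd q))"
      by simp
  qed (simp_all add: line_product_snd[OF B] smooth_at_ident[OF R])
qed

section \<open>The lifted contact pair structure\<close>

lemma length2_conv: "length us = 2 \<longleftrightarrow> (\<exists>u v. us = [u, v])"
  by (auto simp: numeral_2_eq_2 length_Suc_conv)

context lifted_contact_structure
begin

lemma ext_deriv_alpha:
  assumes "u \<in> tangent_space AM p" "v \<in> tangent_space AM p"
  shows "ext_deriv AM 1 \<alpha> p [u, v] = \<eta> (\<pi> p) [push p u, push p v]"
proof -
  obtain X Y where X: "vfield_near AM p X" "X p = u" and Y: "vfield_near AM p Y" "Y p = v"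
    using vfield_near_extension[OF M assms(1)] vfield_near_extension[OF M assms(2)] by metis
  show ?thesis
    using ext_deriv_1_eq[OF M alpha_form X(1) Y(1)] curvature[OF X(1) Y(1)] X(2) Y(2) by simp
qed

text \<open>The value of d on vectors can be computed with any extensions. Lifts plus constant
  multiples of \<xi> are chosen because they are related to fields on the base, so that naturality
  of the bracket applies.\<close>

lemma ext_deriv_pullback_beta:
  assumes u: "u \<in> tangent_space AM p" and v: "v \<in> tangent_space AM p"
  shows "ext_deriv AM 1 (pullback AB \<pi> \<beta>) p [u, v] = ext_deriv AB 1 \<beta> (\<pi> p) [push p u, push p v]"
proof -
  obtain X Y where X: "vfield_near AB (\<pi> p) X" "X (\<pi> p) = push p u" and Y: "vfield_near AB (\<pi> p) Y" "Y (\<pi> p) = push p v"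
    using vfield_near_extension[OF B push_tangent[OF u]] vfield_near_extension[OF B push_tangent[OF v]] by metis
  define V where "V Z c q = hlift q (Z (\<pi> q)) + c *\<^sub>R \<xi> q" for Z c q
  have near: "vfield_near AM p (V Z c)" if "vfield_near AB (\<pi> p) Z" for Z c
    unfolding V_def by (intro vfield_near_add[OF M] hlift_near[OF that] vfield_near_cmult[OF M xi_near])
  have rel: "\<forall>\<^sub>F q in nhds p. push q (V Z c q) = Z (\<pi> q)" if "vfield_near AB (\<pi> p) Z" for Z c
    using push_hlift_eventually[OF that]
    by eventually_elim (simp add: V_def push_forward_add push_forward_scaleR push_xi)
  have val: "V X (\<alpha> p [u]) p = u" "V Y (\<alpha> p [v]) p = v"
    unfolding V_def X(2) Y(2) by (rule tangent_decomposition[symmetric, OF u] tangent_decomposition[symmetric, OF v])+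
  note nX = near[OF X(1), of "\<alpha> p [u]"] and nY = near[OF Y(1), of "\<alpha> p [v]"]
  note rX = rel[OF X(1), of "\<alpha> p [u]"] and rY = rel[OF Y(1), of "\<alpha> p [v]"]
  have ap: "w (\<lambda>q. pullback AB \<pi> \<beta> q [V Z c q]) = push p w (\<lambda>b. \<beta> b [Z b])"
    if w: "w \<in> tangent_space AM p" and Z: "vfield_near AB (\<pi> p) Z" for w Z c
  proof -
    have "\<forall>\<^sub>F q in nhds p. pullback AB \<pi> \<beta> q [V Z c q] = 1 * \<beta> (\<pi> q) [Z (\<pi> q)]"
      using rel[OF Z, of c] by eventually_elim (simp add: pullback_def)
    from tangent_germ_eventually[OF M w this] show ?thesis using push_apply[OF Z w, of 1] by simp
  qed
  have "ext_deriv1 AM (pullback AB \<pi> \<beta>) (V X (\<alpha> p [u])) (V Y (\<alpha> p [v])) p = ext_deriv1 AB \<beta> X Y (\<pi> p)"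
    unfolding ext_deriv1_def ap[OF vfield_near_tangent[OF nX] Y(1)] ap[OF vfield_near_tangent[OF nY] X(1)]
    unfolding pullback_def list.map push_lie_bracket[OF nX nY X(1) Y(1) rX rY] val X(2) Y(2) ..
  then show ?thesis
    using ext_deriv_1_eq[OF M pullback_beta_form nX nY] ext_deriv_1_eq[OF B beta_form X(1) Y(1)] val X(2) Y(2) by simp
qed

text \<open>The two numbers change places: the first form of the pair is \<alpha>, and d\<alpha> is
  the pullback of \<eta>, whose powers vanish beyond \<open>k\<close>.\<close>

lemma contact_pair_lifted:
  assumes cs: "contact_symplectic_pair AB h k \<beta> \<eta>" and dim: "DIM('f) = DIM('e) + 1"
  shows "contact_pair AM k h \<alpha> (pullback AB \<pi> \<beta>)"
proof -
  have dimB: "DIM('e) = 2 * h + 2 * k + 1"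
    and vol: "volume_form AB (wedge 1 (2 * h + 2 * k) \<beta>
       (wedge (2 * h) (2 * k) (wedge_power (ext_deriv AB 1 \<beta>) h) (wedge_power \<eta> k)))"
    and v1: "vanishing_form AB (2 * (h + 1)) (wedge_power (ext_deriv AB 1 \<beta>) (h + 1))"
    and v2: "vanishing_form AB (2 * (k + 1)) (wedge_power \<eta> (k + 1))"
    using cs unfolding contact_symplectic_pair_def by simp_all
  have push_list: "map (push p) vs \<in> tangent_lists AB n (\<pi> p)" if "vs \<in> tangent_lists AM n p" for n p vs
    using that push_tangent unfolding tangent_lists_def by auto
  have da: "ext_deriv AM 1 \<alpha> p us = \<eta> (\<pi> p) (map (push p) us)"
    and db: "ext_deriv AM 1 (pullback AB \<pi> \<beta>) p us = ext_deriv AB 1 \<beta> (\<pi> p) (map (push p) us)"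
    if l: "length us = 2" and t: "set us \<subseteq> tangent_space AM p" for us p
  proof -
    obtain u v where "us = [u, v]" using l unfolding length2_conv by blast
    with t show "ext_deriv AM 1 \<alpha> p us = \<eta> (\<pi> p) (map (push p) us)"
      "ext_deriv AM 1 (pullback AB \<pi> \<beta>) p us = ext_deriv AB 1 \<beta> (\<pi> p) (map (push p) us)"
      using ext_deriv_alpha[of u p v] ext_deriv_pullback_beta[of u p v] by simp_all
  qed
  have pa: "wedge_power (ext_deriv AM 1 \<alpha>) n p us = wedge_power \<eta> n (\<pi> p) (map (push p) us)"
    if "length us = 2 * n" "set us \<subseteq> tangent_space AM p" for us n p
    by (rule wedge_power_transfer[OF that(1)]) (use da that(2) in blast)
  have pb: "wedge_power (ext_deriv AM 1 (pullback AB \<pi> \<beta>)) n p us = wedge_power (ext_deriv AB 1 \<beta>) n (\<pi> p) (map (push p) us)"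
    if "length us = 2 * n" "set us \<subseteq> tangent_space AM p" for us n p
    by (rule wedge_power_transfer[OF that(1)]) (use db that(2) in blast)
  show ?thesis
    unfolding contact_pair_def
  proof (intro conjI)
    show "DIM('f) = 2 * k + 2 * h + 2" using dim dimB by simp
    show "differential_form AM 1 \<alpha>" "differential_form AM 1 (pullback AB \<pi> \<beta>)"
      by (rule alpha_form pullback_beta_form)+
    show "vanishing_form AM (2 * (k + 1)) (wedge_power (ext_deriv AM 1 \<alpha>) (k + 1))"
      unfolding vanishing_form_def
    proof (intro allI ballI)
      fix p vs assume vs: "vs \<in> tangent_lists AM (2 * (k + 1)) p"
      have "wedge_power (ext_deriv AM 1 \<alpha>) (k + 1) p vs = wedge_power \<eta> (k + 1) (\<pi> p) (map (push p) vs)"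
        by (rule pa) (use vs in \<open>simp_all add: tangent_lists_def\<close>)
      also have "\<dots> = 0" using v2 push_list[OF vs] unfolding vanishing_form_def by blast
      finally show "wedge_power (ext_deriv AM 1 \<alpha>) (k + 1) p vs = 0" .
    qed
    show "vanishing_form AM (2 * (h + 1)) (wedge_power (ext_deriv AM 1 (pullback AB \<pi> \<beta>)) (h + 1))"
      unfolding vanishing_form_def
    proof (intro allI ballI)
      fix p vs assume vs: "vs \<in> tangent_lists AM (2 * (h + 1)) p"
      have "wedge_power (ext_deriv AM 1 (pullback AB \<pi> \<beta>)) (h + 1) p vs
          = wedge_power (ext_deriv AB 1 \<beta>) (h + 1) (\<pi> p) (map (push p) vs)"
        by (rule pb) (use vs in \<open>simp_all add: tangent_lists_def\<close>)
      also have "\<dots> = 0" using v1 push_list[OF vs] unfolding vanishing_form_def by blast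
      finally show "wedge_power (ext_deriv AM 1 (pullback AB \<pi> \<beta>)) (h + 1) p vs = 0" .
    qed
    let ?H = "wedge_power (ext_deriv AM 1 \<alpha>) k" and ?D = "wedge_power (ext_deriv AM 1 (pullback AB \<pi> \<beta>)) h"
    let ?R = "wedge (2 * k) (1 + 2 * h) ?H (wedge 1 (2 * h) (pullback AB \<pi> \<beta>) ?D)"
    show "volume_form AM (wedge 1 (2 * k + (1 + 2 * h)) \<alpha> ?R)"
      unfolding volume_form_def
    proof
      fix p
      obtain ws where ws: "ws \<in> tangent_lists AB DIM('e) (\<pi> p)" and nz: "wedge 1 (2 * h + 2 * k) \<beta>
          (wedge (2 * h) (2 * k) (wedge_power (ext_deriv AB 1 \<beta>) h) (wedge_power \<eta> k)) (\<pi> p) ws \<noteq> 0"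
        using vol unfolding volume_form_def by blast
      \<comment> \<open>Lifted vectors are killed by \<alpha>; with \<xi> in front of them only the
        term pairing \<alpha> with \<xi> survives, times the volume form of the base on
        \<open>ws\<close>, up to reordering.\<close>
      define us where "us = map (hlift p) ws"
      have wT: "w \<in> tangent_space AB (\<pi> p)" if "w \<in> set ws" for w using ws that by (auto simp: tangent_lists_def)
      have len: "length us = 2 * k + (1 + 2 * h)" using ws dimB by (simp add: us_def tangent_lists_def)
      have uT: "set us \<subseteq> tangent_space AM p" using wT hlift_tangent by (auto simp: us_def)
      have pu: "map (push p) us = ws"
        unfolding us_def map_map by (rule map_idI) (simp add: push_hlift wT)
      have au: "\<alpha> p [u] = 0" if "u \<in> set us" for u using that wT alpha_hlift by (auto simp: us_def)
      have "?R p us = wedge (2 * k) (1 + 2 * h) (wedge_power \<eta> k)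
          (wedge 1 (2 * h) \<beta> (wedge_power (ext_deriv AB 1 \<beta>) h)) (\<pi> p) (map (push p) us)"
      proof (rule wedge_transfer[OF len])
        fix ys assume ys: "length ys = 2 * k" "set ys \<subseteq> set us"
        show "?H p ys = wedge_power \<eta> k (\<pi> p) (map (push p) ys)" by (rule pa[OF ys(1)]) (use ys(2) uT in blast)
      next
        fix ys assume ys: "length ys = 1 + 2 * h" "set ys \<subseteq> set us"
        show "wedge 1 (2 * h) (pullback AB \<pi> \<beta>) ?D p ys =
            wedge 1 (2 * h) \<beta> (wedge_power (ext_deriv AB 1 \<beta>) h) (\<pi> p) (map (push p) ys)"
        proof (rule wedge_transfer[OF ys(1)])
          fix zs assume zs: "length zs = 2 * h" "set zs \<subseteq> set ys"
          show "?D p zs = wedge_power (ext_deriv AB 1 \<beta>) h (\<pi> p) (map (push p) zs)"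
            by (rule pb[OF zs(1)]) (use zs(2) ys(2) uT in blast)
        qed (simp add: pullback_def)
      qed
      then have Rnz: "?R p us \<noteq> 0" using wedge_wedge_rotate_nonzero[OF nz] pu by simp
      have "wedge 1 (2 * k + (1 + 2 * h)) \<alpha> ?R p (\<xi> p # us) = \<alpha> p [\<xi> p] * ?R p us"
        by (rule wedge_1_Cons[where \<alpha> = \<alpha> and x = p, OF len au]) (assumption | rule wedge_permute)+
      moreover have "\<xi> p # us \<in> tangent_lists AM DIM('f) p"
        using len uT xi_tangent dim dimB by (simp add: tangent_lists_def)
      ultimately show "\<exists>vs\<in>tangent_lists AM DIM('f) p. wedge 1 (2 * k + (1 + 2 * h)) \<alpha> ?R p vs \<noteq> 0"
        using Rnz alpha_xi by (intro bexI[of _ "\<xi> p # us"]) simp_all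
    qed
  qed
qed

section \<open>Reeb fields and the endomorphism of the lifted pair\<close>

abbreviation Reeb_lift where "Reeb_lift p \<equiv> hlift p (W (\<pi> p))"

lemma cp_reeb_fields_lifted: "cp_reeb_fields AM \<alpha> (pullback AB \<pi> \<beta>) \<xi> Reeb_lift"
  unfolding cp_reeb_fields_def
proof (intro conjI allI ballI)
  show "smooth_vfield_on AM UNIV \<xi>" "smooth_vfield_on AM UNIV Reeb_lift"
    unfolding smooth_vfield_iff_near[OF open_UNIV] by (simp_all add: xi_near hlift_near[OF W_near])
  fix p
  note W = W_tangent[of "\<pi> p"]
  show "\<alpha> p [\<xi> p] = 1" "\<alpha> p [Reeb_lift p] = 0" by (rule alpha_xi alpha_hlift[OF W])+
  show "pullback AB \<pi> \<beta> p [\<xi> p] = 0" "pullback AB \<pi> \<beta> p [Reeb_lift p] = 1"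
    by (simp_all add: pullback_def push_xi form1_zero[OF beta_form] push_hlift[OF W] beta_W)
  fix v \<alpha>' Z assume v: "v \<in> tangent_space AM p" and a: "\<alpha>' \<in> {\<alpha>, pullback AB \<pi> \<beta>}" and Z: "Z \<in> {\<xi>, Reeb_lift}"
  obtain Y where Y: "vfield_near AB (\<pi> p) Y" "Y (\<pi> p) = push p v"
    using vfield_near_extension[OF B push_tangent[OF v]] .
  note n0 = vfield_near_zero[OF B, of "\<pi> p"]
  have "ext_deriv1 AB \<beta> (\<lambda>_. 0) Y (\<pi> p) = 0"
    using lie_bracket_cmult_left[OF B n0 Y(1), of 0]
    by (simp add: ext_deriv1_def form1_zero[OF beta_form] tangent_const[OF B vfield_near_tangent[OF Y(1)]] zero_fun_apply)
  then have b0: "ext_deriv AB 1 \<beta> (\<pi> p) [0, push p v] = 0"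
    using ext_deriv_1_eq[OF B beta_form n0 Y(1)] Y(2) by simp
  have bW: "ext_deriv AB 1 \<beta> (\<pi> p) [W (\<pi> p), push p v] = 0"
    using ext_deriv_1_eq[OF B beta_form W_near Y(1)] dbeta_W[OF Y(1)] Y(2) by simp
  have e0: "\<eta> (\<pi> p) [0, push p v] = 0" and eW: "\<eta> (\<pi> p) [W (\<pi> p), push p v] = 0"
    using eta_W[OF push_tangent[OF v], of 0] eta_W[OF push_tangent[OF v], of 1] by simp_all
  have "ext_deriv AM 1 \<alpha> p [\<xi> p, v] = 0" "ext_deriv AM 1 \<alpha> p [Reeb_lift p, v] = 0"
    "ext_deriv AM 1 (pullback AB \<pi> \<beta>) p [\<xi> p, v] = 0" "ext_deriv AM 1 (pullback AB \<pi> \<beta>) p [Reeb_lift p, v] = 0"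
    unfolding ext_deriv_alpha[OF xi_tangent v] ext_deriv_alpha[OF hlift_tangent[OF W] v]
      ext_deriv_pullback_beta[OF xi_tangent v] ext_deriv_pullback_beta[OF hlift_tangent[OF W] v]
      push_xi push_hlift[OF W] by (rule e0 eW b0 bW)+
  with a Z show "ext_deriv AM 1 \<alpha>' p [Z p, v] = 0" by (elim insertE emptyE) simp_all
qed

abbreviation lifted_psi where "lifted_psi \<equiv> lifted_endomorphism AB AM \<pi> \<alpha> \<psi>"

lemma lifted_psi_field: "endomorphism_field AM lifted_psi"
proof -
  have "lifted_psi = (\<lambda>p v. hlift p (\<psi> (\<pi> p) (push p v)))"
    by (rule ext, rule ext) (rule lifted_endomorphism_def)
  then show ?thesis using lifted_endomorphism_field[OF psi_field] by (simp only:)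
qed

lemma lifted_psi_lifted_psi:
  assumes v: "v \<in> tangent_space AM p"
  shows "lifted_psi p (lifted_psi p v) = - v + \<alpha> p [v] *\<^sub>R \<xi> p + pullback AB \<pi> \<beta> p [v] *\<^sub>R Reeb_lift p"
proof -
  note pv = push_tangent[OF v] and jv = psi_tangent[OF push_tangent[OF v]] and W = W_tangent[of "\<pi> p"]
  note jj = psi_tangent[OF jv]
  have eq: "lifted_psi p (lifted_psi p v) = hlift p (\<psi> (\<pi> p) (\<psi> (\<pi> p) (push p v)))"
    unfolding lifted_endomorphism_def push_hlift[OF jv] ..
  note t1 = tangent_space_uminus[OF v] and t2 = tangent_space_scaleR[OF xi_tangent]
    and t3 = tangent_space_scaleR[OF hlift_tangent[OF W]]
  note t12 = tangent_space_plus[OF t1 t2]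
  show ?thesis
    unfolding eq
  proof (rule tangent_eq_iff[THEN iffD2, OF hlift_tangent[OF jj] tangent_space_plus[OF t12 t3]], rule conjI)
    show "push p (hlift p (\<psi> (\<pi> p) (\<psi> (\<pi> p) (push p v)))) =
        push p (- v + \<alpha> p [v] *\<^sub>R \<xi> p + pullback AB \<pi> \<beta> p [v] *\<^sub>R Reeb_lift p)"
      unfolding push_hlift[OF jj] push_forward_add push_forward_uminus push_forward_scaleR push_xi push_hlift[OF W]
      unfolding psi_psi[OF pv] pullback_def by simp
    show "\<alpha> p [hlift p (\<psi> (\<pi> p) (\<psi> (\<pi> p) (push p v)))] =
        \<alpha> p [- v + \<alpha> p [v] *\<^sub>R \<xi> p + pullback AB \<pi> \<beta> p [v] *\<^sub>R Reeb_lift p]"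
      unfolding alpha_hlift[OF jj] form1_add[OF alpha_form t12 t3] form1_add[OF alpha_form t1 t2]
        form1_uminus[OF alpha_form v] form1_scaleR[OF alpha_form xi_tangent]
        form1_scaleR[OF alpha_form hlift_tangent[OF W]] alpha_xi alpha_hlift[OF W] by simp
  qed
qed

lemma lifted_psi_reeb: "lifted_psi p (\<xi> p) = 0" "lifted_psi p (Reeb_lift p) = 0"
  by (simp_all add: lifted_endomorphism_def push_xi endomorphism_zero[OF psi_field] hlift_zero
      push_hlift[OF W_tangent] psi_W)

lemma acs_J_eq: "acs_J \<alpha> (pullback AB \<pi> \<beta>) \<xi> Reeb_lift lifted_psi = lifted_acs (- 1)"
  by (rule ext, rule ext) (simp add: acs_J_def lifted_acs_def lifted_endomorphism_def pullback_def)

lemma acs_T_eq: "acs_T \<alpha> (pullback AB \<pi> \<beta>) \<xi> Reeb_lift lifted_psi = lifted_acs 1"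
  by (rule ext, rule ext) (simp add: acs_T_def lifted_acs_def lifted_endomorphism_def pullback_def)

text \<open>
  The Reeb fields of any contact pair structure with endomorphism \<open>\<phi>\<close> are found by evaluating the
  formula for \<open>\<phi>\<^sup>2\<close> on \<open>\<xi>\<close> and on the lift of \<open>W\<close>, both of which are killed by \<open>\<phi>\<close>.
\<close>

lemma contact_pair_structure_reeb_unique:
  assumes "contact_pair_structure AM h' k' \<alpha> (pullback AB \<pi> \<beta>) Z1 Z2 lifted_psi"
  shows "Z1 = \<xi>" "Z2 = Reeb_lift"
proof -
  have sq: "lifted_psi p (lifted_psi p v) = - v + \<alpha> p [v] *\<^sub>R Z1 p + pullback AB \<pi> \<beta> p [v] *\<^sub>R Z2 p"
    if "v \<in> tangent_space AM p" for p v
    using assms that unfolding contact_pair_structure_def by blast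
  have z: "lifted_psi p 0 = 0" for p by (rule endomorphism_zero[OF lifted_psi_field])
  note W = W_tangent
  show "Z1 = \<xi>"
  proof
    fix p
    have "0 = - \<xi> p + 1 *\<^sub>R Z1 p + 0 *\<^sub>R Z2 p"
      using sq[OF xi_tangent, of p] by (simp add: lifted_psi_reeb z alpha_xi pullback_def push_xi form1_zero[OF beta_form])
    then show "Z1 p = \<xi> p" by simp
  qed
  show "Z2 = Reeb_lift"
  proof
    fix p
    have "0 = - Reeb_lift p + 0 *\<^sub>R Z1 p + 1 *\<^sub>R Z2 p"
      using sq[OF hlift_tangent[OF W], of p]
      by (simp add: lifted_psi_reeb z alpha_hlift[OF W] pullback_def push_hlift[OF W] beta_W)
    then show "Z2 p = Reeb_lift p" by simp
  qed
qed

text \<open>Uniqueness identifies the existentially quantified Reeb fields with \<xi> and the lift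
  of W. Conversely, the definition asks for the whole contact pair structure, assembled here, and
  the two signs \<open>s\<close> give \<open>J\<close> and \<open>T\<close>.\<close>

theorem normal_contact_pair_structure_iff:
  assumes "contact_symplectic_pair AB h k \<beta> \<eta>" "DIM('f) = DIM('e) + 1"
  shows "normal_contact_pair_structure AM k h \<alpha> (pullback AB \<pi> \<beta>) lifted_psi \<longleftrightarrow>
    contact_tensors_vanish AB \<beta> W \<psi>"
proof
  assume "normal_contact_pair_structure AM k h \<alpha> (pullback AB \<pi> \<beta>) lifted_psi"
  then obtain Z1 Z2 where Z: "contact_pair_structure AM k h \<alpha> (pullback AB \<pi> \<beta>) Z1 Z2 lifted_psi"
    and T: "integrable_acs AM (acs_T \<alpha> (pullback AB \<pi> \<beta>) Z1 Z2 lifted_psi)"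
    unfolding normal_contact_pair_structure_def by blast
  show "contact_tensors_vanish AB \<beta> W \<psi>"
    using T integrable_lifted_acs_iff[of 1] unfolding contact_pair_structure_reeb_unique[OF Z] acs_T_eq by simp
next
  assume "contact_tensors_vanish AB \<beta> W \<psi>"
  then have I: "integrable_acs AM (lifted_acs (- 1))" "integrable_acs AM (lifted_acs 1)"
    using integrable_lifted_acs_iff[of "- 1"] integrable_lifted_acs_iff[of 1] by simp_all
  have "contact_pair_structure AM k h \<alpha> (pullback AB \<pi> \<beta>) \<xi> Reeb_lift lifted_psi"
    unfolding contact_pair_structure_def
    using contact_pair_lifted[OF assms] cp_reeb_fields_lifted lifted_psi_field lifted_psi_lifted_psi lifted_psi_reeb
    by blast
  with I show "normal_contact_pair_structure AM k h \<alpha> (pullback AB \<pi> \<beta>) lifted_psi"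
    unfolding normal_contact_pair_structure_def acs_J_eq[symmetric] acs_T_eq[symmetric] by blast
qed

end


section \<open>Almost contact-symplectic structures\<close>

lemma almost_contact_symplectic_facts:
  fixes A :: "('b::{t2_space,second_countable_topology}, 'e::euclidean_space) atlas"
  assumes A: "smooth_manifold A" and S: "almost_contact_symplectic_structure A h k \<beta> \<eta> W \<psi>"
  shows "differential_form A 1 \<beta>" "\<And>b. vfield_near A b W" "endomorphism_field A \<psi>"
    "\<And>b v. v \<in> tangent_space A b \<Longrightarrow> \<psi> b (\<psi> b v) = - v + \<beta> b [v] *\<^sub>R W b"
    "\<And>b. \<psi> b (W b) = 0" "\<And>b. \<beta> b [W b] = 1"
    "\<And>b X. vfield_near A b X \<Longrightarrow> ext_deriv1 A \<beta> W X b = 0"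
    "almost_contact_structure A \<beta> W \<psi>"
proof -
  have cs: "contact_symplectic_pair A h k \<beta> \<eta>" and R: "cs_reeb_field A \<beta> \<eta> W" and psi: "endomorphism_field A \<psi>"
    and sq: "\<And>b v. v \<in> tangent_space A b \<Longrightarrow> \<psi> b (\<psi> b v) = - v + \<beta> b [v] *\<^sub>R W b"
    using S unfolding almost_contact_symplectic_structure_def by blast+
  show beta: "differential_form A 1 \<beta>" using cs unfolding contact_symplectic_pair_def by blast
  have Wf: "smooth_vfield_on A UNIV W" and bW: "\<And>b. \<beta> b [W b] = 1"
    and dW: "\<And>b v. v \<in> tangent_space A b \<Longrightarrow> ext_deriv A 1 \<beta> b [W b, v] = 0"
    using R unfolding cs_reeb_field_def by blast+
  then show W: "vfield_near A b W" for b using vfield_nearI by blast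
  note tW = vfield_near_tangent[OF W]
  show "endomorphism_field A \<psi>" "\<And>b v. v \<in> tangent_space A b \<Longrightarrow> \<psi> b (\<psi> b v) = - v + \<beta> b [v] *\<^sub>R W b"
    "\<And>b. \<beta> b [W b] = 1" by (rule psi sq bW; assumption?)+
  \<comment> \<open>\<psi>^2 W = 0, so the formula for \<psi>^2 at \<psi> W gives \<psi> W = c W.
    Then 0 = \<psi>^2 W = c \<psi> W, and in either case \<psi> W = 0.\<close>
  show psiW: "\<psi> b (W b) = 0" for b
  proof -
    let ?c = "\<beta> b [\<psi> b (W b)]"
    have 0: "\<psi> b (\<psi> b (W b)) = 0" using sq[OF tW] bW by simp
    have "\<psi> b (\<psi> b (\<psi> b (W b))) = - \<psi> b (W b) + ?c *\<^sub>R W b"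
      by (rule sq[OF endomorphism_tangent[OF psi tW]])
    then have 1: "\<psi> b (W b) = ?c *\<^sub>R W b" using 0 endomorphism_zero[OF psi] by simp
    then have "\<psi> b (\<psi> b (W b)) = ?c *\<^sub>R \<psi> b (W b)" using endomorphism_scaleR[OF psi tW, of b ?c] by metis
    then have "?c *\<^sub>R \<psi> b (W b) = 0" using 0 by simp
    then show ?thesis using 1 by auto
  qed
  show "ext_deriv1 A \<beta> W X b = 0" if X: "vfield_near A b X" for b X
    using ext_deriv_1_eq[OF A beta W X] dW[OF vfield_near_tangent[OF X]] by simp
  show "almost_contact_structure A \<beta> W \<psi>"
    unfolding almost_contact_structure_def using beta Wf psi sq psiW bW by blast
qed

lemma form2_linear_left:
  assumes "differential_form A 2 \<eta>" "u \<in> tangent_space A b" "v \<in> tangent_space A b" "w \<in> tangent_space A b"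
  shows "\<eta> b [u + v, w] = \<eta> b [u, w] + \<eta> b [v, w]" and "\<eta> b [c *\<^sub>R u, w] = c * \<eta> b [u, w]"
proof -
  have "[u, w] \<in> tangent_lists A 2 b" using assms by (simp add: tangent_lists_def)
  then have "\<forall>i<2. \<forall>v\<in>tangent_space A b. \<forall>v'\<in>tangent_space A b. \<forall>c.
      \<eta> b ([u, w][i := v + v']) = \<eta> b ([u, w][i := v]) + \<eta> b ([u, w][i := v']) \<and>
      \<eta> b ([u, w][i := c *\<^sub>R v]) = c * \<eta> b ([u, w][i := v])"
    using assms(1) unfolding differential_form_def by blast
  from this[rule_format, of 0, OF _ assms(2,3)]
  show "\<eta> b [u + v, w] = \<eta> b [u, w] + \<eta> b [v, w]" and "\<eta> b [c *\<^sub>R u, w] = c * \<eta> b [u, w]" by simp_all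
qed

lemma lifted_contact_structureI:
  fixes AB :: "('b::{t2_space,second_countable_topology}, 'e::euclidean_space) atlas"
  assumes S: "almost_contact_symplectic_structure AB h k \<beta> \<eta> W \<psi>"
    and inv: "\<And>b X Y. X \<in> tangent_space AB b \<Longrightarrow> Y \<in> tangent_space AB b \<Longrightarrow> \<eta> b [\<psi> b X, \<psi> b Y] = \<eta> b [X, Y]"
    and C: "connection_bundle AB AM \<pi> \<xi> \<alpha> \<eta>"
  shows "lifted_contact_structure AB AM \<pi> \<xi> \<alpha> \<eta> \<beta> W \<psi>"
proof (intro lifted_contact_structure.intro C lifted_contact_structure_axioms.intro)
  note A = connection_bundle.B[OF C]
  note facts = almost_contact_symplectic_facts[OF A S]
  show "differential_form AB 1 \<beta>" "\<And>b. vfield_near AB b W" "endomorphism_field AB \<psi>"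
    "\<And>b v. v \<in> tangent_space AB b \<Longrightarrow> \<psi> b (\<psi> b v) = - v + \<beta> b [v] *\<^sub>R W b"
    "\<And>b. \<psi> b (W b) = 0" "\<And>b. \<beta> b [W b] = 1"
    "\<And>b X. vfield_near AB b X \<Longrightarrow> ext_deriv1 AB \<beta> W X b = 0"
    by (rule facts; assumption?)+
  show "\<eta> b [\<psi> b v, \<psi> b w] = \<eta> b [v, w]" if "v \<in> tangent_space AB b" "w \<in> tangent_space AB b" for v w b
    by (rule inv[OF that])
  have eta: "differential_form AB 2 \<eta>"
    using S unfolding almost_contact_symplectic_structure_def contact_symplectic_pair_def by blast
  have eW: "\<eta> b [W b, v] = 0" if "v \<in> tangent_space AB b" for v b
    using S that unfolding almost_contact_symplectic_structure_def cs_reeb_field_def by blast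
  note tW = vfield_near_tangent[OF facts(2)]
  \<comment> \<open>Stated with a factor because the locale does not assume \<eta> to be
    bilinear.\<close>
  show ecW: "\<eta> b [c *\<^sub>R W b, v] = 0" if v: "v \<in> tangent_space AB b" for v b c
    using form2_linear_left(2)[OF eta tW tW v] eW[OF v] by simp
  show "\<eta> b [\<psi> b v, w] + \<eta> b [v, \<psi> b w] = 0" if v: "v \<in> tangent_space AB b" and w: "w \<in> tangent_space AB b" for v w b
  proof -
    note jw = endomorphism_tangent[OF facts(3) w]
    \<comment> \<open>Invariance for the pair \<psi> v, w, read backwards, followed by the formula
      for \<psi>^2.\<close>
    have "\<eta> b [\<psi> b v, w] = \<eta> b [- v + \<beta> b [v] *\<^sub>R W b, \<psi> b w]"
      using inv[OF endomorphism_tangent[OF facts(3) v] w] facts(4)[OF v] by simp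
    also have "\<dots> = \<eta> b [- v, \<psi> b w] + \<eta> b [\<beta> b [v] *\<^sub>R W b, \<psi> b w]"
      by (rule form2_linear_left(1)[OF eta tangent_space_uminus[OF v] tangent_space_scaleR[OF tW] jw])
    also have "\<dots> = - \<eta> b [v, \<psi> b w]"
      using form2_linear_left(2)[OF eta v v jw, of "- 1"] ecW[OF jw] by simp
    finally show ?thesis by simp
  qed
qed

text \<open>This is \<open>dt\<close>: a tangent vector is applied to the coordinate function \<open>snd\<close>.\<close>

definition line_form :: "('b \<times> real) dform"
  where "line_form z vs = hd vs snd"

text \<open>Flatness of dt is immediate: the bracket applied to the function \<open>snd\<close> is
  by definition the difference of the two derivative terms in the invariant formula.\<close>

lemma connection_bundle_product:
  fixes AB :: "('b::{t2_space,second_countable_topology}, 'e::euclidean_space) atlas"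
  assumes B: "smooth_manifold AB"
  shows "connection_bundle AB (line_product AB) fst (line_vector AB) line_form (\<lambda>_ _. 0)"
proof (rule line_fibration.connection_bundleI[OF line_fibration_product[OF B]])
  note R = smooth_manifold_line_product[OF B] and snd_smooth = line_product_snd[OF B]
  show "surj (fst :: 'b \<times> real \<Rightarrow> 'b)" by (rule surjI[of _ "\<lambda>b. (b, 0)"]) simp
  show "differential_form (line_product AB) 1 line_form"
    by (rule form1I) (simp_all add: line_form_def tvec_apply vfield_near_smooth[OF _ snd_smooth])
  show "line_form z [line_vector AB z] = 1" for z
  proof -
    have "deriv (snd \<circ> (\<lambda>s. (fst z, s))) (snd z) = 1" by (simp add: comp_def)
    then show ?thesis using snd_smooth[of z] by (simp add: line_form_def line_vector_def velocity_def)
  qed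
  show "ext_deriv1 (line_product AB) line_form X Y z = 0" for X Y z
    by (simp add: ext_deriv1_def line_form_def lie_bracket_apply[OF snd_smooth])
qed

text \<open>The case of zero curvature, where the conditions on \<eta> are trivial. It remains to
  recognise the push-forward along the slice inclusion in \<open>cone_acs\<close> as the horizontal
  lift for dt.\<close>

lemma normal_almost_contact_structure_iff:
  fixes AB :: "('b::{t2_space,second_countable_topology}, 'e::euclidean_space) atlas"
  assumes B: "smooth_manifold AB" and S: "almost_contact_symplectic_structure AB h k \<beta> \<eta> W \<psi>"
  shows "normal_almost_contact_structure AB \<beta> W \<psi> \<longleftrightarrow> contact_tensors_vanish AB \<beta> W \<psi>"
proof -
  note facts = almost_contact_symplectic_facts[OF B S]
  note R = smooth_manifold_line_product[OF B]
  interpret lifted_contact_structure AB "line_product AB" fst "line_vector AB" line_form "\<lambda>_ _. 0" \<beta> W \<psi>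
    by (intro lifted_contact_structure.intro connection_bundle_product[OF B] lifted_contact_structure_axioms.intro facts)
       simp_all
  have hl: "push_forward (line_product AB) (\<lambda>b'. (b', t)) b y = hlift (b, t) y" if y: "y \<in> tangent_space AB b" for b t y
  proof -
    have i: "smooth_at AB (line_product AB) (\<lambda>b'. (b', t)) b"
      by (rule smooth_at_Pair[OF B B smooth_manifold_std smooth_at_ident[OF B] smooth_fun_at_const[OF B]])
    have "hlift (b, t) y = push_forward (line_product AB) (\<lambda>b'. (b', t)) b y"
    proof (rule hlift_eqI)
      show "push_forward (line_product AB) (\<lambda>b'. (b', t)) b y \<in> tangent_space (line_product AB) (b, t)"
        by (rule push_forward_tangent[OF B R i y])
      show "line_form (b, t) [push_forward (line_product AB) (\<lambda>b'. (b', t)) b y] = 0"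
        by (simp add: line_form_def push_forward_def comp_def tangent_const[OF B y])
      show "push (b, t) (push_forward (line_product AB) (\<lambda>b'. (b', t)) b y) = y"
      proof
        fix f
        show "push (b, t) (push_forward (line_product AB) (\<lambda>b'. (b', t)) b y) f = y f"
          using smooth_at_compose[OF R B smooth_manifold_std line_product_fst[OF B, of "(b, t)"], of f]
            tangent_not_smooth[OF y, of f]
          by (auto simp: push_forward_def comp_def)
      qed
    qed
    then show ?thesis ..
  qed
  have "lifted_acs 1 z w = cone_acs AB \<beta> W \<psi> z w" if w: "w \<in> tangent_space (line_product AB) z" for z w
  proof -
    obtain b t where z: "z = (b, t)" by (cases z)
    note pw = push_tangent[OF w]
    have j: "\<psi> b (push z w) \<in> tangent_space AB b" using psi_tangent[OF pw] by (simp add: z)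
    have cW: "w snd *\<^sub>R W b \<in> tangent_space AB b" by (rule tangent_space_scaleR[OF W_tangent])
    have "cone_acs AB \<beta> W \<psi> z w = push_forward (line_product AB) (\<lambda>b'. (b', t)) b (\<psi> b (push z w) - w snd *\<^sub>R W b)
        + \<beta> b [push z w] *\<^sub>R line_vector AB z"
      by (simp add: cone_acs_def z line_vector_def Let_def)
    also have "\<dots> = hlift (b, t) (\<psi> b (push z w)) - w snd *\<^sub>R hlift (b, t) (W b) + \<beta> b [push z w] *\<^sub>R line_vector AB z"
      unfolding push_forward_diff push_forward_scaleR hl[OF j] hl[OF W_tangent] ..
    also have "\<dots> = lifted_acs 1 z w"
      by (simp add: lifted_acs_def z line_form_def)
    finally show ?thesis ..
  qed
  from integrable_acs_cong[OF R lifted_acs_endomorphism this]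
  have "integrable_acs (line_product AB) (cone_acs AB \<beta> W \<psi>) \<longleftrightarrow> contact_tensors_vanish AB \<beta> W \<psi>"
    using integrable_lifted_acs_iff[of 1] by simp
  then show ?thesis unfolding normal_almost_contact_structure_def using facts(8) by simp
qed

section \<open>Principal circle bundles\<close>

lemma cis_eq_imp_int_diff:
  assumes "cis (2 * pi * s) = cis (2 * pi * t)"
  obtains n :: int where "s = t + of_int n"
proof -
  have "sin (2 * pi * s) = sin (2 * pi * t) \<and> cos (2 * pi * s) = cos (2 * pi * t)"
    using assms by (simp add: complex_eq_iff)
  then obtain n :: int where "2 * pi * s = 2 * pi * t + 2 * pi * n" unfolding sin_cos_eq_iff by blast
  then have "2 * pi * s = 2 * pi * (t + n)" by (simp add: algebra_simps)
  then show thesis using that by simp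
qed

lemma cis_Im_Ln:
  assumes "norm w = 1"
  shows "cis (Im (Ln w)) = w"
proof -
  have w: "w \<noteq> 0" using assms by auto
  have "w = exp (Ln w)" using w by simp
  also have "\<dots> = of_real (exp (Re (Ln w))) * cis (Im (Ln w))" by (rule exp_eq_polar)
  also have "Re (Ln w) = 0" using w assms by simp
  finally show ?thesis by simp
qed

context
  fixes AB :: "('b::{t2_space,second_countable_topology}, 'e::euclidean_space) atlas"
    and AM :: "('m::{t2_space,second_countable_topology}, 'f::euclidean_space) atlas"
    and \<theta> :: "real \<Rightarrow> 'm \<Rightarrow> 'm" and \<pi> :: "'m \<Rightarrow> 'b"
  assumes B: "smooth_manifold AB" and M: "smooth_manifold AM"
    and pcb: "principal_circle_bundle AB AM \<theta> \<pi>"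
begin

lemma bundle_pi_smooth: "smooth_at AM AB \<pi> p"
  and bundle_action: "\<theta> 0 p = p" "\<theta> 1 p = p" "\<theta> (s + t) p = \<theta> s (\<theta> t p)"
  using pcb unfolding principal_circle_bundle_def by blast+

lemma bundle_trivialisation:
  obtains U \<Psi> and \<zeta> :: "'m \<Rightarrow> complex" where "open U" "b \<in> U"
    "\<And>u t. u \<in> U \<Longrightarrow> smooth_at (line_product AB) AM \<Psi> (u, t)"
    "\<And>p. \<pi> p \<in> U \<Longrightarrow> smooth_at AM std_atlas \<zeta> p"
    "\<And>u t. u \<in> U \<Longrightarrow> \<pi> (\<Psi> (u, t)) = u" "\<And>u t. u \<in> U \<Longrightarrow> \<zeta> (\<Psi> (u, t)) = cis (2 * pi * t)"
    "\<And>u s t. u \<in> U \<Longrightarrow> \<theta> s (\<Psi> (u, t)) = \<Psi> (u, s + t)"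
    "\<And>p. \<pi> p \<in> U \<Longrightarrow> \<exists>t. p = \<Psi> (\<pi> p, t)"
proof -
  have "\<exists>U \<Psi> (\<zeta> :: 'm \<Rightarrow> complex). open U \<and> b \<in> U \<and>
        (\<forall>x\<in>U \<times> UNIV. smooth_at (line_product AB) AM \<Psi> x) \<and>
        (\<forall>p\<in>\<pi> -` U. smooth_at AM std_atlas \<zeta> p) \<and>
        (\<forall>u\<in>U. \<forall>s t. \<pi> (\<Psi> (u, t)) = u \<and> \<zeta> (\<Psi> (u, t)) = cis (2 * pi * t) \<and>
           \<theta> s (\<Psi> (u, t)) = \<Psi> (u, s + t)) \<and>
        (\<forall>p\<in>\<pi> -` U. \<exists>t. p = \<Psi> (\<pi> p, t))"
    using pcb unfolding principal_circle_bundle_def by blast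
  then show thesis
    by (elim exE conjE) (rule that, (simp | blast)+)
qed

lemma bundle_action_int: "\<theta> (of_int n) p = p"
proof -
  have nat: "\<theta> (real n) p = p" for n p
    by (induction n) (simp_all add: bundle_action)
  have neg: "\<theta> (- real n) p = p" for n p
    using bundle_action(3)[of "- real n" "real n" p] by (simp add: nat bundle_action(1))
  show ?thesis
    by (cases n rule: int_cases2) (simp_all add: nat neg)
qed

lemma bundle_surj: "surj \<pi>"
proof (rule surjI)
  fix b
  have "\<exists>p. \<pi> p = b" by (rule bundle_trivialisation[of b]) blast
  then show "\<pi> (SOME p. \<pi> p = b) = b" by (rule someI_ex)
qed

context
  fixes U \<Psi> and \<zeta> :: "'m \<Rightarrow> complex"
  assumes U: "open U"
    and Psi_smooth: "\<And>u t. u \<in> U \<Longrightarrow> smooth_at (line_product AB) AM \<Psi> (u, t)"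
    and zeta_smooth: "\<And>p. \<pi> p \<in> U \<Longrightarrow> smooth_at AM std_atlas \<zeta> p"
    and pi_Psi: "\<And>u t. u \<in> U \<Longrightarrow> \<pi> (\<Psi> (u, t)) = u"
    and zeta_Psi: "\<And>u t. u \<in> U \<Longrightarrow> \<zeta> (\<Psi> (u, t)) = cis (2 * pi * t)"
    and theta_Psi: "\<And>u s t. u \<in> U \<Longrightarrow> \<theta> s (\<Psi> (u, t)) = \<Psi> (u, s + t)"
    and Psi_onto: "\<And>p. \<pi> p \<in> U \<Longrightarrow> \<exists>t. p = \<Psi> (\<pi> p, t)"
begin

section \<open>The fibre coordinate of a circle bundle\<close>

lemma Psi_periodic:
  assumes u: "u \<in> U" and e: "cis (2 * pi * s) = cis (2 * pi * t)"
  shows "\<Psi> (u, s) = \<Psi> (u, t)"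
proof -
  obtain n :: int where "s = t + of_int n" using cis_eq_imp_int_diff[OF e] .
  then have "\<Psi> (u, s) = \<theta> (of_int n) (\<Psi> (u, t))" using theta_Psi[OF u] by (simp add: add.commute)
  then show ?thesis by (simp add: bundle_action_int)
qed

text \<open>\<zeta> determines the fibre parameter up to an integer, and two points of an open
  interval of length 1 differ by less than 1.\<close>

lemma Psi_inj_on: "inj_on \<Psi> (U \<times> {t0 - 1 / 2<..<t0 + 1 / 2})"
proof (rule inj_onI)
  fix x y assume x: "x \<in> U \<times> {t0 - 1 / 2<..<t0 + 1 / 2}" and y: "y \<in> U \<times> {t0 - 1 / 2<..<t0 + 1 / 2}"
    and e: "\<Psi> x = \<Psi> y"
  obtain u s v t where xy: "x = (u, s)" "y = (v, t)" by (cases x, cases y)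
  have uv: "u \<in> U" "v \<in> U" using x y xy by simp_all
  have "u = v" using e pi_Psi[OF uv(1), of s] pi_Psi[OF uv(2), of t] xy by simp
  have "cis (2 * pi * s) = cis (2 * pi * t)" using e zeta_Psi[OF uv(1), of s] zeta_Psi[OF uv(2), of t] xy by simp
  then obtain n :: int where n: "s = t + of_int n" by (rule cis_eq_imp_int_diff)
  have "\<bar>s - t\<bar> < 1" using x y xy by auto
  then have "\<bar>real_of_int n\<bar> < 1" using n by simp
  then have "n = 0" by linarith
  with n \<open>u = v\<close> xy show "x = y" by simp
qed

text \<open>In the trivialisation the action is translation of the parameter, so the derivative at
  time 0 along an orbit is the derivative at \<open>t\<close> along the line.\<close>

lemma circle_generator_eq:
  assumes u: "u \<in> U"
  shows "circle_generator AM \<theta> (\<Psi> (u, t)) = push_forward AM \<Psi> (u, t) (line_vector AB (u, t))"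
proof
  fix f :: "'m \<Rightarrow> real"
  let ?g = "\<lambda>s. f (\<Psi> (u, s))"
  show "circle_generator AM \<theta> (\<Psi> (u, t)) f = push_forward AM \<Psi> (u, t) (line_vector AB (u, t)) f"
  proof (cases "smooth_fun_at AM f (\<Psi> (u, t))")
    case True
    have s: "smooth_fun_at (line_product AB) (\<lambda>z. f (\<Psi> z)) (u, t)"
      by (rule smooth_at_compose[OF smooth_manifold_line_product[OF B] M smooth_manifold_std Psi_smooth[OF u] True])
    have "deriv (\<lambda>s. ?g (s + t)) 0 = deriv ?g t"
      unfolding deriv_def using DERIV_shift[where f = ?g and x = 0 and z = t] by simp
    then show ?thesis
      using True s by (simp add: circle_generator_def velocity_def push_forward_def line_vector_def comp_def
          bundle_action(1) theta_Psi[OF u])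
  next
    case False
    then show ?thesis by (simp add: circle_generator_def velocity_def push_forward_def bundle_action(1))
  qed
qed

text \<open>The angle of \<zeta> is a smooth fibre coordinate away from a branch cut.\<close>

lemma bundle_local_inverse:
  assumes p: "\<pi> p \<in> U"
  obtains \<tau> N where "open N" "p \<in> N" "\<And>q. q \<in> N \<Longrightarrow> \<pi> q \<in> U"
    "\<And>q. q \<in> N \<Longrightarrow> smooth_fun_at AM \<tau> q" "\<And>q. q \<in> N \<Longrightarrow> \<Psi> (\<pi> q, \<tau> q) = q"
proof -
  obtain t0 where t0: "p = \<Psi> (\<pi> p, t0)" using Psi_onto[OF p] by blast
  \<comment> \<open>This rotation sends \<zeta> at \<open>p\<close> to 1, away from the cut of
    \<open>Ln\<close> along the nonpositive reals.\<close>
  define c where "c = cis (- (2 * pi * t0))"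
  define S where "S = {z. z * c \<in> - \<real>\<^sub>\<le>\<^sub>0}"
  have S: "open S"
  proof -
    have "S = (\<lambda>z. z * c) -` (- \<real>\<^sub>\<le>\<^sub>0)" by (auto simp: S_def)
    then show ?thesis by (simp only:) (intro open_vimage open_Compl closed_nonpos_Reals_complex continuous_intros)
  qed
  define g where "g z = t0 + Im (Ln (z * c)) / (2 * pi)" for z
  have "smooth_on S (\<lambda>z. Ln (z * c))"
    by (rule smooth_on_compose[OF smooth_on_bounded_linear[OF bounded_linear_mult_left] smooth_on_Ln S])
       (auto simp: S_def intro!: open_Compl closed_nonpos_Reals_complex)
  then have "smooth_on S (\<lambda>z. Im (Ln (z * c)) / (2 * pi))"
    by (rule smooth_on_compose[OF _ smooth_on_bounded_linear[OF bounded_linear_compose[OF bounded_linear_divide bounded_linear_Im]] S open_UNIV])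
       simp
  then have g: "smooth_on S g" unfolding g_def by (intro smooth_on_add smooth_on_const S)
  have "\<zeta> p = cis (2 * pi * t0)" using zeta_Psi[OF p, of t0] t0 by simp
  then have "\<zeta> p * c = 1" by (simp add: c_def cis_mult)
  then have zp: "\<zeta> p \<in> S" by (simp add: S_def)
  have "\<forall>\<^sub>F q in nhds p. \<zeta> q \<in> S"
    by (rule smooth_at_compose_eventually[OF M smooth_manifold_std zeta_smooth[OF p] eventually_nhds_in_open[OF S zp]])
  moreover have "\<forall>\<^sub>F q in nhds p. \<pi> q \<in> U"
    by (rule smooth_at_compose_eventually[OF M B bundle_pi_smooth eventually_nhds_in_open[OF U p]])
  ultimately have "\<forall>\<^sub>F q in nhds p. \<zeta> q \<in> S \<and> \<pi> q \<in> U" by (rule eventually_conj)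
  then obtain N where N: "open N" "p \<in> N" "\<And>q. q \<in> N \<Longrightarrow> \<zeta> q \<in> S" "\<And>q. q \<in> N \<Longrightarrow> \<pi> q \<in> U"
    unfolding eventually_nhds by blast
  show thesis
  proof (rule that[of N "\<lambda>q. g (\<zeta> q)"])
    fix q assume q: "q \<in> N"
    show "smooth_fun_at AM (\<lambda>q. g (\<zeta> q)) q"
      by (rule smooth_at_compose[OF M smooth_manifold_std smooth_manifold_std zeta_smooth[OF N(4)[OF q]]
            smooth_at_std_std[OF S N(3)[OF q] g]])
    obtain t where t: "q = \<Psi> (\<pi> q, t)" using Psi_onto[OF N(4)[OF q]] by blast
    then have z: "\<zeta> q = cis (2 * pi * t)" using zeta_Psi[OF N(4)[OF q], of t] by simp
    have "norm (\<zeta> q * c) = 1" by (simp add: z c_def norm_mult)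
    note ln = cis_Im_Ln[OF this]
    have "2 * pi * g (\<zeta> q) = 2 * pi * t0 + Im (Ln (\<zeta> q * c))" by (simp add: g_def field_simps)
    then have "cis (2 * pi * g (\<zeta> q)) = cis (2 * pi * t0) * (\<zeta> q * c)" by (simp add: ln flip: cis_mult)
    also have "\<dots> = cis (2 * pi * t)" by (simp add: z c_def cis_mult)
    finally have "cis (2 * pi * g (\<zeta> q)) = cis (2 * pi * t)" .
    \<comment> \<open>Equality on the circle fixes the parameter only up to an integer, which \<Psi>
      does not see.\<close>
    from Psi_periodic[OF N(4)[OF q] this] t show "\<Psi> (\<pi> q, g (\<zeta> q)) = q" by simp
  qed (use N in auto)
qed

end

lemma line_fibration_circle_bundle: "line_fibration AB AM \<pi> (circle_generator AM \<theta>)"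
proof
  show "smooth_manifold AB" "smooth_manifold AM" "smooth_at AM AB \<pi> p" for p
    by (rule B M bundle_pi_smooth)+
  fix p
  obtain U \<Psi> and \<zeta> :: "'m \<Rightarrow> complex" where U: "open U" "\<pi> p \<in> U"
    and t: "\<And>u t. u \<in> U \<Longrightarrow> smooth_at (line_product AB) AM \<Psi> (u, t)"
      "\<And>p. \<pi> p \<in> U \<Longrightarrow> smooth_at AM std_atlas \<zeta> p"
      "\<And>u t. u \<in> U \<Longrightarrow> \<pi> (\<Psi> (u, t)) = u" "\<And>u t. u \<in> U \<Longrightarrow> \<zeta> (\<Psi> (u, t)) = cis (2 * pi * t)"
      "\<And>u s t. u \<in> U \<Longrightarrow> \<theta> s (\<Psi> (u, t)) = \<Psi> (u, s + t)"
      "\<And>p. \<pi> p \<in> U \<Longrightarrow> \<exists>t. p = \<Psi> (\<pi> p, t)"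
    by (rule bundle_trivialisation[of "\<pi> p"]) (rule that, (simp | blast)+)
  obtain \<tau> N where N: "open N" "p \<in> N" "\<And>q. q \<in> N \<Longrightarrow> \<pi> q \<in> U"
    "\<And>q. q \<in> N \<Longrightarrow> smooth_fun_at AM \<tau> q" "\<And>q. q \<in> N \<Longrightarrow> \<Psi> (\<pi> q, \<tau> q) = q"
    using bundle_local_inverse[OF U(1) t U(2)] by metis
  show "\<exists>\<Psi> \<tau> N. open N \<and> p \<in> N \<and> (\<forall>q\<in>N. smooth_fun_at AM \<tau> q \<and>
      smooth_at (line_product AB) AM \<Psi> (\<pi> q, \<tau> q) \<and> \<Psi> (\<pi> q, \<tau> q) = q \<and>
      (\<forall>\<^sub>F z in nhds (\<pi> q, \<tau> q). \<pi> (\<Psi> z) = fst z) \<and>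
      circle_generator AM \<theta> q = push_forward AM \<Psi> (\<pi> q, \<tau> q) (line_vector AB (\<pi> q, \<tau> q)))"
  proof (intro exI[of _ \<Psi>] exI[of _ \<tau>] exI[of _ N] conjI ballI N t(1))
    fix q assume q: "q \<in> N"
    have "\<forall>\<^sub>F z in nhds (\<pi> q, \<tau> q). z \<in> U \<times> UNIV"
      using U(1) N(3)[OF q] by (intro eventually_nhds_in_open open_Times) simp_all
    then show "\<forall>\<^sub>F z in nhds (\<pi> q, \<tau> q). \<pi> (\<Psi> z) = fst z"
      by eventually_elim (use t(3) in \<open>auto simp: mem_Times_iff\<close>)
    show "circle_generator AM \<theta> q = push_forward AM \<Psi> (\<pi> q, \<tau> q) (line_vector AB (\<pi> q, \<tau> q))"
      using circle_generator_eq[OF U(1) t N(3)[OF q], of "\<tau> q"] N(5)[OF q] by simp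
  qed
qed

text \<open>The dimensions are those of two unrelated model types. They are compared through smooth
  injections both ways: the local inverse (\<pi>, \<tau>), and \<Psi> on an interval of length
  1.\<close>

lemma circle_bundle_dimension: "DIM('f) = DIM('e) + 1"
proof -
  fix p :: 'm
  obtain U \<Psi> and \<zeta> :: "'m \<Rightarrow> complex" where U: "open U" "\<pi> p \<in> U"
    and t: "\<And>u t. u \<in> U \<Longrightarrow> smooth_at (line_product AB) AM \<Psi> (u, t)"
      "\<And>p. \<pi> p \<in> U \<Longrightarrow> smooth_at AM std_atlas \<zeta> p"
      "\<And>u t. u \<in> U \<Longrightarrow> \<pi> (\<Psi> (u, t)) = u" "\<And>u t. u \<in> U \<Longrightarrow> \<zeta> (\<Psi> (u, t)) = cis (2 * pi * t)"
      "\<And>u s t. u \<in> U \<Longrightarrow> \<theta> s (\<Psi> (u, t)) = \<Psi> (u, s + t)"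
      "\<And>p. \<pi> p \<in> U \<Longrightarrow> \<exists>t. p = \<Psi> (\<pi> p, t)"
    by (rule bundle_trivialisation[of "\<pi> p"]) (rule that, (simp | blast)+)
  obtain \<tau> N where N: "open N" "p \<in> N" "\<And>q. q \<in> N \<Longrightarrow> \<pi> q \<in> U"
    "\<And>q. q \<in> N \<Longrightarrow> smooth_fun_at AM \<tau> q" "\<And>q. q \<in> N \<Longrightarrow> \<Psi> (\<pi> q, \<tau> q) = q"
    using bundle_local_inverse[OF U(1) t U(2)] by metis
  note R = smooth_manifold_line_product[OF B]
  have "DIM('f) \<le> DIM('e \<times> real)"
  proof (rule manifold_dimension_le[OF M R N(1,2)])
    show "smooth_at AM (line_product AB) (\<lambda>q. (\<pi> q, \<tau> q)) q" if "q \<in> N" for q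
      by (rule smooth_at_Pair[OF M B smooth_manifold_std bundle_pi_smooth N(4)[OF that]])
    show "inj_on (\<lambda>q. (\<pi> q, \<tau> q)) N" by (rule inj_on_inverseI[of _ \<Psi>]) (rule N(5))
  qed
  moreover have "DIM('e \<times> real) \<le> DIM('f)"
  proof (rule manifold_dimension_le[OF R M])
    show "open (U \<times> {0 - 1 / 2<..<0 + 1 / 2 :: real})" by (intro open_Times U(1)) simp
    show "(\<pi> p, 0) \<in> U \<times> {0 - 1 / 2<..<0 + 1 / 2 :: real}" using U(2) by simp
    show "inj_on \<Psi> (U \<times> {0 - 1 / 2<..<0 + 1 / 2})" by (rule Psi_inj_on[OF U(1) t])
    show "smooth_at (line_product AB) AM \<Psi> z" if "z \<in> U \<times> {0 - 1 / 2<..<0 + 1 / 2 :: real}" for z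
      using t(1)[of "fst z" "snd z"] that by (simp add: mem_Times_iff)
  qed
  ultimately show ?thesis by simp
qed

end

text \<open>The curvature condition is given for vectors; \<open>ext_deriv_1_eq\<close> turns it
  into the condition on fields that the locale asks for.\<close>

lemma boothby_wang_connection_bundle:
  assumes B: "smooth_manifold AB" and M: "smooth_manifold AM"
    and bw: "boothby_wang_fibration AB AM \<eta> \<theta> \<pi> \<alpha>"
  shows "connection_bundle AB AM \<pi> (circle_generator AM \<theta>) \<alpha> \<eta>"
proof -
  have pb: "principal_circle_bundle AB AM \<theta> \<pi>" and form: "differential_form AM 1 \<alpha>"
    and axi: "\<And>p. \<alpha> p [circle_generator AM \<theta> p] = 1"
    and curv: "\<And>p vs. vs \<in> tangent_lists AM 2 p \<Longrightarrow> ext_deriv AM 1 \<alpha> p vs = pullback AB \<pi> \<eta> p vs"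
    using bw unfolding boothby_wang_fibration_def connection_form_def by blast+
  show ?thesis
  proof (rule line_fibration.connection_bundleI[OF line_fibration_circle_bundle[OF B M pb] bundle_surj[OF B M pb] form axi])
    fix p X Y assume X: "vfield_near AM p X" and Y: "vfield_near AM p Y"
    have "[X p, Y p] \<in> tangent_lists AM 2 p"
      using vfield_near_tangent[OF X] vfield_near_tangent[OF Y] by (simp add: tangent_lists_def)
    from curv[OF this] show "ext_deriv1 AM \<alpha> X Y p = \<eta> (\<pi> p) [push_forward AB \<pi> p (X p), push_forward AB \<pi> p (Y p)]"
      unfolding ext_deriv_1_eq[OF M form X Y] by (simp add: pullback_def)
  qed
qed

theorem theorem31:
  fixes AB :: "('b::{t2_space,second_countable_topology}, 'e::euclidean_space) atlas"
    and AM :: "('m::{t2_space,second_countable_topology}, 'f::euclidean_space) atlas"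
    and \<beta> \<eta> :: "'b dform" and W :: "'b vfield" and \<psi> :: "'b \<Rightarrow> 'b tvec \<Rightarrow> 'b tvec"
    and \<theta> :: "real \<Rightarrow> 'm \<Rightarrow> 'm" and \<pi> :: "'m \<Rightarrow> 'b"
    and \<alpha>1 \<alpha>2 :: "'m dform" and \<phi> :: "'m \<Rightarrow> 'm tvec \<Rightarrow> 'm tvec"
    and h k :: nat
  assumes "smooth_manifold AB" and "compact (UNIV :: 'b set)"
    and "almost_contact_symplectic_structure AB h k \<beta> \<eta> W \<psi>"
    and "represents_integral_class AB \<eta>"
    and "smooth_manifold AM"
    and "boothby_wang_fibration AB AM \<eta> \<theta> \<pi> \<alpha>1"
    and "\<alpha>2 = pullback AB \<pi> \<beta>"
    and "\<phi> = lifted_endomorphism AB AM \<pi> \<alpha>1 \<psi>"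
    and "\<And>b X Y. X \<in> tangent_space AB b \<Longrightarrow> Y \<in> tangent_space AB b \<Longrightarrow>
           \<eta> b [\<psi> b X, \<psi> b Y] = \<eta> b [X, Y]"
    and "decomposable AB \<beta> \<eta> \<psi>"
  shows "normal_contact_pair_structure AM k h \<alpha>1 \<alpha>2 \<phi> \<longleftrightarrow>
         normal_almost_contact_structure AB \<beta> W \<psi>"
proof -
  interpret lifted_contact_structure AB AM \<pi> "circle_generator AM \<theta>" \<alpha>1 \<eta> \<beta> W \<psi>
    by (rule lifted_contact_structureI[OF assms(3,9) boothby_wang_connection_bundle[OF assms(1,5,6)]])
  have cs: "contact_symplectic_pair AB h k \<beta> \<eta>"
    using assms(3) unfolding almost_contact_symplectic_structure_def by blast
  have "principal_circle_bundle AB AM \<theta> \<pi>" using assms(6) unfolding boothby_wang_fibration_def by blast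
  from normal_contact_pair_structure_iff[OF cs circle_bundle_dimension[OF assms(1,5) this]]
  show ?thesis
    unfolding assms(7,8) normal_almost_contact_structure_iff[OF assms(1,3)] .
qed

end
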